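(* Let $b>0$, $E_{\mathrm{i}b}=\mathbb{C}/(\mathbb{Z}+\mathrm{i}b\,\mathbb{Z})$, let $n\ge 1$ be an integer, let $\rho\in(8\pi(n-1),8\pi n)$, and let $u$ be a solution of $\Delta u+e^u=\rho\delta_0$ on $E_{\mathrm{i}b}$ which is axisymmetric, i.e. $u(z)=u(-z)=u(\bar z)$. Then the problem $$\begin{cases}\Delta\phi+e^{u}\phi=0\quad\text{on }E_{\mathrm{i}b},\\ \phi(z)=\phi(-z)=\phi(\bar z)\end{cases}$$ has only the trivial solution $\phi\equiv 0$.
   Context: Write $z=x+\mathrm{i}y$, $\Delta=\partial_x^2+\partial_y^2=4\partial_z\partial_{\bar z}$, and let $\delta_0$ be the Dirac measure at $0$. A solution $u$ of $\Delta u+e^u=\rho\delta_0$ on $E_{\mathrm{i}b}$ is a real-valued function on $E_{\mathrm{i}b}\setminus\{0\}$ satisfying the equation in the sense of distributions; by elliptic regularity this means that $u$ is $C^2$ on $E_{\mathrm{i}b}\setminus\{0\}$ with $\Delta u+e^u=0$ there, and $u(z)=4\eta\log|z|+v(z)$ near $z=0$ with $v$ of class $C^2$ at $0$, where $\eta=\rho/(8\pi)$. In particular $e^u$ extends continuously to $E_{\mathrm{i}b}$ with value $0$ at $0$. The functions $\phi$ are real-valued and $C^2$ on $E_{\mathrm{i}b}$. *)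

theory Defs
  imports "HOL-Analysis.Analysis"
begin

definition dir_deriv :: "complex \<Rightarrow> (complex \<Rightarrow> real) \<Rightarrow> complex \<Rightarrow> real" where
  "dir_deriv d f z = frechet_derivative f (at z) d"

text \<open>
  For open \<open>S\<close> this is the usual class of \<open>k\<close> times continuously (real) differentiable functions:
  the derivative is linear in the direction, so it suffices to require continuity of all
  directional derivatives.
\<close>

primrec Ck_on :: "nat \<Rightarrow> complex set \<Rightarrow> (complex \<Rightarrow> real) \<Rightarrow> bool" where
  "Ck_on 0 S f \<longleftrightarrow> continuous_on S f"
| "Ck_on (Suc k) S f \<longleftrightarrow>
     (\<forall>z\<in>S. f differentiable (at z)) \<and> (\<forall>d. Ck_on k S (dir_deriv d f))"

definition laplacian :: "(complex \<Rightarrow> real) \<Rightarrow> complex \<Rightarrow> real" where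
  "laplacian f z = dir_deriv 1 (dir_deriv 1 f) z + dir_deriv \<i> (dir_deriv \<i> f) z"

definition lattice :: "real \<Rightarrow> complex set" where
  "lattice b = {of_int m + \<i> * of_real b * of_int k | m k. True}"

text \<open>
  Functions on the torus \<open>\<complex> / lattice b\<close>, or on the torus minus the point \<open>0\<close>, are represented by
  their lifts to \<open>\<complex>\<close>, or to the complement of \<open>lattice b\<close>. For functions on the punctured torus,
  the values of the total HOL function at lattice points are irrelevant, and so
  \<open>periodic_on\<close> and \<open>axisymmetric_on\<close> take the domain of the lift as a parameter.
\<close>

definition periodic_on :: "real \<Rightarrow> complex set \<Rightarrow> (complex \<Rightarrow> real) \<Rightarrow> bool" where
  "periodic_on b S f \<longleftrightarrow> (\<forall>z\<in>S. \<forall>w\<in>lattice b. f (z + w) = f z)"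

definition axisymmetric_on :: "complex set \<Rightarrow> (complex \<Rightarrow> real) \<Rightarrow> bool" where
  "axisymmetric_on S f \<longleftrightarrow> (\<forall>z\<in>S. f z = f (- z) \<and> f z = f (cnj z))"

text \<open>
  Solutions of \<open>\<Delta>u + e\<^sup>u = \<rho> \<delta>\<^sub>0\<close> on the torus. The distributional equation is expressed in its
  classical form (equivalent by elliptic regularity): the equation holds pointwise away from
  \<open>0\<close>, and \<open>u(z) = 4 \<eta> log|z| + v(z)\<close> near \<open>0\<close> with \<open>\<eta> = \<rho> / (8 \<pi>)\<close> and \<open>v\<close> of class \<open>C\<^sup>2\<close>. The
  logarithmic term carries the Dirac mass, since \<open>\<Delta> log|z| = 2 \<pi> \<delta>\<^sub>0\<close>.
\<close>

definition mean_field_solution :: "real \<Rightarrow> real \<Rightarrow> (complex \<Rightarrow> real) \<Rightarrow> bool" where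
  "mean_field_solution b \<rho> u \<longleftrightarrow>
     periodic_on b (- lattice b) u \<and>
     Ck_on 2 (- lattice b) u \<and>
     (\<forall>z. z \<notin> lattice b \<longrightarrow> laplacian u z + exp (u z) = 0) \<and>
     (\<exists>v r. r > 0 \<and> Ck_on 2 (ball 0 r) v \<and>
        (\<forall>z\<in>ball 0 r - {0}. u z = 4 * (\<rho> / (8 * pi)) * ln (norm z) + v z))"

text \<open>
  The continuous extension of \<open>e\<^sup>u\<close> to the whole torus; its value at \<open>0\<close> is \<open>0\<close> because \<open>\<rho> > 0\<close>.
\<close>

definition exp_ext :: "real \<Rightarrow> (complex \<Rightarrow> real) \<Rightarrow> complex \<Rightarrow> real" where
  "exp_ext b u z = (if z \<in> lattice b then 0 else exp (u z))"

definition axisymmetric_linearized_solution ::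
    "real \<Rightarrow> (complex \<Rightarrow> real) \<Rightarrow> (complex \<Rightarrow> real) \<Rightarrow> bool" where
  "axisymmetric_linearized_solution b u \<phi> \<longleftrightarrow>
     periodic_on b UNIV \<phi> \<and>
     Ck_on 2 UNIV \<phi> \<and>
     (\<forall>z. laplacian \<phi> z + exp_ext b u z * \<phi> z = 0) \<and>
     axisymmetric_on UNIV \<phi>"

end

theory Submission
  imports Defs "HOL-Complex_Analysis.Complex_Analysis"
begin

text \<open>
  For a solution \<open>u\<close>, the function \<open>Q = u\<^sub>z\<^sup>2/4 - u\<^sub>z\<^sub>z/2\<close> is elliptic with a double pole at \<open>0\<close>, and for a
  solution \<open>\<phi>\<close> of the linearized problem \<open>\<phi>\<^sub>z\<^sub>z - u\<^sub>z \<phi>\<^sub>z\<close> is elliptic without poles, hence a real constant \<open>c\<close>.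
  If \<open>c = 0\<close>, then \<open>\<phi>\<close> satisfies a first order linear system and vanishes as soon as it vanishes at
  the center of the rectangle.

  To exclude \<open>c \<noteq> 0\<close>, consider \<open>y'' = (Q + \<epsilon>) y\<close> with a formal parameter \<open>\<epsilon>\<close>. Let \<open>x\<^sub>1, x\<^sub>2\<close> and \<open>y\<^sub>1, y\<^sub>2\<close> be the
  even and odd real solutions on the horizontal and on the vertical edge issuing from the center,
  evaluated at the other end of the edge, and let \<open>A = x\<^sub>1 x\<^sub>1'\<close>, \<open>C = x\<^sub>2 x\<^sub>2'\<close>, \<open>A* = y\<^sub>1 y\<^sub>1'\<close>, \<open>C* = y\<^sub>2 y\<^sub>2'\<close>.
  The half-turn monodromy at \<open>0\<close> does not depend on \<open>\<epsilon>\<close>, which gives \<open>A C* + C A* = - sin(\<pi>\<eta>) / 2\<close>. The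
  existence of \<open>u\<close> and \<open>\<phi>\<close> says that \<open>A C* - C A*\<close> vanishes to second order in \<open>\<epsilon>\<close>; so \<open>A C*\<close> and \<open>C A*\<close> have
  the same nonzero value, vanishing first and opposite second derivatives, and the second
  logarithmic derivatives of \<open>A C*\<close> and \<open>C A*\<close> add up to zero. But each of the eight factors is, as a
  function of \<open>\<epsilon>\<close>, strictly logarithmically concave: as the characteristic function of a
  Sturm-Liouville problem it has only real zeros, and the concavity is an explicit integral of a square.
\<close>

section \<open>Real second order equations and formal parameter derivatives\<close>

text \<open>The equation \<open>y'' = Q y\<close> is the one that e^(-u/2) solves in the variable z,
  and replacing u by u + t \<phi> changes Q by -(t/2)(\<phi>_zz - u_z \<phi>_z) + O(t^2). If c is
  nonzero, a suitable multiple of \<phi> therefore moves Q, to first order, by exactly \<epsilon>.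
  The center is the base point because u is regular and critical there and both edges leave from it:
  on either edge the even product is k times the odd product with the same k = -exp(u(center))/8,
  and for nonzero c the first variations of these two factors agree as well. This shared factor is
  the source of the second order vanishing. The restriction on \<rho> enters as sin(\<pi>\<eta>)
  \<noteq> 0, which keeps the two products away from zero. The parameter is formal because only its
  coefficients of order 0, 1 and 2 matter, so that analytic dependence on \<epsilon> never has to be
  discussed.\<close>

lemma gronwall_zero:
  fixes e e' :: "real \<Rightarrow> real"
  assumes der: "\<And>t. t \<in> {a..b} \<Longrightarrow> (e has_real_derivative e' t) (at t)"
    and bound: "\<And>t. t \<in> {a..b} \<Longrightarrow> \<bar>e' t\<bar> \<le> K * e t"
    and nonneg: "\<And>t. t \<in> {a..b} \<Longrightarrow> 0 \<le> e t"
    and zero: "t0 \<in> {a..b}" "e t0 = 0" and t: "t \<in> {a..b}"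
  shows "e t = 0"
proof (cases "t0 \<le> t")
  case True
  have "e t * exp (- K * t) \<le> e t0 * exp (- K * t0)"
  proof (rule DERIV_nonpos_imp_nonincreasing[OF True])
    fix x assume "t0 \<le> x" "x \<le> t"
    then have x: "x \<in> {a..b}" using zero t by auto
    have "((\<lambda>t. e t * exp (- K * t)) has_real_derivative (e' x - K * e x) * exp (- K * x)) (at x)"
      by (auto intro!: derivative_eq_intros der[OF x] simp: algebra_simps)
    moreover have "(e' x - K * e x) * exp (- K * x) \<le> 0"
      using bound[OF x] by (intro mult_nonpos_nonneg) auto
    ultimately show "\<exists>y. ((\<lambda>t. e t * exp (- K * t)) has_real_derivative y) (at x) \<and> y \<le> 0" by blast
  qed
  then have "e t * exp (- K * t) \<le> 0" using zero by simp
  then have "e t \<le> 0" by (metis exp_gt_zero mult_pos_pos not_le)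
  then show ?thesis using nonneg[OF t] by simp
next
  case False
  then have tt: "t \<le> t0" by simp
  have "e t * exp (K * t) \<le> e t0 * exp (K * t0)"
  proof (rule DERIV_nonneg_imp_nondecreasing[OF tt])
    fix x assume "t \<le> x" "x \<le> t0"
    then have x: "x \<in> {a..b}" using zero t by auto
    have "((\<lambda>t. e t * exp (K * t)) has_real_derivative (e' x + K * e x) * exp (K * x)) (at x)"
      by (auto intro!: derivative_eq_intros der[OF x] simp: algebra_simps)
    moreover have "(e' x + K * e x) * exp (K * x) \<ge> 0"
      using bound[OF x] by (intro mult_nonneg_nonneg) auto
    ultimately show "\<exists>y. ((\<lambda>t. e t * exp (K * t)) has_real_derivative y) (at x) \<and> 0 \<le> y" by blast
  qed
  then have "e t * exp (K * t) \<le> 0" using zero by simp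
  then have "e t \<le> 0" by (metis exp_gt_zero mult_pos_pos not_le)
  then show ?thesis using nonneg[OF t] by simp
qed

text \<open>The energy \<open>(d t)\<^sup>2 + (dd t)\<^sup>2\<close> satisfies a Gronwall inequality
  with constant 1 + sup |q|, so zero data propagate from \<open>t0\<close> in both
  directions.\<close>

lemma linear_ode_unique:
  fixes d dd q :: "real \<Rightarrow> real"
  assumes d: "\<And>t. t \<in> {a..b} \<Longrightarrow> (d has_real_derivative dd t) (at t)"
    and dd: "\<And>t. t \<in> {a..b} \<Longrightarrow> (dd has_real_derivative q t * d t) (at t)"
    and q: "continuous_on {a..b} q"
    and zero: "t0 \<in> {a..b}" "d t0 = 0" "dd t0 = 0" and t: "t \<in> {a..b}"
  shows "d t = 0 \<and> dd t = 0"
proof -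
  have "bounded (q ` {a..b})"
    using compact_continuous_image[OF q] compact_Icc compact_imp_bounded by blast
  then obtain M where M: "\<And>t. t \<in> {a..b} \<Longrightarrow> \<bar>q t\<bar> \<le> M"
    unfolding bounded_iff by force
  have "(d t)\<^sup>2 + (dd t)\<^sup>2 = 0"
  proof (rule gronwall_zero[where e = "\<lambda>t. (d t)\<^sup>2 + (dd t)\<^sup>2" and K = "1 + M"
        and e' = "\<lambda>t. 2 * d t * dd t * (1 + q t)"])
    fix t assume t: "t \<in> {a..b}"
    show "((\<lambda>t. (d t)\<^sup>2 + (dd t)\<^sup>2) has_real_derivative 2 * d t * dd t * (1 + q t)) (at t)"
      by (auto intro!: derivative_eq_intros d[OF t] dd[OF t] simp: algebra_simps)
    have "2 * \<bar>d t * dd t\<bar> \<le> (d t)\<^sup>2 + (dd t)\<^sup>2"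
      using sum_squares_bound[of "\<bar>d t\<bar>" "\<bar>dd t\<bar>"] by (simp add: abs_mult)
    moreover have "\<bar>1 + q t\<bar> \<le> 1 + M" using M[OF t] by linarith
    ultimately have "(2 * \<bar>d t * dd t\<bar>) * \<bar>1 + q t\<bar> \<le> ((d t)\<^sup>2 + (dd t)\<^sup>2) * (1 + M)"
      by (intro mult_mono) auto
    moreover have "\<bar>2 * d t * dd t * (1 + q t)\<bar> = (2 * \<bar>d t * dd t\<bar>) * \<bar>1 + q t\<bar>"
      unfolding abs_mult by simp
    ultimately show "\<bar>2 * d t * dd t * (1 + q t)\<bar> \<le> (1 + M) * ((d t)\<^sup>2 + (dd t)\<^sup>2)"
      by (simp only: mult.commute)
  qed (use zero t in auto)
  then show ?thesis by (simp add: sum_power2_eq_zero_iff)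
qed

text \<open>Here \<open>x0\<close>, \<open>x1\<close>, \<open>x2\<close> are the first coefficients
  in \<epsilon> of a solution of x'' = (q + k \<epsilon>) x with initial data free of \<epsilon>,
  and \<open>m0\<close>, \<open>m1\<close>, \<open>m2\<close> those of its Wronskian m with a fixed
  solution \<open>P\<close> of the unperturbed equation. The quantity
  \<open>(m1 L)\<^sup>2 - 2 * m0 L * m2 L\<close> is (dm/d\<epsilon>)^2 - m d^2m/d\<epsilon>^2 at
  \<epsilon> = 0. It equals the integral of 2 P^2 J, where J is the integral of x0^2. Prescribing
  \<open>P\<close> at \<open>L\<close> turns m into the end value of x or of x'.\<close>

lemma tower_turan:
  fixes q x0 x1 x2 dx0 dx1 dx2 P dP :: "real \<Rightarrow> real"
  assumes L: "L > 0" and k: "k\<^sup>2 = (1::real)"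
    and x0: "\<And>t. t \<in> {0..L} \<Longrightarrow> (x0 has_real_derivative dx0 t) (at t)"
    and dx0: "\<And>t. t \<in> {0..L} \<Longrightarrow> (dx0 has_real_derivative q t * x0 t) (at t)"
    and x1: "\<And>t. t \<in> {0..L} \<Longrightarrow> (x1 has_real_derivative dx1 t) (at t)"
    and dx1: "\<And>t. t \<in> {0..L} \<Longrightarrow> (dx1 has_real_derivative q t * x1 t + k * x0 t) (at t)"
    and x2: "\<And>t. t \<in> {0..L} \<Longrightarrow> (x2 has_real_derivative dx2 t) (at t)"
    and dx2: "\<And>t. t \<in> {0..L} \<Longrightarrow> (dx2 has_real_derivative q t * x2 t + k * x1 t) (at t)"
    and P: "\<And>t. t \<in> {0..L} \<Longrightarrow> (P has_real_derivative dP t) (at t)"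
    and dP: "\<And>t. t \<in> {0..L} \<Longrightarrow> (dP has_real_derivative q t * P t) (at t)"
    and init: "x1 0 = 0" "dx1 0 = 0" "x2 0 = 0" "dx2 0 = 0"
  defines "m0 \<equiv> \<lambda>t. x0 t * dP t - dx0 t * P t"
    and "m1 \<equiv> \<lambda>t. x1 t * dP t - dx1 t * P t"
    and "m2 \<equiv> \<lambda>t. x2 t * dP t - dx2 t * P t"
  shows "(m1 L)\<^sup>2 - 2 * m0 L * m2 L \<ge> 0"
    and "x0 0 \<noteq> 0 \<Longrightarrow> P L \<noteq> 0 \<Longrightarrow> (m1 L)\<^sup>2 - 2 * m0 L * m2 L > 0"
proof -
  define J where "J = (\<lambda>t. k * (x0 t * dx1 t - dx0 t * x1 t))"
  define e where "e = (\<lambda>t. (m1 t)\<^sup>2 - 2 * m0 t * m2 t)"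
  have kk: "k * k = 1" using k by (simp add: power2_eq_square)
  have dJ: "(J has_real_derivative (x0 t)\<^sup>2) (at t)" if t: "t \<in> {0..L}" for t
    unfolding J_def using kk
    by (auto intro!: derivative_eq_intros x0[OF t] dx0[OF t] x1[OF t] dx1[OF t]
        simp: algebra_simps power2_eq_square)
  have dm0: "(m0 has_real_derivative 0) (at t)" if t: "t \<in> {0..L}" for t
    unfolding m0_def by (auto intro!: derivative_eq_intros x0[OF t] dx0[OF t] P[OF t] dP[OF t])
  have dm1: "(m1 has_real_derivative - k * x0 t * P t) (at t)" if t: "t \<in> {0..L}" for t
    unfolding m1_def
    by (auto intro!: derivative_eq_intros x1[OF t] dx1[OF t] P[OF t] dP[OF t] simp: algebra_simps)
  have dm2: "(m2 has_real_derivative - k * x1 t * P t) (at t)" if t: "t \<in> {0..L}" for t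
    unfolding m2_def
    by (auto intro!: derivative_eq_intros x2[OF t] dx2[OF t] P[OF t] dP[OF t] simp: algebra_simps)
  \<comment> \<open>The \<open>dP\<close> terms cancel in \<open>m0 t * x1 t - m1 t * x0 t\<close>,
    leaving \<open>P t\<close> times the Wronskian of \<open>x0\<close> and
    \<open>x1\<close>.\<close>
  have de: "(e has_real_derivative 2 * (P t)\<^sup>2 * J t) (at t)" if t: "t \<in> {0..L}" for t
  proof -
    have "(e has_real_derivative 2 * m1 t * (- k * x0 t * P t) - 2 * m0 t * (- k * x1 t * P t)) (at t)"
      unfolding e_def by (auto intro!: derivative_eq_intros dm0[OF t] dm1[OF t] dm2[OF t])
    moreover have "2 * m1 t * (- k * x0 t * P t) - 2 * m0 t * (- k * x1 t * P t) = 2 * (P t)\<^sup>2 * J t"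
      unfolding m0_def m1_def J_def by (simp add: algebra_simps power2_eq_square)
    ultimately show ?thesis by simp
  qed
  have J0: "J 0 = 0" and e0: "e 0 = 0" using init by (auto simp: J_def e_def m1_def m2_def)
  have Jmono: "J s \<le> J t" if "0 \<le> s" "s \<le> t" "t \<le> L" for s t
    by (rule DERIV_nonneg_imp_nondecreasing[OF \<open>s \<le> t\<close>]) (use that in \<open>auto intro!: exI dJ\<close>)
  then have Jnn: "0 \<le> J t" if "t \<in> {0..L}" for t using that J0 by fastforce
  have emono: "e s \<le> e t" if "0 \<le> s" "s \<le> t" "t \<le> L" for s t
    by (rule DERIV_nonneg_imp_nondecreasing[OF \<open>s \<le> t\<close>]) (use that Jnn in \<open>auto intro!: exI de\<close>)
  have "0 \<le> e L" using emono[of 0 L] e0 L by simp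
  then show "(m1 L)\<^sup>2 - 2 * m0 L * m2 L \<ge> 0" by (simp add: e_def)
  show "(m1 L)\<^sup>2 - 2 * m0 L * m2 L > 0" if x00: "x0 0 \<noteq> 0" and PL: "P L \<noteq> 0"
  proof -
    \<comment> \<open>For strictness, \<open>J\<close> becomes positive immediately after 0 and
      stays so, while \<open>P\<close> has no zero on a final piece of the interval; on that piece
      \<open>e\<close> increases strictly.\<close>
    have "isCont x0 0" using x0[of 0] L by (auto intro: DERIV_isCont)
    then obtain s where s: "s > 0" "\<And>t. \<bar>t\<bar> < s \<Longrightarrow> x0 t \<noteq> 0"
      using continuous_at_avoid[of 0 x0 0] x00 by (auto simp: dist_real_def)
    define s' where "s' = min (s/2) (L/2)"
    have s': "0 < s'" "s' < L" "s' < s" using s L by (auto simp: s'_def)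
    have "J 0 < J s'"
      by (rule DERIV_pos_imp_increasing[OF s'(1)]) (use s s' in \<open>auto intro!: exI dJ\<close>)
    then have Jpos: "J t > 0" if "s' \<le> t" "t \<le> L" for t using Jmono[of s' t] that s' J0 by linarith
    have "isCont P L" using P[of L] L by (auto intro: DERIV_isCont)
    then obtain r where r: "r > 0" "\<And>t. \<bar>t - L\<bar> < r \<Longrightarrow> P t \<noteq> 0"
      using continuous_at_avoid[of L P 0] PL by (auto simp: dist_real_def abs_minus_commute)
    define r' where "r' = max s' (L - r/2)"
    have r': "s' \<le> r'" "r' < L" "L - r < r'" "0 \<le> r'" using r s' by (auto simp: r'_def)
    have "e r' < e L"
      by (rule DERIV_pos_imp_increasing[OF r'(2)])
         (use r r' Jpos in \<open>auto intro!: exI de mult_pos_pos\<close>)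
    then show ?thesis using emono[of 0 r'] e0 r' by (simp add: e_def)
  qed
qed

lemma antiderivative_on_interval:
  fixes f :: "real \<Rightarrow> real"
  assumes "L > 0" "continuous_on {0..L} f"
  obtains F where "F 0 = 0" "\<And>t. t \<in> {0..L} \<Longrightarrow> (F has_real_derivative f t) (at t)"
proof -
  \<comment> \<open>Clamping the argument extends \<open>f\<close> continuously past both ends, so
    the derivative at 0 and at \<open>L\<close> is two-sided.\<close>
  define g where "g = (\<lambda>t. f (max 0 (min L t)))"
  have g: "continuous_on {- 1..L + 1} g"
    unfolding g_def using assms
    by (intro continuous_on_compose2[OF assms(2)] continuous_intros) auto
  define G where "G = (\<lambda>t. integral {- 1..t} g)"
  have "(G has_real_derivative f t) (at t)" if "t \<in> {0..L}" for t
  proof -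
    have "(G has_real_derivative g t) (at t within {- 1..L + 1})"
      unfolding G_def using that by (intro integral_has_real_derivative[OF g]) auto
    moreover have "t \<in> interior {- 1..L + 1}" using that by simp
    ultimately show ?thesis using that at_within_interior by (fastforce simp: g_def)
  qed
  then show thesis
    by (intro that[of "\<lambda>t. G t - G 0"]) (auto intro!: derivative_eq_intros)
qed

text \<open>
  With \<open>r = e\<^bsup>-U/4\<^esup>\<close> and \<open>\<psi>' = \<omega> e\<^bsup>U/2\<^esup>\<close>, \<open>\<omega>\<^sup>2 = 1/8\<close>, the functions \<open>r cos \<psi>\<close> and \<open>r sin \<psi>\<close> solve
  \<open>x'' = q x\<close>; replacing \<open>U\<close> by \<open>U + \<epsilon> \<Theta>\<close> changes \<open>q\<close> to \<open>q + k \<epsilon> + O(\<epsilon>\<^sup>2)\<close>, and the first order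
  terms \<open>P1\<close>, \<open>S1\<close> in \<open>\<epsilon>\<close> of these two functions give the tower at order one.
\<close>

lemma edge_ratio:
  fixes U U' U'' \<Theta> \<Theta>' \<Theta>'' a0 da0 a1 da1 b0 db0 b1 db1 q :: "real \<Rightarrow> real"
  assumes L: "L > 0"
    and U: "\<And>t. t \<in> {0..L} \<Longrightarrow> (U has_real_derivative U' t) (at t)"
    and U': "\<And>t. t \<in> {0..L} \<Longrightarrow> (U' has_real_derivative U'' t) (at t)"
    and \<Theta>: "\<And>t. t \<in> {0..L} \<Longrightarrow> (\<Theta> has_real_derivative \<Theta>' t) (at t)"
    and \<Theta>': "\<And>t. t \<in> {0..L} \<Longrightarrow> (\<Theta>' has_real_derivative \<Theta>'' t) (at t)"
    and cq: "continuous_on {0..L} q"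
    and q: "\<And>t. t \<in> {0..L} \<Longrightarrow> q t = (U' t)\<^sup>2 / 16 - U'' t / 4 - exp (U t) / 8"
    and \<Theta>eq: "\<And>t. t \<in> {0..L} \<Longrightarrow> 2 * \<Theta>'' t - U' t * \<Theta>' t + exp (U t) * \<Theta> t = - 8 * k"
    and ends: "U' 0 = 0" "U' L = 0" "\<Theta>' 0 = 0" "\<Theta>' L = 0"
    and a0: "\<And>t. t \<in> {0..L} \<Longrightarrow> (a0 has_real_derivative da0 t) (at t)"
    and da0: "\<And>t. t \<in> {0..L} \<Longrightarrow> (da0 has_real_derivative q t * a0 t) (at t)"
    and a1: "\<And>t. t \<in> {0..L} \<Longrightarrow> (a1 has_real_derivative da1 t) (at t)"
    and da1: "\<And>t. t \<in> {0..L} \<Longrightarrow> (da1 has_real_derivative q t * a1 t + k * a0 t) (at t)"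
    and b0: "\<And>t. t \<in> {0..L} \<Longrightarrow> (b0 has_real_derivative db0 t) (at t)"
    and db0: "\<And>t. t \<in> {0..L} \<Longrightarrow> (db0 has_real_derivative q t * b0 t) (at t)"
    and b1: "\<And>t. t \<in> {0..L} \<Longrightarrow> (b1 has_real_derivative db1 t) (at t)"
    and db1: "\<And>t. t \<in> {0..L} \<Longrightarrow> (db1 has_real_derivative q t * b1 t + k * b0 t) (at t)"
    and init: "a0 0 = 1" "da0 0 = 0" "a1 0 = 0" "da1 0 = 0" "b0 0 = 0" "db0 0 = 1" "b1 0 = 0" "db1 0 = 0"
  defines "k0 \<equiv> - exp (U 0) / 8"
  shows "a0 L * da0 L = k0 * (b0 L * db0 L)"
    and "a0 L * da1 L + a1 L * da0 L = k0 * (b0 L * db1 L + b1 L * db0 L) + \<Theta> 0 * k0 * (b0 L * db0 L)"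
proof -
  define \<omega> :: real where "\<omega> = sqrt (1/8)"
  have \<omega>: "\<omega> * \<omega> = 1/8" "\<omega> > 0" by (auto simp: \<omega>_def)
  define r where "r = (\<lambda>t. exp (- U t / 4))"
  define w where "w = (\<lambda>t. \<omega> * exp (U t / 2))"
  have rr: "r t * (w t * w t) = r t * exp (U t) / 8" "r t * r t * w t = \<omega>" for t
  proof -
    have "w t * w t = (\<omega> * \<omega>) * (exp (U t / 2) * exp (U t / 2))" by (simp add: w_def)
    also have "\<dots> = exp (U t) / 8" unfolding \<omega> exp_add[symmetric] by simp
    finally show "r t * (w t * w t) = r t * exp (U t) / 8" by simp
    have "r t * r t * w t = \<omega> * (exp (- U t / 4) * exp (- U t / 4) * exp (U t / 2))"
      by (simp add: r_def w_def)
    also have "\<dots> = \<omega>" unfolding exp_add[symmetric] by simp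
    finally show "r t * r t * w t = \<omega>" .
  qed
  have contU: "continuous_on {0..L} U" and cont\<Theta>: "continuous_on {0..L} \<Theta>"
    using U \<Theta> by (meson DERIV_isCont continuous_at_imp_continuous_on)+
  have "continuous_on {0..L} w" unfolding w_def by (intro continuous_intros contU) auto
  from antiderivative_on_interval[OF L this] obtain \<psi>
    where \<psi>: "\<psi> 0 = 0" "\<And>t. t \<in> {0..L} \<Longrightarrow> (\<psi> has_real_derivative w t) (at t)" by blast
  \<comment> \<open>The integrand is the first variation of the phase speed \<open>w\<close> when
    \<open>U\<close> moves in direction \<open>\<Theta>\<close>; hence \<open>\<psi>1\<close> is the
    first variation of the phase \<open>\<psi>\<close>.\<close>
  have "continuous_on {0..L} (\<lambda>t. w t * \<Theta> t / 2)"
    unfolding w_def by (intro continuous_intros contU cont\<Theta>) auto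
  from antiderivative_on_interval[OF L this] obtain \<psi>1
    where \<psi>1: "\<psi>1 0 = 0" "\<And>t. t \<in> {0..L} \<Longrightarrow> (\<psi>1 has_real_derivative w t * \<Theta> t / 2) (at t)"
    by blast
  define P where "P = (\<lambda>t. r t * cos (\<psi> t))"
  define S where "S = (\<lambda>t. r t * sin (\<psi> t))"
  define dP where "dP = (\<lambda>t. (- 1 / 4) * (U' t * P t) - w t * S t)"
  define dS where "dS = (\<lambda>t. (- 1 / 4) * (U' t * S t) + w t * P t)"
  define P1 where "P1 = (\<lambda>t. (- 1 / 4) * (\<Theta> t * P t) - \<psi>1 t * S t)"
  define S1 where "S1 = (\<lambda>t. (- 1 / 4) * (\<Theta> t * S t) + \<psi>1 t * P t)"
  define dP1 where "dP1 = (\<lambda>t. (- 1 / 4) * (\<Theta>' t * P t + \<Theta> t * dP t) - (1 / 2) * (w t * \<Theta> t * S t) - \<psi>1 t * dS t)"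
  define dS1 where "dS1 = (\<lambda>t. (- 1 / 4) * (\<Theta>' t * S t + \<Theta> t * dS t) + (1 / 2) * (w t * \<Theta> t * P t) + \<psi>1 t * dP t)"
  have ww: "w t * w t = exp (U t) / 8" for t
    using rr(1)[of t] by (simp add: r_def)
  have w: "(w has_real_derivative w t * U' t / 2) (at t)" if t: "t \<in> {0..L}" for t
    unfolding w_def by (auto intro!: derivative_eq_intros U[OF t])
  have P: "(P has_real_derivative dP t) (at t)" and S: "(S has_real_derivative dS t) (at t)"
    if t: "t \<in> {0..L}" for t
    unfolding P_def S_def dP_def dS_def r_def
    by (auto intro!: derivative_eq_intros U[OF t] \<psi>(2)[OF t] simp: field_simps)
  have qq: "q t = (U' t)\<^sup>2 / 16 - U'' t / 4 - w t * w t" if "t \<in> {0..L}" for t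
    using q[OF that] ww by simp
  have dP: "(dP has_real_derivative q t * P t) (at t)" and dS: "(dS has_real_derivative q t * S t) (at t)"
    if t: "t \<in> {0..L}" for t
    unfolding dP_def dS_def
    by (auto intro!: derivative_eq_intros U'[OF t] P[OF t] S[OF t] w[OF t]
        simp: dP_def dS_def qq[OF t] field_simps power2_eq_square)
  have P1: "(P1 has_real_derivative dP1 t) (at t)" and S1: "(S1 has_real_derivative dS1 t) (at t)"
    if t: "t \<in> {0..L}" for t
    unfolding P1_def S1_def
    by (auto intro!: derivative_eq_intros \<Theta>[OF t] P[OF t] S[OF t] \<psi>1(2)[OF t]
        simp: dP1_def dS1_def field_simps)
  \<comment> \<open>The right-hand side is the first variation of \<open>q\<close> in direction
    \<open>\<Theta>\<close>; the hypothesis \<open>\<Theta>eq\<close> says that it is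
    constant.\<close>
  have kk: "k = (- 2 * \<Theta>'' t + U' t * \<Theta>' t - 8 * (w t * w t) * \<Theta> t) / 8" if "t \<in> {0..L}" for t
    using \<Theta>eq[OF that] unfolding ww by (simp add: field_simps)
  have dP1: "(dP1 has_real_derivative q t * P1 t + k * P t) (at t)"
    and dS1: "(dS1 has_real_derivative q t * S1 t + k * S t) (at t)"
    if t: "t \<in> {0..L}" for t
  proof -
    have "(dP1 has_real_derivative (- 1 / 4) * (\<Theta>'' t * P t + \<Theta>' t * dP t + (\<Theta>' t * dP t + \<Theta> t * (q t * P t)))
        - (1 / 2) * ((w t * U' t / 2 * \<Theta> t + w t * \<Theta>' t) * S t + w t * \<Theta> t * dS t)
        - (w t * \<Theta> t / 2 * dS t + \<psi>1 t * (q t * S t))) (at t)"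
      unfolding dP1_def
      by (auto intro!: derivative_eq_intros \<Theta>[OF t] \<Theta>'[OF t] P[OF t] S[OF t] dP[OF t] dS[OF t]
          \<psi>1(2)[OF t] w[OF t] simp: field_simps)
    then show "(dP1 has_real_derivative q t * P1 t + k * P t) (at t)"
      by (rule DERIV_cong)
         (simp add: P1_def dP_def dS_def kk[OF t] field_simps)
    have "(dS1 has_real_derivative (- 1 / 4) * (\<Theta>'' t * S t + \<Theta>' t * dS t + (\<Theta>' t * dS t + \<Theta> t * (q t * S t)))
        + (1 / 2) * ((w t * U' t / 2 * \<Theta> t + w t * \<Theta>' t) * P t + w t * \<Theta> t * dP t)
        + (w t * \<Theta> t / 2 * dP t + \<psi>1 t * (q t * P t))) (at t)"
      unfolding dS1_def
      by (auto intro!: derivative_eq_intros \<Theta>[OF t] \<Theta>'[OF t] P[OF t] S[OF t] dP[OF t] dS[OF t]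
          \<psi>1(2)[OF t] w[OF t] simp: field_simps)
    then show "(dS1 has_real_derivative q t * S1 t + k * S t) (at t)"
      by (rule DERIV_cong)
         (simp add: S1_def dP_def dS_def kk[OF t] field_simps)
  qed
  define r0 where "r0 = r 0"
  have r0: "r0 > 0" by (simp add: r0_def r_def)
  have w0: "r0 * r0 * w 0 = \<omega>" using rr(2)[of 0] by (simp add: r0_def)
  have LL: "0 \<in> {0..L}" "L \<in> {0..L}" using L by auto
  have P0: "P 0 = r0" "S 0 = 0" "dP 0 = 0" "dS 0 = w 0 * r0"
    using ends \<psi>(1) by (auto simp: P_def S_def dP_def dS_def r0_def)
  have P10: "P1 0 = - \<Theta> 0 / 4 * r0" "dP1 0 = 0" "S1 0 = 0" "dS1 0 = \<Theta> 0 / 4 * w 0 * r0"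
    using ends \<psi>1(1) P0 by (auto simp: P1_def S1_def dP1_def dS1_def)
  have wr: "w 0 * r0 * (r0 / \<omega>) = 1" using w0 \<omega> by (simp add: field_simps)
  have A0: "a0 t - P t / r0 = 0 \<and> da0 t - dP t / r0 = 0" if "t \<in> {0..L}" for t
    by (rule linear_ode_unique[OF _ _ cq LL(1) _ _ that])
       (use r0 in \<open>auto intro!: derivative_eq_intros a0 da0 P dP simp: init P0 field_simps\<close>)
  have B0: "b0 t - S t * (r0 / \<omega>) = 0 \<and> db0 t - dS t * (r0 / \<omega>) = 0" if "t \<in> {0..L}" for t
    by (rule linear_ode_unique[OF _ _ cq LL(1) _ _ that])
       (use r0 \<omega> wr in \<open>auto intro!: derivative_eq_intros b0 db0 S dS simp: init P0 field_simps\<close>)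
  \<comment> \<open>The normalized solution is \<open>P\<close> divided by its value
    \<open>r0\<close> at 0, and \<open>r0\<close> itself varies by the factor 1 - \<epsilon>
    \<Theta>(0)/4; this produces the term with \<open>\<Theta> 0 / 4\<close>. The odd solution
    carries \<open>r0\<close> in the numerator, which gives the opposite sign in
    \<open>B1\<close>.\<close>
  have A1: "a1 t - (P1 t + \<Theta> 0 / 4 * P t) / r0 = 0 \<and> da1 t - (dP1 t + \<Theta> 0 / 4 * dP t) / r0 = 0"
    if "t \<in> {0..L}" for t
  proof (rule linear_ode_unique[OF _ _ cq LL(1) _ _ that])
    fix t assume t: "t \<in> {0..L}"
    show "((\<lambda>t. a1 t - (P1 t + \<Theta> 0 / 4 * P t) / r0) has_real_derivative
        da1 t - (dP1 t + \<Theta> 0 / 4 * dP t) / r0) (at t)"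
      using r0 by (auto intro!: derivative_eq_intros a1[OF t] P1[OF t] P[OF t])
    have a0t: "a0 t = P t / r0" using A0[OF t] by simp
    show "((\<lambda>t. da1 t - (dP1 t + \<Theta> 0 / 4 * dP t) / r0) has_real_derivative
        q t * (a1 t - (P1 t + \<Theta> 0 / 4 * P t) / r0)) (at t)"
      using r0 by (auto intro!: derivative_eq_intros da1[OF t] dP1[OF t] dP[OF t] simp: a0t field_simps)
  qed (use r0 in \<open>auto simp: init P0 P10\<close>)
  have B1: "b1 t - (S1 t - \<Theta> 0 / 4 * S t) * (r0 / \<omega>) = 0 \<and> db1 t - (dS1 t - \<Theta> 0 / 4 * dS t) * (r0 / \<omega>) = 0"
    if "t \<in> {0..L}" for t
  proof (rule linear_ode_unique[OF _ _ cq LL(1) _ _ that])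
    fix t assume t: "t \<in> {0..L}"
    show "((\<lambda>t. b1 t - (S1 t - \<Theta> 0 / 4 * S t) * (r0 / \<omega>)) has_real_derivative
        db1 t - (dS1 t - \<Theta> 0 / 4 * dS t) * (r0 / \<omega>)) (at t)"
      using \<omega> by (auto intro!: derivative_eq_intros b1[OF t] S1[OF t] S[OF t])
    have b0t: "b0 t = S t * (r0 / \<omega>)" using B0[OF t] by simp
    show "((\<lambda>t. db1 t - (dS1 t - \<Theta> 0 / 4 * dS t) * (r0 / \<omega>)) has_real_derivative
        q t * (b1 t - (S1 t - \<Theta> 0 / 4 * S t) * (r0 / \<omega>))) (at t)"
      using \<omega> by (auto intro!: derivative_eq_intros db1[OF t] dS1[OF t] dS[OF t] simp: b0t field_simps)
  qed (use \<omega> in \<open>auto simp: init P0 P10\<close>)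
  have k0: "k0 * (r0 / \<omega>) * (r0 / \<omega>) = - 1 / (r0 * r0)"
  proof -
    have "r0 * r0 * (r0 * r0) * exp (U 0) = 1"
      by (simp add: r0_def r_def flip: exp_add)
    then show ?thesis using r0 \<omega> unfolding k0_def by (simp add: field_simps)
  qed
  have l0: "a0 L = P L / r0" "da0 L = dP L / r0" "b0 L = S L * (r0 / \<omega>)" "db0 L = dS L * (r0 / \<omega>)"
    using A0[OF LL(2)] B0[OF LL(2)] by auto
  have l1: "a1 L = (P1 L + \<Theta> 0 / 4 * P L) / r0" "da1 L = (dP1 L + \<Theta> 0 / 4 * dP L) / r0"
     "b1 L = (S1 L - \<Theta> 0 / 4 * S L) * (r0 / \<omega>)" "db1 L = (dS1 L - \<Theta> 0 / 4 * dS L) * (r0 / \<omega>)"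
    using A1[OF LL(2)] B1[OF LL(2)] by auto
  \<comment> \<open>Since P^2 + S^2 = r^2 and U' vanishes at \<open>L\<close>, the derivative of P^2
    + S^2 vanishes there. \<open>PS1\<close> is the first variation of this identity and uses that
    \<open>\<Theta>'\<close> vanishes at \<open>L\<close> too.\<close>
  have PS: "P L * dP L = - (S L * dS L)"
    using ends by (simp add: dP_def dS_def)
  have PS1: "P L * dP1 L + P1 L * dP L = - (S L * dS1 L + S1 L * dS L)"
    using ends PS by (simp add: dP1_def dS1_def P1_def S1_def dP_def dS_def algebra_simps)
  show "a0 L * da0 L = k0 * (b0 L * db0 L)"
  proof -
    have "k0 * (b0 L * db0 L) = (k0 * (r0 / \<omega>) * (r0 / \<omega>)) * (S L * dS L)"
      unfolding l0 by (simp add: mult_ac)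
    then show ?thesis unfolding k0 l0 using PS by simp
  qed
  show "a0 L * da1 L + a1 L * da0 L = k0 * (b0 L * db1 L + b1 L * db0 L) + \<Theta> 0 * k0 * (b0 L * db0 L)"
  proof -
    have minus_one_over: "(- 1 / x) * z = - z / x" for x z :: real by simp
    have "k0 * (b0 L * db1 L + b1 L * db0 L) + \<Theta> 0 * k0 * (b0 L * db0 L)
      = (k0 * (r0 / \<omega>) * (r0 / \<omega>)) * (S L * dS1 L + S1 L * dS L + \<Theta> 0 / 2 * (S L * dS L))"
      unfolding l0 l1 by (simp add: algebra_simps)
    also have "\<dots> = - (S L * dS1 L + S1 L * dS L + \<Theta> 0 / 2 * (S L * dS L)) / (r0 * r0)"
      unfolding k0 by (rule minus_one_over)
    also have "- (S L * dS1 L + S1 L * dS L + \<Theta> 0 / 2 * (S L * dS L)) =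
        P L * dP1 L + P1 L * dP L + \<Theta> 0 / 2 * (P L * dP L)"
      unfolding PS PS1 by simp
    also have "(P L * dP1 L + P1 L * dP L + \<Theta> 0 / 2 * (P L * dP L)) / (r0 * r0)
        = a0 L * da1 L + a1 L * da0 L"
      unfolding l0 l1 using r0 by (simp add: field_simps)
    finally show ?thesis by simp
  qed
qed

section \<open>The connection relation\<close>

text \<open>Conjugation with \<epsilon> regarded as a real parameter: its fixed points are the
  series with real coefficients.\<close>

definition cnj_fps :: "complex fps \<Rightarrow> complex fps" where
  "cnj_fps F = Abs_fps (\<lambda>n. cnj (F $ n))"

lemma cnj_fps_nth [simp]: "cnj_fps F $ n = cnj (F $ n)"
  by (simp add: cnj_fps_def)

lemma cnj_fps_arith:
  "cnj_fps (F + G) = cnj_fps F + cnj_fps G"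
  "cnj_fps (F - G) = cnj_fps F - cnj_fps G"
  "cnj_fps (- F) = - cnj_fps F"
  "cnj_fps (F * G) = cnj_fps F * cnj_fps G"
  "cnj_fps (fps_const a) = fps_const (cnj a)"
  by (auto simp: fps_eq_iff fps_mult_nth)

text \<open>One solution, with coordinates \<open>l\<close>, \<open>m\<close> in the basis
  normalized at the center, is evaluated at the far ends of the two edges. At the end of the
  vertical edge its value \<open>s\<close> and derivative \<open>s'\<close> are real; at the end of
  the horizontal edge they are real up to the phase \<open>E\<close>. Eliminating \<open>r\<close>
  and \<open>r'\<close> leaves two homogeneous linear equations for the nonzero pair (s, s'), so
  their determinant vanishes, and this is the claimed relation.\<close>

lemma connection_determinant:
  fixes X1 X2 dX1 dX2 Y1 Y2 dY1 dY2 l m :: "complex fps"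
  assumes WX: "X1 * dX2 - X2 * dX1 = 1" and WY: "Y1 * dY2 - Y2 * dY1 = 1"
    and real: "cnj_fps X1 = X1" "cnj_fps X2 = X2" "cnj_fps dX1 = dX1" "cnj_fps dX2 = dX2"
      "cnj_fps Y1 = Y1" "cnj_fps Y2 = Y2" "cnj_fps dY1 = dY1" "cnj_fps dY2 = dY2"
    and I: "I = fps_const \<i>" and E: "E = fps_const (cis \<theta>)"
    and s: "s = l * Y1 - I * m * Y2" "cnj_fps s = s"
    and s': "s' = I * l * dY1 + m * dY2" "cnj_fps s' = s'"
    and r: "E * r = l * X1 - m * X2" "cnj_fps r = r"
    and r': "- I * E * r' = - l * dX1 + m * dX2" "cnj_fps r' = r'"
    and nz: "l \<noteq> 0 \<or> m \<noteq> 0"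
  shows "X1 * dX1 * Y2 * dY2 + X2 * dX2 * Y1 * dY1 = fps_const (of_real (sin (2 * \<theta>) / 2))"
proof -
  define c S where "c = fps_const (of_real (cos \<theta>) :: complex)" and "S = fps_const (of_real (sin \<theta>) :: complex)"
  define E' where "E' = fps_const (cis (- \<theta>))"
  have EE: "E' * E = 1" by (simp add: E E'_def cis_mult flip: fps_const_mult)
  have E'c: "E' = c - I * S"
    by (simp add: E'_def c_def S_def I fps_const_sub complex_eq_iff)
  have II: "I * I = -1" by (simp add: I fps_const_neg[symmetric] del: fps_const_neg)
  have IIx: "I * (I * x) = - x" for x
    using II by (simp flip: mult.assoc)
  have cS: "c * c + S * S = 1"
    unfolding c_def S_def fps_const_mult fps_const_add of_real_mult[symmetric] of_real_add[symmetric]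
    by (simp add: power2_eq_square[symmetric])
  have lm: "l = dY2 * s + I * Y2 * s'" "m = - I * dY1 * s + Y1 * s'"
    using WY II unfolding s(1) s'(1) by algebra+
  define p q where "p = E' * l" and "q = E' * m"
  have pq: "p = dX2 * r - I * X2 * r'" "q = dX1 * r - I * X1 * r'"
    using WX EE r(1) r'(1) unfolding p_def q_def by algebra+
  have cI: "cnj_fps I = - I" "cnj_fps c = c" "cnj_fps S = S"
    by (auto simp: fps_eq_iff I c_def S_def)
  have cc: "cnj_fps p = dX2 * r + I * X2 * r'" "cnj_fps q = dX1 * r + I * X1 * r'"
    unfolding pq cnj_fps_arith cI real r(2) r'(2) by simp_all
  have cc': "cnj_fps p = (c + I * S) * (dY2 * s - I * Y2 * s')"
            "cnj_fps q = (c + I * S) * (I * dY1 * s + Y1 * s')"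
    unfolding p_def q_def E'c lm cnj_fps_arith cI real s(2) s'(2) by (simp_all add: algebra_simps)
  have two: "(2::complex fps) \<noteq> 0" "2 * I \<noteq> 0"
    by (auto simp: I numeral_fps_const)
  have pc: "p = (c - I * S) * (dY2 * s + I * Y2 * s')" "q = (c - I * S) * (- I * dY1 * s + Y1 * s')"
    unfolding p_def q_def E'c lm by simp_all
  \<comment> \<open>As \<open>r\<close> and \<open>r'\<close> are real, adding and subtracting
    conjugates of \<open>p\<close> and \<open>q\<close> isolates each product; the same sums
    computed from \<open>s\<close> and \<open>s'\<close> then give the four real relations
    \<open>R\<close>.\<close>
  have "2 * (dX2 * r) = p + cnj_fps p" "2 * (dX1 * r) = q + cnj_fps q"
       "2 * I * (X2 * r') = cnj_fps p - p" "2 * I * (X1 * r') = cnj_fps q - q"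
    unfolding cc unfolding pq by (simp_all add: algebra_simps)
  then have "2 * (dX2 * r) = 2 * (c * dY2 * s + S * Y2 * s')"
       "2 * (dX1 * r) = 2 * (c * Y1 * s' - S * dY1 * s)"
       "2 * I * (X2 * r') = 2 * I * (S * dY2 * s - c * Y2 * s')"
       "2 * I * (X1 * r') = 2 * I * (c * dY1 * s + S * Y1 * s')"
    unfolding cc' unfolding pc by (simp_all add: algebra_simps II IIx)
  then have R: "dX2 * r = c * dY2 * s + S * Y2 * s'" "dX1 * r = c * Y1 * s' - S * dY1 * s"
       "X2 * r' = S * dY2 * s - c * Y2 * s'" "X1 * r' = c * dY1 * s + S * Y1 * s'"
    using two by (simp_all only: mult_cancel_left simp_thms)
  define D where "D = X1 * dX1 * Y2 * dY2 + X2 * dX2 * Y1 * dY1 - c * S"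
  have e1: "s * (c * dX1 * dY2 + S * dX2 * dY1) = s' * (c * dX2 * Y1 - S * dX1 * Y2)"
    using R(1,2) by algebra
  have e2: "s' * (c * X1 * Y2 + S * X2 * Y1) = s * (S * X1 * dY2 - c * X2 * dY1)"
    using R(3,4) by algebra
  \<comment> \<open>The right-hand side is the determinant of the system formed by \<open>e1\<close>
    and \<open>e2\<close>; the two Wronskians and cos^2 + sin^2 = 1 reduce it to
    \<open>D\<close>.\<close>
  have D: "D = (c * dX1 * dY2 + S * dX2 * dY1) * (c * X1 * Y2 + S * X2 * Y1)
            - (c * dX2 * Y1 - S * dX1 * Y2) * (S * X1 * dY2 - c * X2 * dY1)"
    using cS WX WY unfolding D_def by algebra
  have "D * s = 0" "D * s' = 0" using e1 e2 unfolding D by algebra+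
  moreover have "s \<noteq> 0 \<or> s' \<noteq> 0" using nz lm by auto
  ultimately have "D = 0" by auto
  moreover have "c * S = fps_const (of_real (sin (2 * \<theta>) / 2))"
    by (simp add: c_def S_def sin_double)
  ultimately show ?thesis by (simp add: D_def)
qed

section \<open>Holomorphic linear equations\<close>

text \<open>Integration along the segment from \<open>a\<close> gains a factor
  \<open>norm (z - a) / Suc n\<close>; iterating it produces the factorials that make the Picard
  series converge.\<close>

lemma primitive_bound:
  fixes f :: "complex \<Rightarrow> complex"
  assumes "convex S" and F: "\<And>z. z \<in> S \<Longrightarrow> (F has_field_derivative f z) (at z)"
    and a: "a \<in> S" "F a = 0"
    and bound: "\<And>z. z \<in> S \<Longrightarrow> norm (f z) \<le> K * norm (z - a) ^ n" and z: "z \<in> S" and "K \<ge> 0"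
  shows "norm (F z) \<le> K * norm (z - a) ^ Suc n / real (Suc n)"
proof -
  define p where "p = (\<lambda>t. a + of_real t * (z - a))"
  have p: "p t \<in> S" if "0 \<le> t" "t \<le> 1" for t
  proof -
    have "p t = (1 - t) *\<^sub>R a + t *\<^sub>R z" by (simp add: p_def scaleR_conv_of_real algebra_simps)
    then show ?thesis using that a z \<open>convex S\<close> by (simp add: convexD_alt)
  qed
  have d: "((\<lambda>t. F (p t)) has_vector_derivative (z - a) * f (p t)) (at t)" if "0 \<le> t" "t \<le> 1" for t
  proof (rule field_vector_diff_chain_at[of p _ _ F, unfolded o_def])
    show "(p has_vector_derivative z - a) (at t)"
      unfolding p_def by (auto intro!: derivative_eq_intros)
  qed (rule F[OF p[OF that]])
  have "norm (F (p 1) - F (p 0)) \<le>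
     K * norm (z - a) ^ Suc n * 1 ^ Suc n / real (Suc n) - K * norm (z - a) ^ Suc n * 0 ^ Suc n / real (Suc n)"
  proof (rule differentiable_bound_general[where f' = "\<lambda>t. (z - a) * f (p t)" and
      \<phi>' = "\<lambda>t. K * norm (z - a) ^ Suc n * t ^ n" and \<phi> = "\<lambda>t. K * norm (z - a) ^ Suc n * t ^ Suc n / real (Suc n)"])
    show "continuous_on {0..1} (\<lambda>t. F (p t))"
      by (intro continuous_at_imp_continuous_on ballI has_vector_derivative_continuous[OF d]) auto
    fix t :: real assume t: "0 < t" "t < 1"
    show "((\<lambda>t. F (p t)) has_vector_derivative (z - a) * f (p t)) (at t)" using d t by simp
    have "((\<lambda>t. K * norm (z - a) ^ Suc n * t ^ Suc n / real (Suc n)) has_real_derivative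
        K * norm (z - a) ^ Suc n * (real (Suc n) * t ^ n) / real (Suc n)) (at t)"
      by (auto intro!: derivative_eq_intros simp del: power_Suc of_nat_Suc)
    then show "((\<lambda>t. K * norm (z - a) ^ Suc n * t ^ Suc n / real (Suc n)) has_vector_derivative
        K * norm (z - a) ^ Suc n * t ^ n) (at t)"
      unfolding has_real_derivative_iff_has_vector_derivative[symmetric]
      by (rule DERIV_cong) simp
    have "norm (f (p t)) \<le> K * norm (p t - a) ^ n" using bound p t by simp
    also have "norm (p t - a) = t * norm (z - a)" using t by (simp add: p_def norm_mult)
    finally have "norm (z - a) * norm (f (p t)) \<le> norm (z - a) * (K * (t * norm (z - a)) ^ n)"
      by (intro mult_left_mono) auto
    then show "norm ((z - a) * f (p t)) \<le> K * norm (z - a) ^ Suc n * t ^ n"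
      unfolding norm_mult by (simp add: power_mult_distrib mult_ac)
  qed (auto intro!: continuous_intros)
  then show ?thesis by (simp add: p_def a)
qed

lemma holomorphic_primitive_at:
  assumes "convex S" "open S" "f holomorphic_on S" "a \<in> S"
  obtains F where "\<And>z. z \<in> S \<Longrightarrow> (F has_field_derivative f z) (at z)" "F a = c"
proof -
  obtain g where g: "\<And>x. x \<in> S \<Longrightarrow> (g has_field_derivative f x) (at x within S)"
    using holomorphic_convex_primitive'[OF assms(1-3)] by blast
  have "(g has_field_derivative f z) (at z)" if "z \<in> S" for z
    using g[OF that] at_within_open[OF that assms(2)] by (simp only:)
  then show thesis
    by (intro that[of "\<lambda>z. g z - g a + c"]) (auto intro!: derivative_eq_intros)
qed

text \<open>Picard iteration, organized as a series of increments: each increment is obtained from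
  the previous one by multiplying by \<open>Q\<close> and taking two primitives that vanish at
  \<open>a\<close>. The boundedness of \<open>S\<close> and of \<open>Q\<close> makes the
  convergence uniform on all of \<open>S\<close>.\<close>

lemma picard_homogeneous:
  fixes Q :: "complex \<Rightarrow> complex"
  assumes S: "convex S" "open S" and bnd: "bounded S" and Q: "Q holomorphic_on S" "bounded (Q ` S)" and a: "a \<in> S"
  obtains y y' where "\<And>z. z \<in> S \<Longrightarrow> (y has_field_derivative y' z) (at z)"
    "\<And>z. z \<in> S \<Longrightarrow> (y' has_field_derivative Q z * y z) (at z)" "y a = c" "y' a = d"
proof -
  obtain M where M: "M > 0" "\<And>z. z \<in> S \<Longrightarrow> norm (Q z) \<le> M"
    using Q(2) unfolding bounded_pos by auto
  obtain R where R: "R > 0" "\<And>z. z \<in> S \<Longrightarrow> norm (z - a) \<le> R"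
  proof -
    obtain e where "\<forall>z\<in>S. dist a z \<le> e" using bnd bounded_any_center by blast
    then have "norm (z - a) \<le> max e 1" if "z \<in> S" for z
      using that by (auto simp: dist_norm norm_minus_commute)
    then show thesis using that[of "max e 1"] by auto
  qed
  define C where "C = norm c + norm d * R + norm d + 1"
  \<comment> \<open>One Picard step: \<open>G\<close> consists of an increment and its derivative,
    and its first component has second derivative \<open>Q\<close> times the first component of
    \<open>g\<close>.\<close>
  define Pr where "Pr = (\<lambda>(g :: (complex \<Rightarrow> complex) \<times> (complex \<Rightarrow> complex)) (G :: (complex \<Rightarrow> complex) \<times> (complex \<Rightarrow> complex)). (\<forall>z\<in>S. (fst G has_field_derivative snd G z) (at z)) \<and>
     (\<forall>z\<in>S. (snd G has_field_derivative Q z * fst g z) (at z)) \<and> fst G a = 0 \<and> snd G a = (0::complex))"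
  have ex: "\<exists>G. Pr g G" if "fst g holomorphic_on S" for g :: "(complex \<Rightarrow> complex) \<times> (complex \<Rightarrow> complex)"
  proof -
    have "(\<lambda>z. Q z * fst g z) holomorphic_on S" using that Q by (intro holomorphic_intros)
    then obtain h where h: "\<And>z. z \<in> S \<Longrightarrow> (h has_field_derivative Q z * fst g z) (at z)" "h a = 0"
      using holomorphic_primitive_at[OF S _ a, of _ 0] by blast
    then have "h holomorphic_on S" using S(2) by (auto simp: holomorphic_on_open)
    then obtain H where H: "\<And>z. z \<in> S \<Longrightarrow> (H has_field_derivative h z) (at z)" "H a = 0"
      using holomorphic_primitive_at[OF S _ a, of _ 0] by blast
    show ?thesis by (rule exI[of _ "(H, h)"]) (use h H in \<open>auto simp: Pr_def\<close>)
  qed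
  have hol: "fst G holomorphic_on S" if "Pr g G" for g G
    unfolding holomorphic_on_open[OF S(2)] using that unfolding Pr_def by blast
  define Y where "Y = rec_nat (\<lambda>z. c + d * (z - a), \<lambda>z. d) (\<lambda>n g. SOME G. Pr g G)"
  have Y0: "Y 0 = (\<lambda>z. c + d * (z - a), \<lambda>z. d)" by (simp add: Y_def)
  have step: "Pr (Y n) (Y (Suc n))" if "fst (Y n) holomorphic_on S" for n
  proof -
    have "Y (Suc n) = (SOME G. Pr (Y n) G)" by (simp add: Y_def)
    then show ?thesis using someI_ex[OF ex[OF that]] by (simp only:)
  qed
  have YS: "fst (Y n) holomorphic_on S \<and> Pr (Y n) (Y (Suc n))" for n
  proof (induction n)
    case 0
    have "fst (Y 0) holomorphic_on S" unfolding Y0 by (auto intro!: holomorphic_intros)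
    then show ?case using step by blast
  next
    case (Suc n)
    then have "fst (Y (Suc n)) holomorphic_on S" using hol by blast
    then show ?case using step by blast
  qed
  define f g where "f = (\<lambda>n. fst (Y n))" and "g = (\<lambda>n. snd (Y n))"
  have df: "(f n has_field_derivative g n z) (at z)" if "z \<in> S" for n z
  proof (cases n)
    case 0 then show ?thesis unfolding f_def g_def by (auto simp: Y0 intro!: derivative_eq_intros)
  next
    case (Suc m) then show ?thesis using YS[of m] that unfolding f_def g_def Pr_def by auto
  qed
  have dg: "(g (Suc n) has_field_derivative Q z * f n z) (at z)" if "z \<in> S" for n z
    using YS[of n] that unfolding f_def g_def Pr_def by auto
  have init: "f (Suc n) a = 0" "g (Suc n) a = 0" for n
    using YS[of n] unfolding f_def g_def Pr_def by auto
  have Cb: "C \<ge> 0" "norm (c + d * (z - a)) \<le> C" "norm d \<le> C" if "z \<in> S" for z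
  proof -
    have "norm (d * (z - a)) \<le> norm d * R" using R(2)[OF that] by (simp add: norm_mult mult_left_mono)
    then show "norm (c + d * (z - a)) \<le> C"
      unfolding C_def using norm_triangle_ineq[of c "d * (z - a)"] norm_ge_zero[of d] by linarith
    have "0 \<le> norm d * R" using R(1) by simp
    then show "C \<ge> 0" "norm d \<le> C" unfolding C_def using norm_ge_zero[of c] norm_ge_zero[of d] by linarith+
  qed
  have fb: "norm (f n z) \<le> C * M ^ n * norm (z - a) ^ (2 * n) / fact (2 * n)" if "z \<in> S" for n z
    using that
  proof (induction n arbitrary: z)
    case 0 then show ?case using Cb by (simp add: f_def Y0)
  next
    case (Suc n)
    let ?K = "C * M ^ Suc n / fact (2 * n)"
    have K: "?K \<ge> 0" using Cb(1)[OF a] M by (intro divide_nonneg_nonneg mult_nonneg_nonneg) auto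
    have b1: "norm (Q z * f n z) \<le> ?K * norm (z - a) ^ (2 * n)" if "z \<in> S" for z
    proof -
      have "norm (Q z * f n z) \<le> M * (C * M ^ n * norm (z - a) ^ (2 * n) / fact (2 * n))"
        unfolding norm_mult using M Suc.IH[OF that] that by (intro mult_mono) auto
      then show ?thesis by (simp add: mult_ac)
    qed
    have b2: "norm (g (Suc n) z) \<le> (?K / real (Suc (2 * n))) * norm (z - a) ^ Suc (2 * n)" if "z \<in> S" for z
      using primitive_bound[OF S(1) dg a(1) init(2) b1 that K] by (simp only: times_divide_eq_left)
    have K': "?K / real (Suc (2 * n)) \<ge> 0" using K by (rule divide_nonneg_nonneg) simp
    have "norm (f (Suc n) z) \<le> (?K / real (Suc (2 * n))) * norm (z - a) ^ Suc (Suc (2 * n)) / real (Suc (Suc (2 * n)))"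
      by (rule primitive_bound[OF S(1) df a(1) init(1) b2 Suc.prems K'])
    also have "\<dots> = C * M ^ Suc n * norm (z - a) ^ (2 * Suc n) / fact (2 * Suc n)"
      by (simp add: field_simps)
    finally show ?case .
  qed
  \<comment> \<open>Weakening \<open>fact (2 * n)\<close> to \<open>fact n\<close> turns the
    majorant into an exponential series.\<close>
  define h where "h = (\<lambda>n. C * ((M * R\<^sup>2) ^ n / fact n))"
  have hb: "norm (f n z) \<le> h n" if "z \<in> S" for n z
  proof -
    have "C * M ^ n * norm (z - a) ^ (2 * n) / fact (2 * n) \<le> C * M ^ n * R ^ (2 * n) / fact n"
      using Cb(1)[OF a] M R that
      by (intro frac_le mult_left_mono power_mono) (auto intro!: fact_mono)
    also have "\<dots> = h n" by (simp add: h_def power_mult power_mult_distrib)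
    finally show ?thesis using fb[OF that, of n] by linarith
  qed
  have sh: "summable h"
    unfolding h_def using summable_exp[of "M * R\<^sup>2"] by (intro summable_mult) (simp add: divide_inverse mult.commute)
  have ev: "\<forall>\<^sub>F n in sequentially. \<forall>z\<in>S. norm (f n z) \<le> h n"
    using hb by (intro always_eventually) blast
  obtain y y1 where y: "\<forall>z\<in>S. ((\<lambda>n. f n z) sums y z) \<and> ((\<lambda>n. g n z) sums y1 z) \<and> (y has_field_derivative y1 z) (at z)"
    using series_and_derivative_comparison[OF S(2) sh df ev] by blast
  have gh: "norm (g (Suc n) z) \<le> M * R * h n" if "z \<in> S" for n z
  proof -
    have hn: "0 \<le> h n" by (rule order_trans[OF norm_ge_zero hb[OF a]])
    have b1: "norm (Q z * f n z) \<le> (M * h n) * norm (z - a) ^ 0" if "z \<in> S" for z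
      unfolding norm_mult using mult_mono[OF M(2)[OF that] hb[OF that, of n]] M(1) by simp
    have b2: "0 \<le> M * h n" using hn M(1) by simp
    have "norm (g (Suc n) z) \<le> (M * h n) * norm (z - a) ^ Suc 0 / real (Suc 0)"
      by (rule primitive_bound[OF S(1) dg a(1) init(2) b1 that b2])
    also have "\<dots> \<le> (M * h n) * R"
      using R(2)[OF that] M hn by (simp add: mult_left_mono)
    finally show ?thesis by (simp add: mult_ac)
  qed
  \<comment> \<open>The derivatives are summed from index 1 on: \<open>g 0\<close> is the constant
    \<open>d\<close> and does not come from a Picard step. It is added back in
    \<open>y1\<close>.\<close>
  have ev: "\<forall>\<^sub>F n in sequentially. \<forall>z\<in>S. norm (g (Suc n) z) \<le> M * R * h n"
    using gh by (intro always_eventually) blast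
  obtain w w1 where w: "\<forall>z\<in>S. ((\<lambda>n. g (Suc n) z) sums w z) \<and> ((\<lambda>n. Q z * f n z) sums w1 z) \<and> (w has_field_derivative w1 z) (at z)"
    using series_and_derivative_comparison[OF S(2) summable_mult[OF sh] dg ev] by blast
  have w1: "w1 z = Q z * y z" if "z \<in> S" for z
  proof (rule sums_unique2)
    show "(\<lambda>n. Q z * f n z) sums w1 z" using w that by blast
    show "(\<lambda>n. Q z * f n z) sums (Q z * y z)" using y that by (intro sums_mult) blast
  qed
  have y1: "y1 z = w z + d" if "z \<in> S" for z
  proof (rule sums_unique2)
    show "(\<lambda>n. g n z) sums y1 z" using y that by blast
    have "(\<lambda>n. g (Suc n) z) sums w z" using w that by blast
    then have "(\<lambda>n. g n z) sums (w z + g 0 z)" by (rule sums_Suc_iff[THEN iffD1])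
    moreover have "g 0 z = d" by (simp add: g_def Y0)
    ultimately show "(\<lambda>n. g n z) sums (w z + d)" by (simp only:)
  qed
  show thesis
  proof (rule that[of y "\<lambda>z. w z + d"])
    fix z assume z: "z \<in> S"
    have "(y has_field_derivative y1 z) (at z)" using y z by blast
    then show "(y has_field_derivative w z + d) (at z)" by (simp only: y1[OF z])
    have "(w has_field_derivative w1 z) (at z)" using w z by blast
    then have "((\<lambda>z. w z + d) has_field_derivative w1 z + 0) (at z)" by (intro DERIV_add DERIV_const)
    then show "((\<lambda>z. w z + d) has_field_derivative Q z * y z) (at z)" by (simp only: w1[OF z] add_0_right)
  next
    have "(\<lambda>n. g (Suc n) a) sums w a" using w a by blast
    then have "w a = 0" unfolding init by (rule sums_unique2[OF _ sums_zero])
    then show "w a + d = d" by simp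
    have "(\<lambda>n. f (Suc n) a) sums 0" unfolding init by (rule sums_zero)
    then have "(\<lambda>n. f n a) sums (0 + f 0 a)" by (rule sums_Suc_iff[THEN iffD1])
    moreover have "(\<lambda>n. f n a) sums y a" using y a by blast
    ultimately have "y a = 0 + f 0 a" by (rule sums_unique2[rotated])
    then show "y a = c" by (simp add: f_def Y0)
  qed
qed

section \<open>Frobenius solutions at the singular point\<close>

definition rps :: "(nat \<Rightarrow> real) \<Rightarrow> complex fps" where
  "rps p = Abs_fps (\<lambda>k. of_real (p k))"

lemma rps_nth [simp]: "rps p $ k = of_real (p k)"
  by (simp add: rps_def)

lemma rps_conv_radius:
  assumes \<rho>: "\<rho> > 0" and p: "\<And>k. \<bar>p k\<bar> \<le> C / \<rho> ^ k"
  shows "fps_conv_radius (rps p) \<ge> ereal \<rho>"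
  unfolding fps_conv_radius_def
proof (rule conv_radius_geI_ex)
  fix r assume r: "0 < r" "ereal r < ereal \<rho>"
  have "summable (\<lambda>n. rps p $ n * of_real r ^ n)"
  proof (rule summable_comparison_test)
    have "norm (rps p $ n * of_real r ^ n) \<le> C * (r / \<rho>) ^ n" for n
    proof -
      have "norm (rps p $ n * of_real r ^ n) \<le> C / \<rho> ^ n * r ^ n"
        using mult_right_mono[OF p, of "r ^ n" n] r by (simp add: norm_mult norm_power)
      then show ?thesis by (simp add: power_divide)
    qed
    then show "\<exists>N. \<forall>n\<ge>N. norm (rps p $ n * of_real r ^ n) \<le> C * (r / \<rho>) ^ n" by blast
    show "summable (\<lambda>n. C * (r / \<rho>) ^ n)"
      using r \<rho> by (intro summable_mult summable_geometric) auto
  qed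
  then show "\<exists>z. norm z = r \<and> summable (\<lambda>n. rps p $ n * z ^ n)"
    using r by (intro exI[of _ "of_real r"]) auto
qed

lemma eval_rps_real:
  assumes "x \<in> \<real>" "norm x < fps_conv_radius (rps p)"
  shows "eval_fps (rps p) x \<in> \<real>"
proof -
  have "(\<lambda>n. Im (rps p $ n * x ^ n)) sums Im (eval_fps (rps p) x)"
    by (rule sums_Im[OF sums_eval_fps[OF assms(2)]])
  moreover have "rps p $ n * x ^ n \<in> \<real>" for n using assms(1) by simp
  ultimately have "(\<lambda>n. 0 :: real) sums Im (eval_fps (rps p) x)"
    by (simp only: complex_is_Real_iff)
  then show ?thesis using sums_unique2 sums_zero complex_is_Real_iff by metis
qed

text \<open>Coefficients of the series H for which z^\<kappa> H(z^2) solves w'' =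
  (\<kappa>(\<kappa>-1)/z^2 + p(z^2)) w + z^\<kappa> f(z^2). The denominator comes from 4 x H'' + (2
  + 4\<kappa>) H' in the variable x = z^2, and it stays positive for \<kappa> >= 0.\<close>

fun frobenius :: "real \<Rightarrow> (nat \<Rightarrow> real) \<Rightarrow> (nat \<Rightarrow> real) \<Rightarrow> real \<Rightarrow> nat \<Rightarrow> real" where
  "frobenius \<kappa> p f h0 0 = h0"
| "frobenius \<kappa> p f h0 (Suc m) =
     ((\<Sum>j\<in>{..m}. p (m - j) * frobenius \<kappa> p f h0 j) + f m) / (real (Suc m) * (4 * real m + 2 + 4 * \<kappa>))"

text \<open>The denominator is at least \<open>2 * Suc m\<close>, which absorbs the
  \<open>Suc m\<close> terms of the convolution and the inhomogeneity;
  \<open>\<rho> * M \<le> 1\<close> lets the induction close with the geometric rate of the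
  data.\<close>

lemma frobenius_bound:
  assumes \<kappa>: "\<kappa> \<ge> 0" and \<rho>: "\<rho> > 0" and p: "\<And>k. \<bar>p k\<bar> \<le> M / \<rho> ^ k" and M: "\<rho> * M \<le> 1"
    and f: "\<And>k. \<bar>f k\<bar> \<le> D / \<rho> ^ k"
  shows "\<bar>frobenius \<kappa> p f h0 k\<bar> \<le> (\<bar>h0\<bar> + \<rho> * D) / \<rho> ^ k"
proof (induction k rule: less_induct)
  case (less k)
  let ?C = "\<bar>h0\<bar> + \<rho> * D"
  have D: "D \<ge> 0" using f[of 0] by simp
  have M0: "M \<ge> 0" using p[of 0] by simp
  show ?case
  proof (cases k)
    case 0 then show ?thesis using D \<rho> by simp
  next
    case (Suc m)
    let ?den = "real (Suc m) * (4 * real m + 2 + 4 * \<kappa>)"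
    have "\<bar>\<Sum>j\<in>{..m}. p (m - j) * frobenius \<kappa> p f h0 j\<bar> \<le> (\<Sum>j\<in>{..m}. M * ?C / \<rho> ^ m)"
    proof (rule order_trans[OF sum_abs sum_mono])
      fix j assume j: "j \<in> {..m}"
      have "\<bar>p (m - j) * frobenius \<kappa> p f h0 j\<bar> \<le> (M / \<rho> ^ (m - j)) * (?C / \<rho> ^ j)"
        unfolding abs_mult using p less.IH[of j] j Suc \<rho> M0 by (intro mult_mono) auto
      also have "\<dots> = M * ?C / (\<rho> ^ (m - j) * \<rho> ^ j)" by simp
      also have "\<rho> ^ (m - j) * \<rho> ^ j = \<rho> ^ m" using j by (simp flip: power_add)
      finally show "\<bar>p (m - j) * frobenius \<kappa> p f h0 j\<bar> \<le> M * ?C / \<rho> ^ m" .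
    qed
    also have "\<dots> = real (Suc m) * (M * ?C / \<rho> ^ m)" by simp
    finally have "\<bar>(\<Sum>j\<in>{..m}. p (m - j) * frobenius \<kappa> p f h0 j) + f m\<bar> \<le> real (Suc m) * (M * ?C / \<rho> ^ m) + D / \<rho> ^ m"
      using f[of m] by linarith
    moreover have "D / \<rho> ^ m \<le> real (Suc m) * (D / \<rho> ^ m)"
      using D \<rho> mult_right_mono[of 1 "real (Suc m)" "D / \<rho> ^ m"] by simp
    ultimately have "\<bar>(\<Sum>j\<in>{..m}. p (m - j) * frobenius \<kappa> p f h0 j) + f m\<bar>
        \<le> real (Suc m) * (M * ?C / \<rho> ^ m) + real (Suc m) * (D / \<rho> ^ m)" by linarith
    also have "real (Suc m) * (M * ?C / \<rho> ^ m) + real (Suc m) * (D / \<rho> ^ m) = real (Suc m) * ((M * ?C + D) / \<rho> ^ m)"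
      by (simp only: distrib_left add_divide_distrib)
    also have "\<dots> \<le> real (Suc m) * ((2 * ?C / \<rho>) / \<rho> ^ m)"
    proof -
      have "(\<rho> * M) * ?C \<le> 1 * ?C" using M D \<rho> by (intro mult_right_mono) auto
      then have "\<rho> * (M * ?C + D) \<le> 2 * ?C" using D \<rho> by (simp add: algebra_simps)
      then have "M * ?C + D \<le> 2 * ?C / \<rho>" using \<rho> by (simp add: pos_le_divide_eq mult.commute)
      then show ?thesis using \<rho> by (intro mult_left_mono divide_right_mono) auto
    qed
    also have "\<dots> = (real (Suc m) * 2) * (?C / \<rho> ^ Suc m)"
    proof -
      have "a * ((2 * c / \<rho>) / x) = (a * 2) * (c / (\<rho> * x))" for a c x :: real by simp
      then show ?thesis by (simp only: power_Suc)
    qed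
    also have "\<dots> \<le> ?den * (?C / \<rho> ^ Suc m)"
      using \<kappa> D \<rho> by (intro mult_right_mono mult_left_mono) auto
    finally have "\<bar>(\<Sum>j\<in>{..m}. p (m - j) * frobenius \<kappa> p f h0 j) + f m\<bar> \<le> ?den * (?C / \<rho> ^ Suc m)" .
    moreover have "?den > 0" using \<kappa> by (intro mult_pos_pos) auto
    ultimately show ?thesis unfolding Suc frobenius.simps abs_divide
      by (simp only: abs_of_pos pos_divide_le_eq mult.commute)
  qed
qed

lemma frobenius_fps:
  fixes p f :: "nat \<Rightarrow> real" and \<kappa> h0 :: real
  assumes \<kappa>: "\<kappa> \<ge> 0"
  defines "H \<equiv> rps (frobenius \<kappa> p f h0)"
  shows "4 * fps_X * fps_deriv (fps_deriv H) + fps_const (of_real (2 + 4 * \<kappa>)) * fps_deriv H = rps p * H + rps f"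
proof (rule fps_ext)
  fix m
  have den: "real (Suc m) * (4 * real m + 2 + 4 * \<kappa>) \<noteq> 0" using \<kappa> by simp
  have "fps_nth (rps p * H + rps f) m = of_real ((\<Sum>j\<in>{..m}. p (m - j) * frobenius \<kappa> p f h0 j) + f m)"
  proof -
    have "fps_nth (rps p * H + rps f) m = (\<Sum>j=0..m. of_real (frobenius \<kappa> p f h0 j) * of_real (p (m - j))) + of_real (f m)"
      unfolding H_def mult.commute[of "rps p"] by (simp add: fps_mult_nth)
    then show ?thesis by (simp add: atMost_atLeast0 mult.commute)
  qed
  also have "(\<Sum>j\<in>{..m}. p (m - j) * frobenius \<kappa> p f h0 j) + f m =
      real (Suc m) * (4 * real m + 2 + 4 * \<kappa>) * frobenius \<kappa> p f h0 (Suc m)"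
    unfolding frobenius.simps by (simp only: times_divide_eq_right nonzero_mult_div_cancel_left[OF den])
  also have "complex_of_real \<dots> = fps_nth (4 * fps_X * fps_deriv (fps_deriv H) + fps_const (of_real (2 + 4 * \<kappa>)) * fps_deriv H) m"
    by (cases m) (simp_all add: H_def numeral_fps_const mult.assoc algebra_simps del: frobenius.simps)
  finally show "fps_nth (4 * fps_X * fps_deriv (fps_deriv H) + fps_const (of_real (2 + 4 * \<kappa>)) * fps_deriv H) m = fps_nth (rps p * H + rps f) m"
    by simp
qed

text \<open>Averaging the expansion with its conjugate and with its reflection yields real
  coefficients and even powers directly, with no comparison of coefficients. The bound on
  \<open>p\<close> comes from the boundedness of the terms at the single point R/2.\<close>

lemma even_real_expansion:
  assumes R: "R > 0" and P: "P holomorphic_on ball 0 R"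
    and ev: "\<And>z. z \<in> ball 0 R \<Longrightarrow> P (- z) = P z" and re: "\<And>z. z \<in> ball 0 R \<Longrightarrow> P (cnj z) = cnj (P z)"
  obtains p :: "nat \<Rightarrow> real" and M where "\<And>k. \<bar>p k\<bar> \<le> M / ((R / 2)\<^sup>2) ^ k"
    "\<And>z. norm z < R \<Longrightarrow> (\<lambda>k. of_real (p k) * (z\<^sup>2) ^ k) sums P z"
proof -
  define c where "c = (\<lambda>k. (deriv ^^ k) P 0 / fact k)"
  have c: "(\<lambda>k. c k * z ^ k) sums P z" if "norm z < R" for z
    using holomorphic_power_series[OF P, of z] that by (simp add: c_def)
  have d: "(\<lambda>k. of_real (Re (c k)) * z ^ k) sums P z" if z: "norm z < R" for z
  proof -
    have "(\<lambda>k. cnj (c k * cnj z ^ k)) sums cnj (P (cnj z))"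
      using c[of "cnj z"] z by (simp only: sums_cnj complex_mod_cnj)
    then have "(\<lambda>k. cnj (c k) * z ^ k) sums P z" using re[of z] z by simp
    from sums_divide[OF sums_add[OF c[OF z] this], of 2]
    have "(\<lambda>k. (c k * z ^ k + cnj (c k) * z ^ k) / 2) sums P z" by simp
    moreover have "(c k * z ^ k + cnj (c k) * z ^ k) / 2 = of_real (Re (c k)) * z ^ k" for k
      by (simp add: complex_add_cnj flip: distrib_right)
    ultimately show ?thesis by simp
  qed
  define p where "p = (\<lambda>k. Re (c (2 * k)))"
  have p: "(\<lambda>k. of_real (p k) * (z\<^sup>2) ^ k) sums P z" if z: "norm z < R" for z
  proof -
    define e where "e = (\<lambda>k. if even k then of_real (Re (c k)) * z ^ k else 0)"
    have "(\<lambda>k. of_real (Re (c k)) * (- z) ^ k) sums P z" using d[of "- z"] z ev[of z] by simp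
    from sums_divide[OF sums_add[OF d[OF z] this], of 2]
    have "(\<lambda>k. (of_real (Re (c k)) * z ^ k + of_real (Re (c k)) * (- z) ^ k) / 2) sums P z" by simp
    moreover have "(of_real (Re (c k)) * z ^ k + of_real (Re (c k)) * (- z) ^ k) / 2 = e k" for k
      by (simp add: e_def)
    ultimately have "e sums P z" by simp
    moreover have "(\<lambda>k. e (2 * k)) sums P z \<longleftrightarrow> e sums P z"
      by (rule sums_mono_reindex) (auto simp: strict_mono_def e_def elim: evenE)
    ultimately show ?thesis by (simp add: e_def p_def power_mult)
  qed
  have "summable (\<lambda>k. of_real (p k) * ((of_real (R / 2) :: complex)\<^sup>2) ^ k)"
    using p[of "of_real (R / 2)"] R sums_summable by fastforce
  then have "Bseq (\<lambda>k. of_real (p k) * ((of_real (R / 2) :: complex)\<^sup>2) ^ k)"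
    by (rule summable_imp_Bseq)
  then obtain M where M: "\<And>k. norm (of_real (p k) * ((of_real (R / 2) :: complex)\<^sup>2) ^ k) \<le> M"
    unfolding Bseq_def by blast
  have "\<bar>p k\<bar> \<le> M / ((R / 2)\<^sup>2) ^ k" for k
  proof -
    have "\<bar>p k\<bar> * ((R / 2)\<^sup>2) ^ k \<le> M"
      using M[of k] R by (simp add: norm_mult norm_power del: of_real_divide)
    then show ?thesis using R by (simp add: pos_le_divide_eq)
  qed
  then show thesis using p that by blast
qed

section \<open>Towers of solutions\<close>

text \<open>The conditions obtained from y'' = (Q + \<epsilon>) y by comparing coefficients of
  \<epsilon>^n.\<close>

definition tower :: "complex set \<Rightarrow> (complex \<Rightarrow> complex) \<Rightarrow> (nat \<Rightarrow> complex \<Rightarrow> complex) \<Rightarrow> (nat \<Rightarrow> complex \<Rightarrow> complex) \<Rightarrow> bool" where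
  "tower S Q y y' \<longleftrightarrow> (\<forall>z\<in>S. \<forall>n. (y n has_field_derivative y' n z) (at z) \<and>
     (y' n has_field_derivative Q z * y n z + (case n of 0 \<Rightarrow> 0 | Suc m \<Rightarrow> y m z)) (at z))"

definition fpsv :: "(nat \<Rightarrow> complex \<Rightarrow> complex) \<Rightarrow> complex \<Rightarrow> complex fps" where
  "fpsv y z = Abs_fps (\<lambda>n. y n z)"

lemma fpsv_nth [simp]: "fpsv y z $ n = y n z"
  by (simp add: fpsv_def)

text \<open>The derivative in z is taken coefficientwise in \<epsilon>, so that the Leibniz rule
  holds in the ring of series and Wronskians can be handled for all orders at once.\<close>

definition has_fps_deriv :: "(complex \<Rightarrow> complex fps) \<Rightarrow> complex fps \<Rightarrow> complex \<Rightarrow> bool" where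
  "has_fps_deriv F F' z \<longleftrightarrow> (\<forall>n. ((\<lambda>z. F z $ n) has_field_derivative F' $ n) (at z))"

lemma has_fps_deriv_const: "has_fps_deriv (\<lambda>z. c) 0 z"
  by (simp add: has_fps_deriv_def)

lemma has_fps_deriv_add:
  "has_fps_deriv F F' z \<Longrightarrow> has_fps_deriv G G' z \<Longrightarrow> has_fps_deriv (\<lambda>z. F z + G z) (F' + G') z"
  by (auto simp: has_fps_deriv_def intro!: derivative_eq_intros)

lemma has_fps_deriv_diff:
  "has_fps_deriv F F' z \<Longrightarrow> has_fps_deriv G G' z \<Longrightarrow> has_fps_deriv (\<lambda>z. F z - G z) (F' - G') z"
  by (auto simp: has_fps_deriv_def intro!: derivative_eq_intros)

lemma has_fps_deriv_mult:
  assumes "has_fps_deriv F F' z" "has_fps_deriv G G' z"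
  shows "has_fps_deriv (\<lambda>z. F z * G z) (F z * G' + F' * G z) z"
  unfolding has_fps_deriv_def
proof
  fix n
  have "((\<lambda>z. \<Sum>i=0..n. F z $ i * G z $ (n - i)) has_field_derivative
      (\<Sum>i=0..n. F z $ i * G' $ (n - i) + F' $ i * G z $ (n - i))) (at z)"
    using assms by (intro DERIV_sum DERIV_mult') (auto simp: has_fps_deriv_def)
  then show "((\<lambda>z. (F z * G z) $ n) has_field_derivative (F z * G' + F' * G z) $ n) (at z)"
    by (simp add: fps_mult_nth sum.distrib)
qed

lemma has_fps_deriv_zero_constant:
  assumes "convex S" "open S" and "\<And>z. z \<in> S \<Longrightarrow> has_fps_deriv F 0 z" and "a \<in> S" "b \<in> S"
  shows "F a = F b"
proof (rule fps_ext)
  fix n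
  have "((\<lambda>z. F z $ n) has_field_derivative 0) (at z within S)" if "z \<in> S" for z
    using assms(3)[OF that] by (auto simp: has_fps_deriv_def intro: has_field_derivative_at_within)
  then obtain c where "\<And>z. z \<in> S \<Longrightarrow> F z $ n = c"
    using has_field_derivative_zero_constant[OF assms(1), of "\<lambda>z. F z $ n"] by blast
  then show "F a $ n = F b $ n" using assms by simp
qed

lemma tower_iff:
  "tower S Q y y' \<longleftrightarrow> (\<forall>z\<in>S. has_fps_deriv (fpsv y) (fpsv y' z) z \<and>
     has_fps_deriv (fpsv y') ((fps_const (Q z) + fps_X) * fpsv y z) z)"
proof -
  have "((fps_const (Q z) + fps_X) * fpsv y z) $ n = Q z * y n z + (case n of 0 \<Rightarrow> 0 | Suc m \<Rightarrow> y m z)" for n z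
    by (auto simp: distrib_right split: nat.split)
  then show ?thesis
    unfolding tower_def has_fps_deriv_def by (auto simp: eta_contract_eq)
qed

lemma tower_subset: "tower S Q y y' \<Longrightarrow> T \<subseteq> S \<Longrightarrow> tower T Q y y'"
  by (auto simp: tower_def)

lemma tower_wronskian:
  assumes "tower S Q y y'" "tower S Q w w'" "z \<in> S"
  shows "has_fps_deriv (\<lambda>z. fpsv y z * fpsv w' z - fpsv y' z * fpsv w z) 0 z"
proof -
  have y: "has_fps_deriv (fpsv y) (fpsv y' z) z" "has_fps_deriv (fpsv y') ((fps_const (Q z) + fps_X) * fpsv y z) z"
    and w: "has_fps_deriv (fpsv w) (fpsv w' z) z" "has_fps_deriv (fpsv w') ((fps_const (Q z) + fps_X) * fpsv w z) z"
    using assms by (auto simp: tower_iff)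
  from has_fps_deriv_diff[OF has_fps_deriv_mult[OF y(1) w(2)] has_fps_deriv_mult[OF y(2) w(1)]]
  show ?thesis by (simp add: algebra_simps)
qed

text \<open>The coefficients \<open>l\<close> and \<open>m\<close> are series in \<epsilon>,
  constant in z: towers form a module over the formal power series.\<close>

lemma tower_lincomb:
  assumes "tower S Q y y'" "tower S Q w w'"
  shows "tower S Q (\<lambda>n z. (l * fpsv y z + m * fpsv w z) $ n) (\<lambda>n z. (l * fpsv y' z + m * fpsv w' z) $ n)"
  unfolding tower_iff
proof
  fix z assume z: "z \<in> S"
  have y: "has_fps_deriv (fpsv y) (fpsv y' z) z" "has_fps_deriv (fpsv y') ((fps_const (Q z) + fps_X) * fpsv y z) z"
    and w: "has_fps_deriv (fpsv w) (fpsv w' z) z" "has_fps_deriv (fpsv w') ((fps_const (Q z) + fps_X) * fpsv w z) z"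
    using assms z by (auto simp: tower_iff)
  have e: "fpsv (\<lambda>n z. (F z :: complex fps) $ n) = F" for F by (rule ext) (simp add: fps_eq_iff)
  show "has_fps_deriv (fpsv (\<lambda>n z. (l * fpsv y z + m * fpsv w z) $ n)) (fpsv (\<lambda>n z. (l * fpsv y' z + m * fpsv w' z) $ n) z) z \<and>
      has_fps_deriv (fpsv (\<lambda>n z. (l * fpsv y' z + m * fpsv w' z) $ n))
        ((fps_const (Q z) + fps_X) * fpsv (\<lambda>n z. (l * fpsv y z + m * fpsv w z) $ n) z) z"
    unfolding e
    using has_fps_deriv_add[OF has_fps_deriv_mult[OF has_fps_deriv_const y(1)] has_fps_deriv_mult[OF has_fps_deriv_const w(1)], of l m]
      has_fps_deriv_add[OF has_fps_deriv_mult[OF has_fps_deriv_const y(2)] has_fps_deriv_mult[OF has_fps_deriv_const w(2)], of l m]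
    by (simp add: algebra_simps)
qed

text \<open>Variation of constants: the terms with \<open>F\<close> cancel in \<open>v'\<close>, and
  in its derivative they are multiplied by the Wronskian, which is 1.\<close>

lemma inhomogeneous_solution:
  assumes S: "convex S" "open S" and a: "a \<in> S"
    and y: "\<And>z. z \<in> S \<Longrightarrow> (y has_field_derivative y' z) (at z)" "\<And>z. z \<in> S \<Longrightarrow> (y' has_field_derivative Q z * y z) (at z)"
    and w: "\<And>z. z \<in> S \<Longrightarrow> (w has_field_derivative w' z) (at z)" "\<And>z. z \<in> S \<Longrightarrow> (w' has_field_derivative Q z * w z) (at z)"
    and W: "\<And>z. z \<in> S \<Longrightarrow> y z * w' z - y' z * w z = (1 :: complex)"
    and F: "F holomorphic_on S"
  obtains v v' where "\<And>z. z \<in> S \<Longrightarrow> (v has_field_derivative v' z) (at z)"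
    "\<And>z. z \<in> S \<Longrightarrow> (v' has_field_derivative Q z * v z + F z) (at z)" "v a = 0" "v' a = 0"
proof -
  have hol: "y holomorphic_on S" "w holomorphic_on S"
    using S y(1) w(1) by (auto simp: holomorphic_on_open)
  have "(\<lambda>z. y z * F z) holomorphic_on S" "(\<lambda>z. w z * F z) holomorphic_on S"
    using hol F by (auto intro!: holomorphic_intros)
  note prim = holomorphic_primitive_at[OF S this(1) a, of 0] holomorphic_primitive_at[OF S this(2) a, of 0]
  obtain A where A: "\<And>z. z \<in> S \<Longrightarrow> (A has_field_derivative y z * F z) (at z)" "A a = 0"
    using prim(1) by blast
  obtain B where B: "\<And>z. z \<in> S \<Longrightarrow> (B has_field_derivative w z * F z) (at z)" "B a = 0"
    using prim(2) by blast
  show thesis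
  proof (rule that[of "\<lambda>z. w z * A z - y z * B z" "\<lambda>z. w' z * A z - y' z * B z"])
    fix z assume z: "z \<in> S"
    show "((\<lambda>z. w z * A z - y z * B z) has_field_derivative w' z * A z - y' z * B z) (at z)"
      by (auto intro!: derivative_eq_intros y(1)[OF z] w(1)[OF z] A(1)[OF z] B(1)[OF z])
    have "((\<lambda>z. w' z * A z - y' z * B z) has_field_derivative
        Q z * (w z * A z - y z * B z) + (y z * w' z - y' z * w z) * F z) (at z)"
      by (auto intro!: derivative_eq_intros y(2)[OF z] w(2)[OF z] A(1)[OF z] B(1)[OF z] simp: algebra_simps)
    then show "((\<lambda>z. w' z * A z - y' z * B z) has_field_derivative
        Q z * (w z * A z - y z * B z) + F z) (at z)"
      by (simp add: W[OF z])
  qed (use A B in auto)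
qed

text \<open>Level n + 1 solves the inhomogeneous equation whose right side is level n. All levels
  above 0 receive zero data at \<open>a\<close>, so the initial values do not depend on
  \<epsilon>.\<close>

lemma tower_extend:
  assumes S: "convex S" "open S" and a: "a \<in> S"
    and y: "\<And>z. z \<in> S \<Longrightarrow> (y has_field_derivative y' z) (at z)" "\<And>z. z \<in> S \<Longrightarrow> (y' has_field_derivative Q z * y z) (at z)"
    and w: "\<And>z. z \<in> S \<Longrightarrow> (w has_field_derivative w' z) (at z)" "\<And>z. z \<in> S \<Longrightarrow> (w' has_field_derivative Q z * w z) (at z)"
    and W: "\<And>z. z \<in> S \<Longrightarrow> y z * w' z - y' z * w z = (1 :: complex)"
    and x: "\<And>z. z \<in> S \<Longrightarrow> (x has_field_derivative x' z) (at z)" "\<And>z. z \<in> S \<Longrightarrow> (x' has_field_derivative Q z * x z) (at z)"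
  obtains X X' where "tower S Q X X'" "fpsv X a = fps_const (x a)" "fpsv X' a = fps_const (x' a)"
proof -
  define P where "P = (\<lambda>n (G :: (complex \<Rightarrow> complex) \<times> (complex \<Rightarrow> complex)). fst G holomorphic_on S \<and> (n = (0::nat) \<longrightarrow> G = (x, x')))"
  define R where "R = (\<lambda>(n::nat) (g :: (complex \<Rightarrow> complex) \<times> (complex \<Rightarrow> complex)) (G :: (complex \<Rightarrow> complex) \<times> (complex \<Rightarrow> complex)).
     (\<forall>z\<in>S. (fst G has_field_derivative snd G z) (at z)) \<and>
     (\<forall>z\<in>S. (snd G has_field_derivative Q z * fst G z + fst g z) (at z)) \<and> fst G a = 0 \<and> snd G a = 0)"
  have "\<exists>G. \<forall>n. P n (G n) \<and> R n (G n) (G (Suc n))"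
  proof (rule dependent_nat_choice)
    have "x holomorphic_on S" unfolding holomorphic_on_open[OF S(2)] using x(1) by blast
    then show "\<exists>G. P 0 G" by (intro exI[of _ "(x, x')"]) (simp add: P_def)
    fix g n assume "P n g"
    then have "fst g holomorphic_on S" by (simp add: P_def)
    from inhomogeneous_solution[OF S a y w W this]
    obtain v v' where v: "\<And>z. z \<in> S \<Longrightarrow> (v has_field_derivative v' z) (at z)"
      "\<And>z. z \<in> S \<Longrightarrow> (v' has_field_derivative Q z * v z + fst g z) (at z)" "v a = 0" "v' a = 0" by blast
    have "v holomorphic_on S" unfolding holomorphic_on_open[OF S(2)] using v(1) by blast
    then show "\<exists>G. P (Suc n) G \<and> R n g G"
      using v by (intro exI[of _ "(v, v')"]) (simp add: P_def R_def)
  qed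
  then obtain G where G: "\<And>n. P n (G n)" "\<And>n. R n (G n) (G (Suc n))" by blast
  have G0: "G 0 = (x, x')" using G(1)[of 0] by (simp add: P_def)
  show thesis
  proof (rule that[of "\<lambda>n. fst (G n)" "\<lambda>n. snd (G n)"])
    show "tower S Q (\<lambda>n. fst (G n)) (\<lambda>n. snd (G n))"
      unfolding tower_def
    proof (intro ballI allI)
      fix z n assume "z \<in> S"
      then show "(fst (G n) has_field_derivative snd (G n) z) (at z) \<and>
        (snd (G n) has_field_derivative Q z * fst (G n) z + (case n of 0 \<Rightarrow> 0 | Suc m \<Rightarrow> fst (G m) z)) (at z)"
        using G(2) x by (cases n) (auto simp: G0 R_def)
    qed
    show "fpsv (\<lambda>n. fst (G n)) a = fps_const (x a)"
    proof (rule fps_ext)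
      fix n show "fpsv (\<lambda>n. fst (G n)) a $ n = fps_const (x a) $ n"
        using G(2)[of "n - 1"] by (cases n) (auto simp: G0 R_def)
    qed
    show "fpsv (\<lambda>n. snd (G n)) a = fps_const (x' a)"
    proof (rule fps_ext)
      fix n show "fpsv (\<lambda>n. snd (G n)) a $ n = fps_const (x' a) $ n"
        using G(2)[of "n - 1"] by (cases n) (auto simp: G0 R_def)
    qed
  qed
qed

lemma fundamental_towers:
  assumes S: "convex S" "open S" and bnd: "bounded S" and Q: "Q holomorphic_on S" "bounded (Q ` S)" and a: "a \<in> S"
  obtains X X' Z Z' where "tower S Q X X'" "fpsv X a = 1" "fpsv X' a = 0"
    "tower S Q Z Z'" "fpsv Z a = 0" "fpsv Z' a = 1"
proof -
  obtain y y' where y: "\<And>z. z \<in> S \<Longrightarrow> (y has_field_derivative y' z) (at z)"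
    "\<And>z. z \<in> S \<Longrightarrow> (y' has_field_derivative Q z * y z) (at z)" "y a = 1" "y' a = 0"
    using picard_homogeneous[OF S bnd Q a, of 1 0] by blast
  obtain w w' where w: "\<And>z. z \<in> S \<Longrightarrow> (w has_field_derivative w' z) (at z)"
    "\<And>z. z \<in> S \<Longrightarrow> (w' has_field_derivative Q z * w z) (at z)" "w a = 0" "w' a = 1"
    using picard_homogeneous[OF S bnd Q a, of 0 1] by blast
  have "((\<lambda>z. y z * w' z - y' z * w z) has_field_derivative 0) (at z within S)" if z: "z \<in> S" for z
    by (rule has_field_derivative_at_within)
       (auto intro!: derivative_eq_intros y(1)[OF z] y(2)[OF z] w(1)[OF z] w(2)[OF z] simp: algebra_simps)
  then obtain c where c: "\<And>z. z \<in> S \<Longrightarrow> y z * w' z - y' z * w z = c"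
    using has_field_derivative_zero_constant[OF S(1), of "\<lambda>z. y z * w' z - y' z * w z"] by blast
  have "c = 1" using c[OF a] y w by simp
  then have W: "\<And>z. z \<in> S \<Longrightarrow> y z * w' z - y' z * w z = 1" using c by simp
  obtain X X' where X: "tower S Q X X'" "fpsv X a = fps_const (y a)" "fpsv X' a = fps_const (y' a)"
    using tower_extend[OF S a y(1,2) w(1,2) W y(1,2)] by blast
  obtain Z Z' where Z: "tower S Q Z Z'" "fpsv Z a = fps_const (w a)" "fpsv Z' a = fps_const (w' a)"
    using tower_extend[OF S a y(1,2) w(1,2) W w(1,2)] by blast
  show thesis using that[of X X' Z Z'] X Z y w by simp
qed

section \<open>Towers at the singular point and their phases\<close>

lemma frobenius_solution:
  fixes H :: "complex fps" and f p :: "nat \<Rightarrow> real"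
  assumes ode: "4 * fps_X * fps_deriv (fps_deriv H) + fps_const (of_real (2 + 4 * \<kappa>)) * fps_deriv H = rps p * H + rps f"
    and rad: "ereal (norm (z\<^sup>2)) < fps_conv_radius H" "ereal (norm (z\<^sup>2)) < fps_conv_radius (rps p)"
      "ereal (norm (z\<^sup>2)) < fps_conv_radius (rps f)"
    and z: "z \<notin> \<real>\<^sub>\<le>\<^sub>0"
    and Q: "Q = of_real (\<kappa> * (\<kappa> - 1)) / z\<^sup>2 + eval_fps (rps p) (z\<^sup>2)"
  defines "w \<equiv> \<lambda>z. z powr of_real \<kappa> * eval_fps H (z\<^sup>2)"
    and "w' \<equiv> \<lambda>z. z powr of_real \<kappa> * (of_real \<kappa> / z * eval_fps H (z\<^sup>2) + 2 * z * eval_fps (fps_deriv H) (z\<^sup>2))"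
  shows "(w has_field_derivative w' z) (at z)"
    and "(w' has_field_derivative Q * w z + z powr of_real \<kappa> * eval_fps (rps f) (z\<^sup>2)) (at z)"
proof -
  have z0: "z \<noteq> 0" using z by auto
  have E: "((\<lambda>z. z powr of_real \<kappa>) has_field_derivative of_real \<kappa> / z * z powr of_real \<kappa>) (at z)"
    using has_field_derivative_powr[OF z, of "of_real \<kappa>"] z0 by (simp add: powr_diff)
  have rad': "ereal (norm (z\<^sup>2)) < fps_conv_radius (fps_deriv H)"
    using rad(1) fps_conv_radius_deriv[of H] by (rule less_le_trans)
  have rad'': "ereal (norm (z\<^sup>2)) < fps_conv_radius (fps_deriv (fps_deriv H))"
    using rad' fps_conv_radius_deriv[of "fps_deriv H"] by (rule less_le_trans)
  have sq: "((\<lambda>z. z\<^sup>2) has_field_derivative 2 * z) (at z)" by (auto intro!: derivative_eq_intros)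
  have H: "((\<lambda>z. eval_fps H (z\<^sup>2)) has_field_derivative eval_fps (fps_deriv H) (z\<^sup>2) * (2 * z)) (at z)"
    by (rule DERIV_chain2[OF has_field_derivative_eval_fps[OF rad(1)] sq])
  have H': "((\<lambda>z. eval_fps (fps_deriv H) (z\<^sup>2)) has_field_derivative
      eval_fps (fps_deriv (fps_deriv H)) (z\<^sup>2) * (2 * z)) (at z)"
    by (rule DERIV_chain2[OF has_field_derivative_eval_fps[OF rad'] sq])
  show "(w has_field_derivative w' z) (at z)"
    unfolding w_def w'_def by (rule DERIV_cong[OF DERIV_mult'[OF E H]]) (simp add: algebra_simps)
  let ?h = "eval_fps H (z\<^sup>2)" and ?h' = "eval_fps (fps_deriv H) (z\<^sup>2)" and ?h'' = "eval_fps (fps_deriv (fps_deriv H)) (z\<^sup>2)"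
  have ode': "4 * z\<^sup>2 * ?h'' + of_real (2 + 4 * \<kappa>) * ?h' = eval_fps (rps p) (z\<^sup>2) * ?h + eval_fps (rps f) (z\<^sup>2)"
  proof -
    let ?x = "z\<^sup>2"
    have m: "ereal (norm ?x) < fps_conv_radius (F * G)"
      if "ereal (norm ?x) < fps_conv_radius F" "ereal (norm ?x) < fps_conv_radius G" for F G :: "complex fps"
      using that by (intro less_le_trans[OF _ fps_conv_radius_mult]) simp
    have c: "ereal (norm ?x) < fps_conv_radius (fps_const c)" "ereal (norm ?x) < fps_conv_radius (fps_X :: complex fps)"
      for c :: complex by simp_all
    have "eval_fps (fps_const 4 * fps_X * fps_deriv (fps_deriv H) + fps_const (of_real (2 + 4 * \<kappa>)) * fps_deriv H) ?x
       = 4 * ?x * ?h'' + of_real (2 + 4 * \<kappa>) * ?h'"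
      by (simp only: eval_fps_add[OF m[OF m[OF c(1) c(2)] rad''] m[OF c(1) rad']] eval_fps_mult[OF m[OF c(1) c(2)] rad'']
        eval_fps_mult[OF c(1) c(2)] eval_fps_mult[OF c(1) rad'] eval_fps_const eval_fps_X)
    moreover have "eval_fps (rps p * H + rps f) ?x = eval_fps (rps p) ?x * ?h + eval_fps (rps f) ?x"
      by (simp only: eval_fps_add[OF m[OF rad(2) rad(1)] rad(3)] eval_fps_mult[OF rad(2) rad(1)])
    moreover have c4: "(4 :: complex fps) = fps_const 4" by (simp add: numeral_fps_const)
    ultimately show ?thesis using ode[unfolded c4] by (simp only:)
  qed
  have "(w' has_field_derivative (of_real \<kappa> / z * z powr of_real \<kappa>) * (of_real \<kappa> / z * ?h + 2 * z * ?h')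
     + (- of_real \<kappa> / z\<^sup>2 * ?h + of_real \<kappa> / z * (?h' * (2 * z)) + (2 * ?h' + 2 * z * (?h'' * (2 * z)))) * z powr of_real \<kappa>) (at z)"
  proof -
    have "((\<lambda>z. of_real \<kappa> / z) has_field_derivative - of_real \<kappa> / z\<^sup>2) (at z)"
      using z0 by (auto intro!: derivative_eq_intros simp: power2_eq_square)
    moreover have "((\<lambda>z. 2 * z) has_field_derivative 2) (at z)"
      by (auto intro!: derivative_eq_intros)
    ultimately show ?thesis
      unfolding w'_def by - (rule DERIV_cong[OF DERIV_mult'[OF E DERIV_add[OF DERIV_mult'[OF _ H] DERIV_mult'[OF _ H']]]], assumption+,
          simp add: algebra_simps)
  qed
  \<comment> \<open>The terms containing \<open>?h\<close> collect to \<kappa>^2 - \<kappa>, the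
    singular coefficient of the potential; the remaining ones form the left side of
    \<open>ode'\<close>.\<close>
  also have "(of_real \<kappa> / z * z powr of_real \<kappa>) * (of_real \<kappa> / z * ?h + 2 * z * ?h')
     + (- of_real \<kappa> / z\<^sup>2 * ?h + of_real \<kappa> / z * (?h' * (2 * z)) + (2 * ?h' + 2 * z * (?h'' * (2 * z)))) * z powr of_real \<kappa>
     = z powr of_real \<kappa> * (of_real (\<kappa> * (\<kappa> - 1)) / z\<^sup>2 * ?h + (4 * z\<^sup>2 * ?h'' + of_real (2 + 4 * \<kappa>) * ?h'))"
    using z0 by (simp add: field_simps power2_eq_square)
  also have "\<dots> = Q * w z + z powr of_real \<kappa> * eval_fps (rps f) (z\<^sup>2)"
    unfolding ode' Q w_def by (simp add: algebra_simps)
  finally show "(w' has_field_derivative Q * w z + z powr of_real \<kappa> * eval_fps (rps f) (z\<^sup>2)) (at z)" .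
qed

lemma fps_deriv_rps: "fps_deriv (rps h) = rps (\<lambda>k. real (Suc k) * h (Suc k))"
  by (simp add: fps_eq_iff)

text \<open>The quarter turn from the positive real to the positive imaginary axis multiplies
  z^\<kappa> by this phase, the only trace that the singular point leaves in the connection
  relation.\<close>

lemma powr_imaginary:
  assumes "y > 0"
  shows "(\<i> * of_real y) powr of_real \<kappa> = cis (pi * \<kappa> / 2) * of_real (y powr \<kappa>)"
proof -
  have "exp (\<i> * of_real (pi / 2)) = \<i>"
    by (simp only: cis_conv_exp[symmetric] cis_pi_half)
  then have "exp (of_real (ln y) + \<i> * of_real (pi / 2)) = \<i> * of_real y"
    using assms by (simp add: exp_add exp_of_real del: of_real_divide)
  then have "Ln (\<i> * of_real y) = of_real (ln y) + \<i> * of_real (pi / 2)"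
    by (intro Ln_unique) (auto simp: pi_gt_zero)
  then have "(\<i> * of_real y) powr of_real \<kappa> = exp (of_real (\<kappa> * ln y) + \<i> * of_real (pi * \<kappa> / 2))"
    using assms by (simp add: powr_def algebra_simps)
  also have "\<dots> = of_real (exp (\<kappa> * ln y)) * cis (pi * \<kappa> / 2)"
    by (simp only: exp_add exp_of_real cis_conv_exp)
  finally show ?thesis using assms by (simp add: powr_def mult.commute)
qed

text \<open>The parameter \<epsilon> does not enter the coefficient of 1/z^2, so every level carries
  the same factor z^\<kappa>, multiplied by a real series in z^2. All coefficients therefore acquire
  the same phase on the imaginary axis: the formal counterpart of a monodromy independent of
  \<epsilon>.\<close>

lemma frobenius_tower:
  assumes \<kappa>: "\<kappa> \<ge> 0" and \<rho>: "\<rho> > 0" and p: "\<And>k. \<bar>p k\<bar> \<le> M / \<rho> ^ k"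
    and Q: "\<And>z. z \<noteq> 0 \<Longrightarrow> norm (z\<^sup>2) < \<rho> \<Longrightarrow> Q z = of_real (\<kappa> * (\<kappa> - 1)) / z\<^sup>2 + eval_fps (rps p) (z\<^sup>2)"
  obtains r w w' where "r > 0" "tower {z. z \<notin> \<real>\<^sub>\<le>\<^sub>0 \<and> norm z < r} Q w w'"
    "\<And>z. z \<notin> \<real>\<^sub>\<le>\<^sub>0 \<Longrightarrow> norm z < r \<Longrightarrow> w 0 z \<noteq> 0"
    "\<And>n x. 0 < x \<Longrightarrow> x < r \<Longrightarrow> w n (of_real x) \<in> \<real> \<and> w' n (of_real x) \<in> \<real>"
    "\<And>n y. 0 < y \<Longrightarrow> y < r \<Longrightarrow> cis (- (pi * \<kappa> / 2)) * w n (\<i> * of_real y) \<in> \<real> \<and>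
        cis (- (pi * \<kappa> / 2)) * \<i> * w' n (\<i> * of_real y) \<in> \<real>"
proof -
  have M: "M \<ge> 0" using p[of 0] by simp
  \<comment> \<open>The radius is shrunk to meet the condition \<open>\<rho>1 * M \<le> 1\<close> of
    \<open>frobenius_bound\<close>.\<close>
  define \<rho>1 where "\<rho>1 = min \<rho> (1 / (M + 1))"
  have \<rho>1: "\<rho>1 > 0" "\<rho>1 \<le> \<rho>" "\<rho>1 * M \<le> 1"
  proof -
    show "\<rho>1 > 0" "\<rho>1 \<le> \<rho>" using \<rho> M by (auto simp: \<rho>1_def)
    have "\<rho>1 * M \<le> 1 / (M + 1) * M" using M by (intro mult_right_mono) (auto simp: \<rho>1_def)
    also have "\<dots> \<le> 1" using M by simp
    finally show "\<rho>1 * M \<le> 1" .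
  qed
  have p1: "\<bar>p k\<bar> \<le> M / \<rho>1 ^ k" for k
  proof -
    have "M / \<rho> ^ k \<le> M / \<rho>1 ^ k" using M \<rho>1 by (intro divide_left_mono power_mono) auto
    then show ?thesis using p[of k] by linarith
  qed
  \<comment> \<open>Level 0 starts with coefficient 1, all higher levels with 0; each level is the
    inhomogeneity of the next.\<close>
  define ht where "ht = rec_nat (frobenius \<kappa> p (\<lambda>_. 0) 1) (\<lambda>n f. frobenius \<kappa> p f 0)"
  have ht: "ht 0 = frobenius \<kappa> p (\<lambda>_. 0) 1" "ht (Suc n) = frobenius \<kappa> p (ht n) 0" for n
    by (simp_all add: ht_def)
  have bound: "\<exists>C. \<forall>k. \<bar>ht n k\<bar> \<le> C / \<rho>1 ^ k" for n
  proof (induction n)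
    case 0
    show ?case unfolding ht using frobenius_bound[OF \<kappa> \<rho>1(1) p1 \<rho>1(3), of "\<lambda>_. 0" 0 1] by auto
  next
    case (Suc n)
    then obtain C where "\<And>k. \<bar>ht n k\<bar> \<le> C / \<rho>1 ^ k" by blast
    from frobenius_bound[OF \<kappa> \<rho>1(1) p1 \<rho>1(3) this, of 0] show ?case unfolding ht by blast
  qed
  have rad: "ereal x < fps_conv_radius (rps (ht n))" if "x < \<rho>1" for n x
  proof -
    obtain C where "\<And>k. \<bar>ht n k\<bar> \<le> C / \<rho>1 ^ k" using bound by blast
    from rps_conv_radius[OF \<rho>1(1) this] that show ?thesis by (meson ereal_less_eq(3) less_le_trans ereal_less(2) less_ereal.simps(1))
  qed
  have radp: "ereal x < fps_conv_radius (rps p)" if "x < \<rho>1" for x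
    using rps_conv_radius[OF \<rho>1(1) p1] that by (meson less_le_trans less_ereal.simps(1))
  have "eval_fps (rps (ht 0)) 0 \<noteq> 0" by (simp add: eval_fps_at_0 ht)
  moreover have "isCont (eval_fps (rps (ht 0))) 0"
  proof (rule DERIV_isCont[OF has_field_derivative_eval_fps])
    show "ereal (norm (0 :: complex)) < fps_conv_radius (rps (ht 0))"
      unfolding norm_zero by (rule rad[OF \<rho>1(1)])
  qed
  ultimately obtain d where d: "d > 0" "\<And>x. norm x < d \<Longrightarrow> eval_fps (rps (ht 0)) x \<noteq> 0"
    using continuous_at_avoid[of 0 "eval_fps (rps (ht 0))" 0] by (auto simp: dist_norm)
  \<comment> \<open>The square root converts a radius in the variable z^2 into one in z;
    \<open>d\<close> keeps \<open>w 0\<close> free of zeros, which later shows that the solution is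
    not trivial.\<close>
  define r where "r = sqrt (min \<rho>1 d)"
  have r: "r > 0" using \<rho>1 d by (simp add: r_def)
  have sq: "norm (z\<^sup>2) < \<rho>1" "norm (z\<^sup>2) < d" "norm (z\<^sup>2) < \<rho>" if "norm z < r" for z :: complex
  proof -
    have "(norm z)\<^sup>2 < r\<^sup>2" using that by (intro power_strict_mono) auto
    then have "norm (z\<^sup>2) < min \<rho>1 d" using \<rho>1 d by (simp add: r_def norm_power)
    then show "norm (z\<^sup>2) < \<rho>1" "norm (z\<^sup>2) < d" "norm (z\<^sup>2) < \<rho>" using \<rho>1 by auto
  qed
  define w where "w = (\<lambda>n z. z powr of_real \<kappa> * eval_fps (rps (ht n)) (z\<^sup>2))"
  define w' where "w' = (\<lambda>n z. z powr of_real \<kappa> * (of_real \<kappa> / z * eval_fps (rps (ht n)) (z\<^sup>2)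
     + 2 * z * eval_fps (fps_deriv (rps (ht n))) (z\<^sup>2)))"
  have T: "(w n has_field_derivative w' n z) (at z) \<and>
      (w' n has_field_derivative Q z * w n z + (case n of 0 \<Rightarrow> 0 | Suc m \<Rightarrow> w m z)) (at z)"
    if z: "z \<notin> \<real>\<^sub>\<le>\<^sub>0" "norm z < r" for n z
  proof (cases n)
    case 0
    have "rps (\<lambda>_. 0) = 0" by (simp add: fps_eq_iff)
    then have r0: "ereal (norm (z\<^sup>2)) < fps_conv_radius (rps (\<lambda>_. 0))" "eval_fps (rps (\<lambda>_. 0)) x = 0" for x
      by simp_all
    have "z \<noteq> 0" using z by auto
    from frobenius_solution[OF frobenius_fps[OF \<kappa>] rad[of _ 0, unfolded ht] radp r0(1) z(1) Q[OF this]] sq[OF z(2)]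
    show ?thesis unfolding w_def w'_def 0 ht(1) by (simp add: r0(2))
  next
    case (Suc m)
    have "z \<noteq> 0" using z by auto
    from frobenius_solution[OF frobenius_fps[OF \<kappa>] rad[of _ "Suc m", unfolded ht] radp rad[of _ m] z(1) Q[OF this]] sq[OF z(2)]
    show ?thesis unfolding w_def w'_def Suc ht(2) by simp
  qed
  have ev: "eval_fps (rps (ht n)) x \<in> \<real>" "eval_fps (fps_deriv (rps (ht n))) x \<in> \<real>"
    if "norm x < \<rho>1" "x \<in> \<real>" for n x
  proof -
    show "eval_fps (rps (ht n)) x \<in> \<real>" using eval_rps_real[OF that(2) rad[OF that(1)]] .
    have "ereal (norm x) < fps_conv_radius (fps_deriv (rps (ht n)))"
      using rad[OF that(1)] fps_conv_radius_deriv by (rule less_le_trans)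
    then show "eval_fps (fps_deriv (rps (ht n))) x \<in> \<real>"
      unfolding fps_deriv_rps using eval_rps_real[OF that(2)] by blast
  qed
  show thesis
  proof (rule that[of r w w'])
    show "tower {z. z \<notin> \<real>\<^sub>\<le>\<^sub>0 \<and> norm z < r} Q w w'" unfolding tower_def using T by blast
    show "w 0 z \<noteq> 0" if "z \<notin> \<real>\<^sub>\<le>\<^sub>0" "norm z < r" for z
      using d(2)[OF sq(2)[OF that(2)]] that(1) unfolding w_def by auto
    show "w n (of_real x) \<in> \<real> \<and> w' n (of_real x) \<in> \<real>" if x: "0 < x" "x < r" for n x
    proof -
      have "norm ((of_real x :: complex)\<^sup>2) < \<rho>1" by (rule sq(1)) (use x in simp)
      note ev = ev[OF this]
      show ?thesis unfolding w_def w'_def using x ev by (auto simp: powr_of_real intro!: Reals_mult Reals_add Reals_divide)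
    qed
    show "cis (- (pi * \<kappa> / 2)) * w n (\<i> * of_real y) \<in> \<real> \<and> cis (- (pi * \<kappa> / 2)) * \<i> * w' n (\<i> * of_real y) \<in> \<real>"
      if y: "0 < y" "y < r" for n y
    proof -
      let ?z = "\<i> * of_real y :: complex"
      have "norm (?z\<^sup>2) < \<rho>1" by (rule sq(1)) (use y in \<open>simp add: norm_mult\<close>)
      moreover have "?z\<^sup>2 \<in> \<real>" by (simp add: power_mult_distrib)
      ultimately have e: "eval_fps (rps (ht n)) (?z\<^sup>2) \<in> \<real>" "eval_fps (fps_deriv (rps (ht n))) (?z\<^sup>2) \<in> \<real>"
        by (rule ev)+
      have c: "cis (- (pi * \<kappa> / 2)) * (cis (pi * \<kappa> / 2) * x) = x" for x
        by (simp add: cis_mult flip: mult.assoc)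
      have 1: "cis (- (pi * \<kappa> / 2)) * w n ?z = of_real (y powr \<kappa>) * eval_fps (rps (ht n)) (?z\<^sup>2)"
        unfolding w_def powr_imaginary[OF y(1)] mult.assoc c ..
      have 2: "cis (- (pi * \<kappa> / 2)) * \<i> * w' n ?z = of_real (y powr \<kappa>) *
          (of_real (\<kappa> / y) * eval_fps (rps (ht n)) (?z\<^sup>2) - of_real (2 * y) * eval_fps (fps_deriv (rps (ht n))) (?z\<^sup>2))"
      proof -
        have "cis (- (pi * \<kappa> / 2)) * \<i> * w' n ?z = cis (- (pi * \<kappa> / 2)) * (cis (pi * \<kappa> / 2) * (of_real (y powr \<kappa>) *
          (\<i> * (of_real \<kappa> / ?z * eval_fps (rps (ht n)) (?z\<^sup>2) + 2 * ?z * eval_fps (fps_deriv (rps (ht n))) (?z\<^sup>2)))))"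
          unfolding w'_def powr_imaginary[OF y(1)] by (simp only: mult_ac)
        moreover have "\<i> * (of_real \<kappa> / ?z * s + 2 * ?z * t) = of_real (\<kappa> / y) * s - of_real (2 * y) * t" for s t
          using y(1) by (simp add: field_simps)
        ultimately show ?thesis unfolding c by (simp only:)
      qed
      show ?thesis unfolding 1 2 using e by (auto intro!: Reals_mult Reals_diff)
    qed
  qed (rule r)
qed

section \<open>Restriction to the edges of the rectangle\<close>

lemma has_derivative_along_line:
  fixes d k :: complex
  assumes "(g has_field_derivative g') (at (p + of_real t * d))"
  shows "((\<lambda>t. Re (k * g (p + of_real t * d))) has_real_derivative Re (k * d * g')) (at t)"
    and "((\<lambda>t. Im (k * g (p + of_real t * d))) has_real_derivative Im (k * d * g')) (at t)"
proof -
  have "((\<lambda>t. p + of_real t * d) has_vector_derivative d) (at t)"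
    by (auto intro!: derivative_eq_intros)
  from field_vector_diff_chain_at[OF this assms]
  have "((\<lambda>t. g (p + of_real t * d)) has_vector_derivative d * g') (at t)" by (simp add: o_def)
  then have *: "((\<lambda>t. k * g (p + of_real t * d)) has_vector_derivative k * d * g') (at t)"
    using has_vector_derivative_mult_right[of _ _ _ k] by (simp add: mult.assoc)
  show "((\<lambda>t. Re (k * g (p + of_real t * d))) has_real_derivative Re (k * d * g')) (at t)"
    and "((\<lambda>t. Im (k * g (p + of_real t * d))) has_real_derivative Im (k * d * g')) (at t)"
    unfolding has_real_derivative_iff_has_vector_derivative
    using bounded_linear.has_vector_derivative[OF bounded_linear_Re *]
      bounded_linear.has_vector_derivative[OF bounded_linear_Im *] by simp_all
qed

text \<open>On a line where \<open>Q\<close> is real and whose direction has real square \<sigma>,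
  the imaginary part of \<open>k * y n\<close> satisfies a real linear equation, homogeneous once
  the previous level is known to be real. Uniqueness then carries reality from \<open>s\<close> to
  \<open>t\<close>, level by level. The factor \<open>k\<close> removes a phase.\<close>

lemma tower_line_real:
  fixes Q :: "complex \<Rightarrow> complex"
  assumes T: "tower S Q y y'" and S: "\<And>t. t \<in> {a..b} \<Longrightarrow> p + of_real t * d \<in> S"
    and d: "d * d = of_real \<sigma>"
    and cont: "continuous_on {a..b} (\<lambda>t. Re (Q (p + of_real t * d)))"
    and real: "\<And>t. t \<in> {a..b} \<Longrightarrow> Q (p + of_real t * d) \<in> \<real>"
    and s: "s \<in> {a..b}" "\<And>n. k * y n (p + of_real s * d) \<in> \<real>" "\<And>n. k * d * y' n (p + of_real s * d) \<in> \<real>"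
    and t: "t \<in> {a..b}"
  shows "k * y n (p + of_real t * d) \<in> \<real> \<and> k * d * y' n (p + of_real t * d) \<in> \<real>"
  unfolding complex_is_Real_iff
  using t
proof (induction n arbitrary: t rule: less_induct)
  case (less n)
  show ?case
  proof (rule linear_ode_unique[where q = "\<lambda>t. \<sigma> * Re (Q (p + of_real t * d))", OF _ _ _ s(1) _ _ less.prems])
    fix t assume t: "t \<in> {a..b}"
    note y = T[unfolded tower_def, rule_format, OF S[OF t], of n]
    show "((\<lambda>t. Im (k * y n (p + of_real t * d))) has_real_derivative Im (k * d * y' n (p + of_real t * d))) (at t)"
      using has_derivative_along_line(2) y by blast
    let ?e = "case n of 0 \<Rightarrow> 0 | Suc m \<Rightarrow> y m (p + of_real t * d)"
    have "((\<lambda>t. Im (k * d * y' n (p + of_real t * d))) has_real_derivative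
        Im (k * d * d * (Q (p + of_real t * d) * y n (p + of_real t * d) + ?e))) (at t)"
      using has_derivative_along_line(2) y by blast
    moreover have "Im (k * d * d * (Q (p + of_real t * d) * y n (p + of_real t * d) + ?e)) =
       \<sigma> * Re (Q (p + of_real t * d)) * Im (k * y n (p + of_real t * d))"
    proof -
      have e: "Im (k * ?e) = 0" using less.IH t by (cases n) auto
      obtain q where q: "Q (p + of_real t * d) = of_real q" using real[OF t] by (auto elim: Reals_cases)
      have "k * d * d * (of_real q * y n (p + of_real t * d) + ?e)
         = of_real \<sigma> * (of_real q * (k * y n (p + of_real t * d)) + k * ?e)"
        unfolding d[symmetric] by (simp add: algebra_simps)
      then show ?thesis unfolding q using e by (simp only: Re_complex_of_real plus_complex.sel Im_complex_of_real times_complex.sel) (simp add: algebra_simps)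
    qed
    ultimately show "((\<lambda>t. Im (k * d * y' n (p + of_real t * d))) has_real_derivative
       \<sigma> * Re (Q (p + of_real t * d)) * Im (k * y n (p + of_real t * d))) (at t)" by simp
  qed (use s cont in \<open>auto simp: complex_is_Real_iff intro!: continuous_intros\<close>)
qed

text \<open>In the parametrization z = p + t d both the potential and \<epsilon> are multiplied by
  d^2 = \<sigma>: here \<open>q\<close> already contains this factor, and the coupling of the levels
  shows it explicitly. It is -1 on vertical lines.\<close>

definition real_tower :: "real \<Rightarrow> (real \<Rightarrow> real) \<Rightarrow> real \<Rightarrow> (nat \<Rightarrow> real \<Rightarrow> real) \<Rightarrow> (nat \<Rightarrow> real \<Rightarrow> real) \<Rightarrow> bool" where
  "real_tower \<sigma> q L x x' \<longleftrightarrow> (\<forall>t\<in>{0..L}. \<forall>n. (x n has_real_derivative x' n t) (at t) \<and>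
     (x' n has_real_derivative q t * x n t + (case n of 0 \<Rightarrow> 0 | Suc m \<Rightarrow> \<sigma> * x m t)) (at t))"

lemma tower_line_real_tower:
  fixes Q :: "complex \<Rightarrow> complex"
  assumes T: "tower S Q y y'" and S: "\<And>t. t \<in> {0..L} \<Longrightarrow> p + of_real t * d \<in> S"
    and d: "d * d = of_real \<sigma>"
    and real: "\<And>t. t \<in> {0..L} \<Longrightarrow> Q (p + of_real t * d) \<in> \<real>"
  shows "real_tower \<sigma> (\<lambda>t. \<sigma> * Re (Q (p + of_real t * d))) L
    (\<lambda>n t. Re (k * y n (p + of_real t * d))) (\<lambda>n t. Re (k * d * y' n (p + of_real t * d)))"
  unfolding real_tower_def
proof (intro ballI allI conjI)
  fix t n assume t: "t \<in> {0..L}"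
  note y = T[unfolded tower_def, rule_format, OF S[OF t], of n]
  show "((\<lambda>t. Re (k * y n (p + of_real t * d))) has_real_derivative Re (k * d * y' n (p + of_real t * d))) (at t)"
    using has_derivative_along_line(1) y by blast
  let ?e = "case n of 0 \<Rightarrow> 0 | Suc m \<Rightarrow> y m (p + of_real t * d)"
  have "((\<lambda>t. Re (k * d * y' n (p + of_real t * d))) has_real_derivative
      Re (k * d * d * (Q (p + of_real t * d) * y n (p + of_real t * d) + ?e))) (at t)"
    using has_derivative_along_line(1) y by blast
  moreover have "Re (k * d * d * (Q (p + of_real t * d) * y n (p + of_real t * d) + ?e)) =
     \<sigma> * Re (Q (p + of_real t * d)) * Re (k * y n (p + of_real t * d)) +
      (case n of 0 \<Rightarrow> 0 | Suc m \<Rightarrow> \<sigma> * Re (k * y m (p + of_real t * d)))"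
  proof -
    have e: "(case n of 0 \<Rightarrow> 0 | Suc m \<Rightarrow> \<sigma> * Re (k * y m (p + of_real t * d))) = \<sigma> * Re (k * ?e)"
      by (cases n) auto
    obtain q where q: "Q (p + of_real t * d) = of_real q" using real[OF t] by (auto elim: Reals_cases)
    have "k * d * d * (of_real q * y n (p + of_real t * d) + ?e)
       = of_real \<sigma> * (of_real q * (k * y n (p + of_real t * d)) + k * ?e)"
      unfolding d[symmetric] by (simp add: algebra_simps)
    then show ?thesis unfolding q e by (simp only: Re_complex_of_real plus_complex.sel Im_complex_of_real times_complex.sel) (simp add: algebra_simps)
  qed
  ultimately show "((\<lambda>t. Re (k * d * y' n (p + of_real t * d))) has_real_derivative
     \<sigma> * Re (Q (p + of_real t * d)) * Re (k * y n (p + of_real t * d)) +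
      (case n of 0 \<Rightarrow> 0 | Suc m \<Rightarrow> \<sigma> * Re (k * y m (p + of_real t * d)))) (at t)" by simp
qed

section \<open>Logarithmic concavity in the parameter and the second order contradiction\<close>

definition fps_turan :: "real fps \<Rightarrow> real" where
  "fps_turan F = 2 * fps_nth F 0 * fps_nth F 2 - (fps_nth F 1)\<^sup>2"

lemma fps_mult_low:
  fixes F G :: "'a :: comm_ring_1 fps"
  shows "fps_nth (F * G) 0 = fps_nth F 0 * fps_nth G 0" "fps_nth (F * G) 1 = fps_nth F 0 * fps_nth G 1 + fps_nth F 1 * fps_nth G 0"
    "fps_nth (F * G) 2 = fps_nth F 0 * fps_nth G 2 + fps_nth F 1 * fps_nth G 1 + fps_nth F 2 * fps_nth G 0"
  by (simp_all add: fps_mult_nth numeral_2_eq_2)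

text \<open>\<open>fps_turan F\<close> is F F'' - F'^2 at \<epsilon> = 0, that is, F^2 times the
  second logarithmic derivative. The identity is the additivity of (log F)'' with denominators
  cleared, valid also when a factor vanishes.\<close>

lemma fps_turan_mult: "fps_turan (F * G) = (fps_nth F 0)\<^sup>2 * fps_turan G + (fps_nth G 0)\<^sup>2 * fps_turan F"
  unfolding fps_turan_def fps_mult_low by (simp add: power2_eq_square algebra_simps)

lemma fps_turan_mult_nonpos: "fps_turan F \<le> 0 \<Longrightarrow> fps_turan G \<le> 0 \<Longrightarrow> fps_turan (F * G) \<le> 0"
  unfolding fps_turan_mult by (intro add_nonpos_nonpos mult_nonneg_nonpos) auto

lemma fps_turan_mult_neg:
  "fps_turan F < 0 \<Longrightarrow> fps_turan G \<le> 0 \<Longrightarrow> fps_nth G 0 \<noteq> 0 \<Longrightarrow> fps_turan (F * G) < 0"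
  unfolding fps_turan_mult by (intro add_nonpos_neg mult_nonneg_nonpos mult_pos_neg) auto

text \<open>The unprimed series belong to one edge and the primed ones to the other; the constants
  \<open>k0\<close> and \<open>k1\<close> are common to both, which forces \<open>G\<close> and
  \<open>H\<close> to agree up to first order. One strictly concave factor is enough:
  \<open>K \<noteq> 0\<close> makes the constant coefficients of all factors of \<open>G\<close>
  nonzero, so strictness survives the multiplication.\<close>

lemma no_double_contact:
  fixes a da c dc a' da' c' dc' :: "real fps"
  assumes rel: "a * da * (c' * dc') + c * dc * (a' * da') = fps_const K" and K: "K \<noteq> 0"
    and k: "fps_nth (a * da) 0 = k0 * fps_nth (c * dc) 0" "fps_nth (a * da) 1 = k0 * fps_nth (c * dc) 1 + k1 * fps_nth (c * dc) 0"
      "fps_nth (a' * da') 0 = k0 * fps_nth (c' * dc') 0" "fps_nth (a' * da') 1 = k0 * fps_nth (c' * dc') 1 + k1 * fps_nth (c' * dc') 0"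
    and turan: "fps_turan a \<le> 0" "fps_turan da < 0" "fps_turan c \<le> 0" "fps_turan dc \<le> 0"
      "fps_turan a' \<le> 0" "fps_turan da' \<le> 0" "fps_turan c' \<le> 0" "fps_turan dc' \<le> 0"
  shows False
proof -
  define G where "G = a * da * (c' * dc')"
  define H where "H = c * dc * (a' * da')"
  have GH: "G + H = fps_const K" using rel by (simp add: G_def H_def)
  have 0: "fps_nth G 0 = fps_nth H 0" unfolding G_def H_def fps_mult_low(1)[of "a * da"] fps_mult_low(1)[of "c * dc"] k by simp
  have 1: "fps_nth G 1 = fps_nth H 1" unfolding G_def H_def fps_mult_low(1,2)[of "a * da"] fps_mult_low(1,2)[of "c * dc"] k
    by (simp add: algebra_simps)
  have s: "fps_nth G n + fps_nth H n = (if n = 0 then K else 0)" for n using arg_cong[OF GH, of "\<lambda>F. fps_nth F n"] by simp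
  have G0: "fps_nth G 0 \<noteq> 0" using s[of 0] 0 K by auto
  have G1: "fps_nth G 1 = 0" "fps_nth H 1 = 0" using s[of 1] 1 by auto
  have "fps_nth H 2 = - fps_nth G 2" using s[of 2] by simp
  then have sum: "fps_turan G + fps_turan H = 0"
    unfolding fps_turan_def G1 0 by simp
  have nz: "fps_nth a 0 \<noteq> 0" "fps_nth da 0 \<noteq> 0" "fps_nth c' 0 \<noteq> 0" "fps_nth dc' 0 \<noteq> 0" using G0 by (auto simp: G_def)
  have "fps_turan (da * a) < 0" using turan nz by (intro fps_turan_mult_neg) auto
  then have "fps_turan (a * da) < 0" by (simp add: mult.commute)
  moreover have "fps_turan (c' * dc') \<le> 0" using turan by (intro fps_turan_mult_nonpos) auto
  moreover have "fps_nth (c' * dc') 0 \<noteq> 0" using nz by simp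
  ultimately have "fps_turan G < 0" unfolding G_def by (rule fps_turan_mult_neg)
  moreover have "fps_turan H \<le> 0" unfolding H_def using turan by (intro fps_turan_mult_nonpos) auto
  ultimately show False using sum by simp
qed

section \<open>The lattice and the connection relation on a quarter of the torus\<close>

lemma lattice_iff: "b \<noteq> 0 \<Longrightarrow> z \<in> lattice b \<longleftrightarrow> Re z \<in> \<int> \<and> Im z / b \<in> \<int>"
  by (fastforce simp: lattice_def complex_eq_iff field_simps elim!: Ints_cases)

lemma closed_lattice: "b \<noteq> 0 \<Longrightarrow> closed (lattice b)"
proof -
  assume b: "b \<noteq> 0"
  have "lattice b = (Re -` \<int>) \<inter> ((\<lambda>z. Im z / b) -` \<int>)"
    using lattice_iff[OF b] by auto
  moreover have "closed (Re -` \<int>)" "closed ((\<lambda>z. Im z / b) -` \<int>)"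
    by (intro continuous_closed_vimage closed_Ints continuous_intros; use b in simp)+
  ultimately show ?thesis by auto
qed

lemma rps_fps_mult: "rps (fps_nth F) * rps (fps_nth G) = rps (fps_nth (F * G))"
  by (simp add: fps_eq_iff fps_mult_nth)

lemma rps_fps_add: "rps (fps_nth F) + rps (fps_nth G) = rps (fps_nth (F + G))"
  by (simp add: fps_eq_iff)

lemma rps_fps_eq_iff: "rps (fps_nth F) = rps (fps_nth G) \<longleftrightarrow> F = G"
  by (simp add: fps_eq_iff)

lemma cnj_fps_rps: "cnj_fps (rps p) = rps p"
  by (simp add: fps_eq_iff)

text \<open>The slanted line cuts off the corner 0, so that the domain is convex, avoids the lattice
  and the branch cut, and still contains the rectangle with corners 0, 1/2, center and
  \<open>\<i> * b / 2\<close> up to a small triangle at 0. The bound 3/4 leaves room around the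
  other corners without reaching further lattice points. \<open>C\<close> is a compact set off the
  lattice, which bounds \<open>Q\<close> on \<open>D\<close>.\<close>

lemma connection_domain:
  fixes b \<delta> :: real
  assumes b: "b > 0" and \<delta>: "\<delta> > 0"
  defines "D \<equiv> {z. Re z + Im z / b > \<delta> \<and> Re z < 3/4 \<and> Im z < 3/4 * b}"
  shows "open D" "convex D" "bounded D" "D \<inter> lattice b = {}" "D \<inter> \<real>\<^sub>\<le>\<^sub>0 = {}"
    and "\<And>Q :: complex \<Rightarrow> complex. continuous_on (- lattice b) Q \<Longrightarrow> bounded (Q ` D)"
proof -
  define C where "C = {z. Re z + Im z / b \<ge> \<delta> \<and> Re z \<le> 3/4 \<and> Im z \<le> 3/4 * b}"
  have DC: "D \<subseteq> C" by (auto simp: D_def C_def)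
  have D: "D = {z. Re z + Im z / b > \<delta>} \<inter> {z. Re z < 3/4} \<inter> {z. Im z < 3/4 * b}"
    by (auto simp: D_def)
  show "open D" unfolding D
    by (intro open_Int open_Collect_less continuous_intros) (use b in auto)
  have "{z. Re z + Im z / b > \<delta>} = {z. Complex 1 (1/b) \<bullet> z > \<delta>}"
    by (auto simp: inner_complex_def field_simps)
  then show "convex D" unfolding D
    by (intro convex_Int convex_halfspace_Re_lt convex_halfspace_Im_lt) (simp only: convex_halfspace_gt)
  have C: "C = {z. Re z + Im z / b \<ge> \<delta>} \<inter> {z. Re z \<le> 3/4} \<inter> {z. Im z \<le> 3/4 * b}"
    by (auto simp: C_def)
  have clC: "closed C" unfolding C
    by (intro closed_Int closed_Collect_le continuous_intros) (use b in auto)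
  have Cl: "C \<inter> lattice b = {}"
  proof -
    have False if z: "z \<in> C" "z \<in> lattice b" for z
    proof -
      obtain m k where mk: "Re z = of_int m" "Im z / b = of_int k"
        using z(2) lattice_iff[of b z] b by (auto elim!: Ints_cases)
      have "Im z / b \<le> 3/4" using z(1) b by (simp add: C_def divide_le_eq)
      then have "k \<le> 0" "m \<le> 0" using z(1) mk by (auto simp: C_def)
      then have "real_of_int m + real_of_int k \<le> 0" by (simp flip: of_int_add)
      then show False using z(1) mk \<delta> by (simp add: C_def)
    qed
    then show ?thesis by blast
  qed
  have "norm z \<le> 3 + 3 * b" if "z \<in> C" for z
  proof -
    have 1: "Im z / b \<le> 3/4" "Re z \<le> 3/4" "Re z + Im z / b \<ge> \<delta>"
      using that b by (auto simp: C_def divide_le_eq)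
    then have "\<bar>Re z\<bar> \<le> 3" "\<bar>Im z / b\<bar> \<le> 3" using \<delta> by linarith+
    then have "\<bar>Re z\<bar> \<le> 3" "\<bar>Im z\<bar> \<le> 3 * b" using b by (auto simp: abs_divide pos_divide_le_eq)
    then show ?thesis using cmod_le[of z] by linarith
  qed
  then have bC: "bounded C" unfolding bounded_iff by blast
  then show "bounded D" using DC bounded_subset by blast
  show "D \<inter> lattice b = {}" using DC Cl by blast
  have "z \<notin> \<real>\<^sub>\<le>\<^sub>0" if "z \<in> D" for z
  proof
    assume "z \<in> \<real>\<^sub>\<le>\<^sub>0"
    then have "Im z = 0" "Re z \<le> 0" by (auto simp: complex_nonpos_Reals_iff)
    then show False using that \<delta> by (simp add: D_def)
  qed
  then show "D \<inter> \<real>\<^sub>\<le>\<^sub>0 = {}" by blast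
  fix Q :: "complex \<Rightarrow> complex" assume Q: "continuous_on (- lattice b) Q"
  have "compact C" using clC bC by (simp add: compact_eq_bounded_closed)
  moreover have "continuous_on C Q" by (rule continuous_on_subset[OF Q]) (use Cl in blast)
  ultimately have "bounded (Q ` C)" by (intro compact_imp_bounded compact_continuous_image)
  then show "bounded (Q ` D)" using DC by (meson bounded_subset image_mono)
qed

text \<open>The Frobenius tower at 0 continues to \<open>D\<close> as a combination of the two
  towers with data (1, 0) and (0, 1) at the center. Near 0 it is real on the real axis and real up
  to a phase on the imaginary axis; this persists up to 1/2 and \<open>\<i> * b / 2\<close>, which
  are also the far ends of the edges from the center. There \<open>connection_determinant\<close>
  applies.\<close>

lemma connection_relation:
  fixes b \<kappa> :: real and Q :: "complex \<Rightarrow> complex"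
  assumes b: "b > 0" and \<kappa>: "\<kappa> \<ge> 0" and Qh: "Q holomorphic_on - lattice b"
    and Qreal: "\<And>z. z \<notin> lattice b \<Longrightarrow> Re z = 0 \<or> Re z = 1/2 \<or> Im z = 0 \<or> Im z = b / 2 \<Longrightarrow> Q z \<in> \<real>"
    and \<rho>: "\<rho> > 0" and p: "\<And>k. \<bar>p k\<bar> \<le> M / \<rho> ^ k"
    and Q0: "\<And>z. z \<noteq> 0 \<Longrightarrow> norm (z\<^sup>2) < \<rho> \<Longrightarrow> Q z = of_real (\<kappa> * (\<kappa> - 1)) / z\<^sup>2 + eval_fps (rps p) (z\<^sup>2)"
  defines "c \<equiv> Complex (1/2) (b/2)"
  obtains xa xa' xc xc' ya ya' yc yc' :: "nat \<Rightarrow> real \<Rightarrow> real" where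
    "real_tower 1 (\<lambda>t. Re (Q (c - of_real t))) (1/2) xa xa'"
    "real_tower 1 (\<lambda>t. Re (Q (c - of_real t))) (1/2) xc xc'"
    "real_tower (-1) (\<lambda>t. - Re (Q (c - \<i> * of_real t))) (b/2) ya ya'"
    "real_tower (-1) (\<lambda>t. - Re (Q (c - \<i> * of_real t))) (b/2) yc yc'"
    "\<And>n. xa n 0 = (if n = 0 then 1 else 0)" "\<And>n. xa' n 0 = 0"
    "\<And>n. xc' n 0 = (if n = 0 then 1 else 0)" "\<And>n. xc n 0 = 0"
    "\<And>n. ya n 0 = (if n = 0 then 1 else 0)" "\<And>n. ya' n 0 = 0"
    "\<And>n. yc' n 0 = (if n = 0 then 1 else 0)" "\<And>n. yc n 0 = 0"
    "Abs_fps (\<lambda>n. xa n (1/2)) * Abs_fps (\<lambda>n. xa' n (1/2)) * (Abs_fps (\<lambda>n. yc n (b/2)) * Abs_fps (\<lambda>n. yc' n (b/2)))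
     + Abs_fps (\<lambda>n. xc n (1/2)) * Abs_fps (\<lambda>n. xc' n (1/2)) * (Abs_fps (\<lambda>n. ya n (b/2)) * Abs_fps (\<lambda>n. ya' n (b/2)))
     = fps_const (sin (pi * \<kappa>) / 2)"
proof -
  obtain r w w' where r: "r > 0" and w: "tower {z. z \<notin> \<real>\<^sub>\<le>\<^sub>0 \<and> norm z < r} Q w w'"
    and w0: "\<And>z. z \<notin> \<real>\<^sub>\<le>\<^sub>0 \<Longrightarrow> norm z < r \<Longrightarrow> w 0 z \<noteq> 0"
    and wx: "\<And>n x. 0 < x \<Longrightarrow> x < r \<Longrightarrow> w n (of_real x) \<in> \<real> \<and> w' n (of_real x) \<in> \<real>"
    and wy: "\<And>n y. 0 < y \<Longrightarrow> y < r \<Longrightarrow> cis (- (pi * \<kappa> / 2)) * w n (\<i> * of_real y) \<in> \<real> \<and>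
        cis (- (pi * \<kappa> / 2)) * \<i> * w' n (\<i> * of_real y) \<in> \<real>"
    using frobenius_tower[OF \<kappa> \<rho> p Q0] by blast
  \<comment> \<open>The points 2\<delta> and 2\<delta>b\<open>\<i>\<close> must lie beyond the
    slanted boundary of \<open>D\<close>, on the edges, and in the disc where the Frobenius tower is
    defined.\<close>
  define \<delta> where "\<delta> = min (1/4) (min (r / 4) (r / (4 * b)))"
  have \<delta>: "\<delta> > 0" "2 * \<delta> \<le> 1/2" "2 * \<delta> < r" "2 * \<delta> * b < r"
  proof -
    show "\<delta> > 0" "2 * \<delta> \<le> 1/2" "2 * \<delta> < r" using r b by (auto simp: \<delta>_def)
    have "\<delta> * b \<le> r / (4 * b) * b" using b by (intro mult_right_mono) (auto simp: \<delta>_def)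
    then show "2 * \<delta> * b < r" using b r by simp
  qed
  define D where "D = {z. Re z + Im z / b > \<delta> \<and> Re z < 3/4 \<and> Im z < 3/4 * b}"
  note D = connection_domain[OF b \<delta>(1), folded D_def]
  have QD: "Q holomorphic_on D" using Qh D(4) by (auto intro: holomorphic_on_subset)
  have Qc: "continuous_on (- lattice b) Q" by (rule holomorphic_on_imp_continuous_on[OF Qh])
  have cD: "c \<in> D" using b \<delta> by (simp add: c_def D_def)
  obtain X X' Z Z' where X: "tower D Q X X'" "fpsv X c = 1" "fpsv X' c = 0"
    and Z: "tower D Q Z Z'" "fpsv Z c = 0" "fpsv Z' c = 1"
    using fundamental_towers[OF D(2,1,3) QD D(6)[OF Qc] cD] by blast
  define S where "S = D \<inter> ball 0 r"
  have S: "convex S" "open S" "S \<subseteq> D" using D by (auto simp: S_def intro: convex_Int)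
  have wS: "tower S Q w w'" by (rule tower_subset[OF w]) (use D(5) in \<open>auto simp: S_def\<close>)
  have WXZ: "fpsv X z * fpsv Z' z - fpsv X' z * fpsv Z z = 1" if "z \<in> D" for z
  proof -
    have "fpsv X z * fpsv Z' z - fpsv X' z * fpsv Z z = fpsv X c * fpsv Z' c - fpsv X' c * fpsv Z c"
      by (rule has_fps_deriv_zero_constant[OF D(2,1) tower_wronskian[OF X(1) Z(1)] that cD])
    then show ?thesis by (simp add: X Z)
  qed
  define x0 :: complex where "x0 = of_real (2 * \<delta>)"
  define y0 :: complex where "y0 = \<i> * of_real (2 * \<delta> * b)"
  have x0S: "x0 \<in> S" using \<delta> b by (simp add: S_def D_def x0_def)
  have y0S: "y0 \<in> S" using \<delta> b by (simp add: S_def D_def y0_def norm_mult)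
  \<comment> \<open>By Cramer's rule these Wronskians, constant on \<open>S\<close>, are the
    coordinates of the Frobenius tower with respect to \<open>X\<close> and \<open>Z\<close>. Thus
    \<open>V\<close> below is its continuation from \<open>S\<close> to \<open>D\<close>.\<close>
  define l where "l = fpsv w x0 * fpsv Z' x0 - fpsv w' x0 * fpsv Z x0"
  define m where "m = fpsv X x0 * fpsv w' x0 - fpsv X' x0 * fpsv w x0"
  have l: "fpsv w z * fpsv Z' z - fpsv w' z * fpsv Z z = l" if "z \<in> S" for z
    unfolding l_def by (rule has_fps_deriv_zero_constant[OF S(1,2) tower_wronskian[OF wS tower_subset[OF Z(1) S(3)]] that x0S])
  have m: "fpsv X z * fpsv w' z - fpsv X' z * fpsv w z = m" if "z \<in> S" for z
    unfolding m_def by (rule has_fps_deriv_zero_constant[OF S(1,2) tower_wronskian[OF tower_subset[OF X(1) S(3)] wS] that x0S])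
  define V where "V = (\<lambda>n z. fps_nth (l * fpsv X z + m * fpsv Z z) n)"
  define V' where "V' = (\<lambda>n z. fps_nth (l * fpsv X' z + m * fpsv Z' z) n)"
  have V: "tower D Q V V'" unfolding V_def V'_def by (rule tower_lincomb[OF X(1) Z(1)])
  have Vw: "V n z = w n z" "V' n z = w' n z" if z: "z \<in> S" for n z
  proof -
    note W = WXZ[OF subsetD[OF S(3) z]]
    have "l * fpsv X z + m * fpsv Z z = fpsv w z * (fpsv X z * fpsv Z' z - fpsv X' z * fpsv Z z)"
      unfolding l[OF z, symmetric] m[OF z, symmetric] by (simp add: algebra_simps)
    then show "V n z = w n z" unfolding V_def W by (simp only: mult_1_right fpsv_nth)
    have "l * fpsv X' z + m * fpsv Z' z = fpsv w' z * (fpsv X z * fpsv Z' z - fpsv X' z * fpsv Z z)"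
      unfolding l[OF z, symmetric] m[OF z, symmetric] by (simp add: algebra_simps)
    then show "V' n z = w' n z" unfolding V'_def W by (simp only: mult_1_right fpsv_nth)
  qed
  have nz: "l \<noteq> 0 \<or> m \<noteq> 0"
  proof (rule ccontr)
    assume "\<not> ?thesis"
    then have "V 0 x0 = 0" by (simp add: V_def)
    moreover have "w 0 x0 \<noteq> 0" using w0 D(5) x0S by (auto simp: S_def)
    ultimately show False using Vw(1)[OF x0S] by simp
  qed
  have cont: "continuous_on A (\<lambda>t. Re (Q (p + of_real t * d)))"
    if "\<And>t. t \<in> A \<Longrightarrow> p + of_real t * d \<in> D" for A p d
  proof -
    have "continuous_on A (\<lambda>t. Q (p + of_real t * d))"
      by (rule continuous_on_compose2[OF Qc]) (use that D(4) in \<open>auto intro!: continuous_intros\<close>)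
    then show ?thesis by (intro continuous_intros)
  qed
  define \<theta> where "\<theta> = pi * \<kappa> / 2"
  have bot: "V n (1/2) \<in> \<real> \<and> V' n (1/2) \<in> \<real>" for n
  proof -
    have inD: "0 + of_real t * 1 \<in> D" if "t \<in> {2 * \<delta>..1/2}" for t
      using that \<delta> b by (simp add: D_def)
    have "1 * V n (0 + of_real (1/2) * 1) \<in> \<real> \<and> 1 * 1 * V' n (0 + of_real (1/2) * 1) \<in> \<real>"
    proof (rule tower_line_real[where S = D and Q = Q and y = V and y' = V' and \<sigma> = 1 and s = "2 * \<delta>" and a = "2 * \<delta>" and b = "1/2" and p = 0 and d = 1 and k = 1 and t = "1/2"])
      show "tower D Q V V'" by (rule V)
      show "continuous_on {2 * \<delta>..1/2} (\<lambda>t. Re (Q (0 + of_real t * 1)))" by (rule cont[OF inD])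
      show "Q (0 + of_real t * 1) \<in> \<real>" if "t \<in> {2 * \<delta>..1/2}" for t
        using inD[OF that] D(4) by (intro Qreal) auto
      show "1 * V n (0 + of_real (2 * \<delta>) * 1) \<in> \<real>" "1 * 1 * V' n (0 + of_real (2 * \<delta>) * 1) \<in> \<real>" for n
        using Vw[OF x0S, of n] wx[of "2 * \<delta>" n] \<delta> by (simp_all add: x0_def)
    qed (use \<delta> inD in auto)
    then show ?thesis by simp
  qed
  \<comment> \<open>The factor \<open>cis (- \<theta>)\<close> undoes the phase of the quarter turn;
    the extra \<open>\<i>\<close> at \<open>V'\<close> turns the complex derivative into the
    derivative along the imaginary axis.\<close>
  have left: "cis (- \<theta>) * V n (\<i> * of_real (b/2)) \<in> \<real> \<and> cis (- \<theta>) * \<i> * V' n (\<i> * of_real (b/2)) \<in> \<real>" for n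
  proof -
    have inD: "0 + of_real t * \<i> \<in> D" if "t \<in> {2 * \<delta> * b..b/2}" for t
    proof -
      have "2 * \<delta> \<le> t / b" "\<delta> < 2 * \<delta>" "t < 3/4 * b" using that b \<delta> by (auto simp: pos_le_divide_eq)
      then show ?thesis by (simp add: D_def)
    qed
    have "cis (- \<theta>) * V n (0 + of_real (b/2) * \<i>) \<in> \<real> \<and> cis (- \<theta>) * \<i> * V' n (0 + of_real (b/2) * \<i>) \<in> \<real>"
    proof (rule tower_line_real[where S = D and Q = Q and y = V and y' = V' and \<sigma> = "-1" and s = "2 * \<delta> * b" and a = "2 * \<delta> * b" and b = "b/2" and p = 0 and d = \<i> and k = "cis (- \<theta>)" and t = "b/2"])
      show "tower D Q V V'" by (rule V)
      show "continuous_on {2 * \<delta> * b..b/2} (\<lambda>t. Re (Q (0 + of_real t * \<i>)))" by (rule cont[OF inD])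
      show "0 + of_real t * \<i> \<in> D" if "t \<in> {2 * \<delta> * b..b/2}" for t by (rule inD[OF that])
      show "Q (0 + of_real t * \<i>) \<in> \<real>" if "t \<in> {2 * \<delta> * b..b/2}" for t
        using inD[OF that] D(4) by (intro Qreal) auto
      show "cis (- \<theta>) * V n (0 + of_real (2 * \<delta> * b) * \<i>) \<in> \<real>" "cis (- \<theta>) * \<i> * V' n (0 + of_real (2 * \<delta> * b) * \<i>) \<in> \<real>" for n
        using Vw[OF y0S, of n] wy[of "2 * \<delta> * b" n] \<delta> b by (simp_all add: y0_def \<theta>_def mult.commute)
    qed (use \<delta> b in auto)
    then show ?thesis by (simp add: mult.commute)
  qed
  have top_in: "c + of_real t * (- 1) \<in> D" if "t \<in> {0..1/2}" for t
    using that \<delta> b by (simp add: D_def c_def)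
  have right_in: "c + of_real t * (- \<i>) \<in> D" if "t \<in> {0..b/2}" for t
  proof -
    have "(b/2 - t) / b \<ge> 0" using that b by simp
    then have "\<delta> < 1/2 + (b/2 - t) / b" using \<delta>(1,2) by linarith
    then show ?thesis using that b by (simp add: D_def c_def)
  qed
  have top_real: "Q (c + of_real t * (- 1)) \<in> \<real>" if "t \<in> {0..1/2}" for t
    using top_in[OF that] D(4) by (intro Qreal) (auto simp: c_def)
  have right_real: "Q (c + of_real t * (- \<i>)) \<in> \<real>" if "t \<in> {0..b/2}" for t
    using right_in[OF that] D(4) by (intro Qreal) (auto simp: c_def)
  have init: "X n c = (if n = 0 then 1 else 0)" "X' n c = 0" "Z n c = 0" "Z' n c = (if n = 0 then 1 else 0)" for n
    using X(2,3) Z(2,3) by (auto simp: fps_eq_iff)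
  have top: "k * Y n (c + of_real t * (- 1)) \<in> \<real> \<and> k * (- 1) * Y' n (c + of_real t * (- 1)) \<in> \<real>"
    if "tower D Q Y Y'" "\<And>n. k * Y n c \<in> \<real>" "\<And>n. k * (- 1) * Y' n c \<in> \<real>" "t \<in> {0..1/2}" for Y Y' k n t
    by (rule tower_line_real[OF that(1) top_in _ cont[OF top_in] top_real, where \<sigma> = 1 and s = 0])
       (use that in auto)
  have right: "k * Y n (c + of_real t * (- \<i>)) \<in> \<real> \<and> k * (- \<i>) * Y' n (c + of_real t * (- \<i>)) \<in> \<real>"
    if "tower D Q Y Y'" "\<And>n. k * Y n c \<in> \<real>" "\<And>n. k * (- \<i>) * Y' n c \<in> \<real>" "t \<in> {0..b/2}" for Y Y' k n t
    by (rule tower_line_real[OF that(1) right_in _ cont[OF right_in] right_real, where \<sigma> = "-1" and s = 0])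
       (use that b in auto)
  let ?p = "\<lambda>t. c + of_real t * (- 1)" and ?q = "\<lambda>t. c + of_real t * (- \<i>)"
  \<comment> \<open>Differentiation along the edges brings in -1 and \<open>- \<i>\<close>. The odd
    solution is therefore multiplied by -1 and by \<open>\<i>\<close>, so that its derivative along
    either edge starts at 1.\<close>
  define xa where "xa = (\<lambda>n t. Re (1 * X n (?p t)))"
  define xa' where "xa' = (\<lambda>n t. Re (1 * (- 1) * X' n (?p t)))"
  define xc where "xc = (\<lambda>n t. Re ((- 1) * Z n (?p t)))"
  define xc' where "xc' = (\<lambda>n t. Re ((- 1) * (- 1) * Z' n (?p t)))"
  define ya where "ya = (\<lambda>n t. Re (1 * X n (?q t)))"
  define ya' where "ya' = (\<lambda>n t. Re (1 * (- \<i>) * X' n (?q t)))"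
  define yc where "yc = (\<lambda>n t. Re (\<i> * Z n (?q t)))"
  define yc' where "yc' = (\<lambda>n t. Re (\<i> * (- \<i>) * Z' n (?q t)))"
  have qt: "(\<lambda>t. 1 * Re (Q (?p t))) = (\<lambda>t. Re (Q (c - of_real t)))"
    "(\<lambda>t. - 1 * Re (Q (?q t))) = (\<lambda>t. - Re (Q (c - \<i> * of_real t)))" by (simp_all add: mult.commute)
  have P3: "?p (1/2) = \<i> * of_real (b/2)" and P1: "?q (b/2) = 1/2"
    by (simp_all add: c_def complex_eq_iff)
  have Re_eq: "z \<in> \<real> \<Longrightarrow> of_real (Re z) = z" for z :: complex by simp
  let ?f = "\<lambda>x t. rps (fps_nth (Abs_fps (\<lambda>n. x n t)))"
  have fp: "fpsv X (?p (1/2)) = ?f xa (1/2)" "fpsv X' (?p (1/2)) = - ?f xa' (1/2)"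
      "fpsv Z (?p (1/2)) = - ?f xc (1/2)" "fpsv Z' (?p (1/2)) = ?f xc' (1/2)"
  proof -
    have h: "(1/2 :: real) \<in> {0..1/2}" by simp
    have "X n (?p (1/2)) = of_real (xa n (1/2))" "X' n (?p (1/2)) = - of_real (xa' n (1/2))" for n
      using top[OF X(1) _ _ h, of 1 n] Re_eq unfolding xa_def xa'_def by (simp_all add: init)
    moreover have "Z n (?p (1/2)) = - of_real (xc n (1/2))" "Z' n (?p (1/2)) = of_real (xc' n (1/2))" for n
      using top[OF Z(1) _ _ h, of "- 1" n] Re_eq unfolding xc_def xc'_def by (simp_all add: init)
    ultimately show "fpsv X (?p (1/2)) = ?f xa (1/2)" "fpsv X' (?p (1/2)) = - ?f xa' (1/2)"
      "fpsv Z (?p (1/2)) = - ?f xc (1/2)" "fpsv Z' (?p (1/2)) = ?f xc' (1/2)"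
      by (simp_all only: fps_eq_iff fpsv_nth rps_nth fps_neg_nth fps_nth_Abs_fps simp_thms)
  qed
  have fq: "fpsv X (?q (b/2)) = ?f ya (b/2)" "fpsv X' (?q (b/2)) = fps_const \<i> * ?f ya' (b/2)"
      "fpsv Z (?q (b/2)) = - (fps_const \<i> * ?f yc (b/2))" "fpsv Z' (?q (b/2)) = ?f yc' (b/2)"
  proof -
    have h: "b/2 \<in> {0..b/2}" using b by simp
    have r: "u = \<i> * of_real (Re (- \<i> * u))" if "- \<i> * u \<in> \<real>" for u :: complex
      using that by (simp add: complex_is_Real_iff complex_eq_iff)
    have r': "u = - (\<i> * of_real (Re (\<i> * u)))" if "\<i> * u \<in> \<real>" for u :: complex
      using that by (simp add: complex_is_Real_iff complex_eq_iff)
    have "X n (?q (b/2)) = of_real (ya n (b/2))" "X' n (?q (b/2)) = \<i> * of_real (ya' n (b/2))" for n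
      using right[OF X(1) _ _ h, of 1 n] Re_eq r[of "X' n (?q (b/2))"] unfolding ya_def ya'_def by (simp_all add: init)
    moreover have "Z n (?q (b/2)) = - (\<i> * of_real (yc n (b/2)))" "Z' n (?q (b/2)) = of_real (yc' n (b/2))" for n
      using right[OF Z(1) _ _ h, of \<i> n] Re_eq r'[of "Z n (?q (b/2))"] unfolding yc_def yc'_def by (simp_all add: init)
    ultimately show "fpsv X (?q (b/2)) = ?f ya (b/2)" "fpsv X' (?q (b/2)) = fps_const \<i> * ?f ya' (b/2)"
      "fpsv Z (?q (b/2)) = - (fps_const \<i> * ?f yc (b/2))" "fpsv Z' (?q (b/2)) = ?f yc' (b/2)"
      by (simp_all only: fps_eq_iff fpsv_nth rps_nth fps_neg_nth fps_mult_left_const_nth fps_nth_Abs_fps simp_thms)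
  qed
  let ?I = "fps_const \<i>" and ?E = "fps_const (cis \<theta>)"
  have II: "?I * ?I = - 1" by (simp add: fps_eq_iff)
  have IIx: "?I * (?I * F) = - F" for F unfolding mult.assoc[symmetric] II by simp
  have "Abs_fps (\<lambda>n. xa n (1/2)) * Abs_fps (\<lambda>n. xa' n (1/2)) * (Abs_fps (\<lambda>n. yc n (b/2)) * Abs_fps (\<lambda>n. yc' n (b/2)))
     + Abs_fps (\<lambda>n. xc n (1/2)) * Abs_fps (\<lambda>n. xc' n (1/2)) * (Abs_fps (\<lambda>n. ya n (b/2)) * Abs_fps (\<lambda>n. ya' n (b/2)))
     = fps_const (sin (pi * \<kappa>) / 2)"
  proof -
    define s where "s = fpsv V (?q (b/2))"
    define s' where "s' = fpsv V' (?q (b/2))"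
    define R where "R = fps_const (cis (- \<theta>)) * fpsv V (?p (1/2))"
    define R' where "R' = fps_const (cis (- \<theta>) * \<i>) * fpsv V' (?p (1/2))"
    have E: "?E * fps_const (cis (- \<theta>)) = 1" by (simp add: cis_mult)
    have fV: "fpsv V z = l * fpsv X z + m * fpsv Z z" "fpsv V' z = l * fpsv X' z + m * fpsv Z' z" for z
      by (simp_all add: fps_eq_iff V_def V'_def)
    have "?f xa (1/2) * ?f xa' (1/2) * ?f yc (b/2) * ?f yc' (b/2) + ?f xc (1/2) * ?f xc' (1/2) * ?f ya (b/2) * ?f ya' (b/2)
       = fps_const (of_real (sin (2 * \<theta>) / 2))"
    proof (rule connection_determinant[OF _ _ _ _ _ _ _ _ _ _ refl refl, where l = l and m = m and s = s and s' = s' and r = R and r' = R'])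
      show "?f xa (1/2) * ?f xc' (1/2) - ?f xc (1/2) * ?f xa' (1/2) = 1"
        using WXZ[OF top_in, of "1/2"] unfolding fp by (simp add: mult.commute)
      show "?f ya (b/2) * ?f yc' (b/2) - ?f yc (b/2) * ?f ya' (b/2) = 1"
        using WXZ[OF right_in, of "b/2"] b unfolding fq by (simp add: mult_ac IIx)
      show "s = l * ?f ya (b/2) - ?I * m * ?f yc (b/2)" unfolding s_def fV fq by (simp add: algebra_simps)
      show "s' = ?I * l * ?f ya' (b/2) + m * ?f yc' (b/2)" unfolding s'_def fV fq by (simp add: algebra_simps)
      show "?E * R = l * ?f xa (1/2) - m * ?f xc (1/2)"
      proof -
        have "?E * R = (?E * fps_const (cis (- \<theta>))) * fpsv V (?p (1/2))" unfolding R_def by (simp only: mult.assoc)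
        then show ?thesis unfolding E fV fp by simp
      qed
      show "- ?I * ?E * R' = - l * ?f xa' (1/2) + m * ?f xc' (1/2)"
      proof -
        have "fps_const (cis (- \<theta>) * \<i>) = fps_const (cis (- \<theta>)) * ?I" by simp
        moreover have "- x * e * ((e' * x) * v) = - (x * x) * ((e * e') * v)" for x e e' v :: "complex fps"
          by (simp add: algebra_simps)
        ultimately have "- ?I * ?E * R' = - (?I * ?I) * ((?E * fps_const (cis (- \<theta>))) * fpsv V' (?p (1/2)))"
          unfolding R'_def by (simp only:)
        then show ?thesis unfolding E II fV fp by simp
      qed
      have cr: "cnj_fps F = F" if "\<And>n. fps_nth F n \<in> \<real>" for F
        using that by (auto simp: fps_eq_iff Reals_cnj_iff)
      show "cnj_fps s = s" "cnj_fps s' = s'" "cnj_fps R = R" "cnj_fps R' = R'"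
        using bot left unfolding s_def s'_def R_def R'_def P1 P3 by (auto intro!: cr)
      show "l \<noteq> 0 \<or> m \<noteq> 0" by (rule nz)
    qed (rule cnj_fps_rps)+
    moreover have "2 * \<theta> = pi * \<kappa>" by (simp add: \<theta>_def)
    moreover have "fps_const (complex_of_real k) = rps (fps_nth (fps_const k))" for k by (simp add: fps_eq_iff)
    ultimately show ?thesis
      by (simp only: rps_fps_mult rps_fps_add rps_fps_eq_iff mult.assoc)
  qed
  moreover have "real_tower 1 (\<lambda>t. Re (Q (c - of_real t))) (1/2) xa xa'"
    unfolding xa_def xa'_def qt(1)[symmetric]
    by (rule tower_line_real_tower[OF X(1) top_in _ top_real]) auto
  moreover have "real_tower 1 (\<lambda>t. Re (Q (c - of_real t))) (1/2) xc xc'"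
    unfolding xc_def xc'_def qt(1)[symmetric]
    by (rule tower_line_real_tower[OF Z(1) top_in _ top_real]) auto
  moreover have "real_tower (-1) (\<lambda>t. - Re (Q (c - \<i> * of_real t))) (b/2) ya ya'"
    unfolding ya_def ya'_def qt(2)[symmetric]
    by (rule tower_line_real_tower[OF X(1) right_in _ right_real]) auto
  moreover have "real_tower (-1) (\<lambda>t. - Re (Q (c - \<i> * of_real t))) (b/2) yc yc'"
    unfolding yc_def yc'_def qt(2)[symmetric]
    by (rule tower_line_real_tower[OF Z(1) right_in _ right_real]) auto
  ultimately show thesis
    by (intro that[of xa xa' xc xc' ya ya' yc yc'])
       (auto simp: xa_def xa'_def xc_def xc'_def ya_def ya'_def yc_def yc'_def init)
qed

section \<open>Concavity of the edge values and rigidity of the pair of edges\<close>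

lemma real_tower_turan:
  assumes L: "L > 0" and \<sigma>: "\<sigma>\<^sup>2 = 1"
    and x: "real_tower \<sigma> q L x x'" and a: "real_tower \<sigma> q L a a'" and c: "real_tower \<sigma> q L c c'"
    and W0: "a 0 0 * c' 0 0 - a' 0 0 * c 0 0 = 1"
    and init: "\<And>n. n > 0 \<Longrightarrow> x n 0 = 0" "\<And>n. n > 0 \<Longrightarrow> x' n 0 = 0"
  shows "fps_turan (Abs_fps (\<lambda>n. x n L)) \<le> 0" and "fps_turan (Abs_fps (\<lambda>n. x' n L)) \<le> 0"
    and "x 0 0 \<noteq> 0 \<Longrightarrow> fps_turan (Abs_fps (\<lambda>n. x' n L)) < 0"
proof -
  have d0: "(y 0 has_real_derivative y' 0 t) (at t)" "(y' 0 has_real_derivative q t * y 0 t) (at t)"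
    and dS: "(y (Suc n) has_real_derivative y' (Suc n) t) (at t)"
      "(y' (Suc n) has_real_derivative q t * y (Suc n) t + \<sigma> * y n t) (at t)"
    if "real_tower \<sigma> q L y y'" "t \<in> {0..L}" for y y' t n
    using that(1)[unfolded real_tower_def, rule_format, OF that(2), of 0]
      that(1)[unfolded real_tower_def, rule_format, OF that(2), of "Suc n"] by simp_all
  have W: "a 0 L * c' 0 L - a' 0 L * c 0 L = 1"
  proof -
    have "(\<lambda>t. a 0 t * c' 0 t - a' 0 t * c 0 t) L = (\<lambda>t. a 0 t * c' 0 t - a' 0 t * c 0 t) 0"
    proof (rule DERIV_isconst_end[OF L])
      show "continuous_on {0..L} (\<lambda>t. a 0 t * c' 0 t - a' 0 t * c 0 t)"
        by (intro continuous_at_imp_continuous_on ballI continuous_intros)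
           (auto intro!: DERIV_isCont d0 a c)
      show "((\<lambda>t. a 0 t * c' 0 t - a' 0 t * c 0 t) has_real_derivative 0) (at t)" if "0 < t" "t < L" for t
        using that by (auto intro!: derivative_eq_intros d0[OF a] d0[OF c])
    qed
    then show ?thesis using W0 by simp
  qed
  have key: "(x 1 L * v - x' 1 L * u)\<^sup>2 - 2 * (x 0 L * v - x' 0 L * u) * (x 2 L * v - x' 2 L * u) \<ge> 0
     \<and> (x 0 0 \<noteq> 0 \<longrightarrow> u \<noteq> 0 \<longrightarrow> (x 1 L * v - x' 1 L * u)\<^sup>2 - 2 * (x 0 L * v - x' 0 L * u) * (x 2 L * v - x' 2 L * u) > 0)"
    if uv: "u = \<alpha> * a 0 L + \<beta> * c 0 L" "v = \<alpha> * a' 0 L + \<beta> * c' 0 L" for \<alpha> \<beta> u v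
  proof -
    have P: "((\<lambda>t. \<alpha> * a 0 t + \<beta> * c 0 t) has_real_derivative \<alpha> * a' 0 t + \<beta> * c' 0 t) (at t)"
      "((\<lambda>t. \<alpha> * a' 0 t + \<beta> * c' 0 t) has_real_derivative q t * (\<alpha> * a 0 t + \<beta> * c 0 t)) (at t)"
      if "t \<in> {0..L}" for t
      by (auto intro!: derivative_eq_intros d0[OF a that] d0[OF c that] simp: algebra_simps)
    have d1: "(x 1 has_real_derivative x' 1 t) (at t)" "(x' 1 has_real_derivative q t * x 1 t + \<sigma> * x 0 t) (at t)"
      if "t \<in> {0..L}" for t using dS[OF x that, of 0] by simp_all
    have d2: "(x 2 has_real_derivative x' 2 t) (at t)" "(x' 2 has_real_derivative q t * x 2 t + \<sigma> * x 1 t) (at t)"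
      if "t \<in> {0..L}" for t using dS[OF x that, of 1] by (simp_all add: numeral_2_eq_2)
    have i: "x 1 0 = 0" "x' 1 0 = 0" "x 2 0 = 0" "x' 2 0 = 0" using init by auto
    note tt = tower_turan[OF L \<sigma> d0(1)[OF x] d0(2)[OF x] d1 d2 P i]
    show ?thesis unfolding uv using tt by blast
  qed
  \<comment> \<open>The comparison solution has end data (0, -1) here and (1, 0) below, so the
    Wronskians become the negatives of the values and of the derivatives of \<open>x\<close>. Its
    end value is nonzero in the second case, which is where strictness is available.\<close>
  show "fps_turan (Abs_fps (\<lambda>n. x n L)) \<le> 0"
    using key[of 0 "c 0 L" "- a 0 L" "-1"] W by (simp add: fps_turan_def algebra_simps)
  show "fps_turan (Abs_fps (\<lambda>n. x' n L)) \<le> 0" "x 0 0 \<noteq> 0 \<Longrightarrow> fps_turan (Abs_fps (\<lambda>n. x' n L)) < 0"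
    using key[of 1 "c' 0 L" "- a' 0 L" 0] W by (simp_all add: fps_turan_def algebra_simps)
qed

text \<open>\<open>U\<close> and \<open>\<Theta>\<close> stand for the restrictions of u and of a
  multiple of \<phi> to an edge, and \<open>k\<close> is the first order change of \<open>q\<close>
  when \<open>U\<close> moves along \<open>\<Theta>\<close>. The end conditions express the
  reflection symmetries. The values at t = 0 are exposed because the two edges share them.\<close>

definition edge_data :: "real \<Rightarrow> (real \<Rightarrow> real) \<Rightarrow> real \<Rightarrow> real \<Rightarrow> real \<Rightarrow> bool" where
  "edge_data L q k u0 \<theta>0 \<longleftrightarrow> (\<exists>U U' U'' \<Theta> \<Theta>' \<Theta>''. (\<forall>t\<in>{0..L}.
     (U has_real_derivative U' t) (at t) \<and> (U' has_real_derivative U'' t) (at t) \<and>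
     (\<Theta> has_real_derivative \<Theta>' t) (at t) \<and> (\<Theta>' has_real_derivative \<Theta>'' t) (at t) \<and>
     q t = (U' t)\<^sup>2 / 16 - U'' t / 4 - exp (U t) / 8 \<and>
     2 * \<Theta>'' t - U' t * \<Theta>' t + exp (U t) * \<Theta> t = - 8 * k) \<and>
     U' 0 = 0 \<and> U' L = 0 \<and> \<Theta>' 0 = 0 \<and> \<Theta>' L = 0 \<and> U 0 = u0 \<and> \<Theta> 0 = \<theta>0)"

text \<open>If \<open>k = \<sigma>\<close>, moving \<open>U\<close> along \<open>\<Theta>\<close> is
  the same to first order as moving the tower parameter, and the proportionality factor moves from
  \<open>k0\<close> by \<open>\<theta>0 * k0\<close>. If \<open>k = 0\<close>, the potential does
  not move; the zero functions then serve as level 1, and the first order relation degenerates to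
  the last conclusion.\<close>

lemma edge_data_ratio:
  assumes L: "L > 0" and E: "edge_data L q k u0 \<theta>0" and cq: "continuous_on {0..L} q"
    and a: "real_tower \<sigma> q L a a'" and c: "real_tower \<sigma> q L c c'"
    and init: "\<And>n. a n 0 = (if n = 0 then 1 else 0)" "\<And>n. a' n 0 = 0"
      "\<And>n. c' n 0 = (if n = 0 then 1 else 0)" "\<And>n. c n 0 = 0"
  defines "A \<equiv> Abs_fps (\<lambda>n. a n L) * Abs_fps (\<lambda>n. a' n L)"
    and "C \<equiv> Abs_fps (\<lambda>n. c n L) * Abs_fps (\<lambda>n. c' n L)"
    and "k0 \<equiv> - exp u0 / 8"
  shows "k = \<sigma> \<or> k = 0 \<Longrightarrow> fps_nth A 0 = k0 * fps_nth C 0"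
    and "k = \<sigma> \<Longrightarrow> fps_nth A 1 = k0 * fps_nth C 1 + \<theta>0 * k0 * fps_nth C 0"
    and "k = 0 \<Longrightarrow> \<theta>0 * k0 * fps_nth C 0 = 0"
proof -
  from E obtain U U' U'' \<Theta> \<Theta>' \<Theta>'' where H: "\<forall>t\<in>{0..L}.
     (U has_real_derivative U' t) (at t) \<and> (U' has_real_derivative U'' t) (at t) \<and>
     (\<Theta> has_real_derivative \<Theta>' t) (at t) \<and> (\<Theta>' has_real_derivative \<Theta>'' t) (at t) \<and>
     q t = (U' t)\<^sup>2 / 16 - U'' t / 4 - exp (U t) / 8 \<and>
     2 * \<Theta>'' t - U' t * \<Theta>' t + exp (U t) * \<Theta> t = - 8 * k"
    and ends: "U' 0 = 0" "U' L = 0" "\<Theta>' 0 = 0" "\<Theta>' L = 0" and U0: "U 0 = u0" "\<Theta> 0 = \<theta>0"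
    unfolding edge_data_def by (elim exE conjE)
  have E: "\<And>t. t \<in> {0..L} \<Longrightarrow> (U has_real_derivative U' t) (at t)"
     "\<And>t. t \<in> {0..L} \<Longrightarrow> (U' has_real_derivative U'' t) (at t)"
     "\<And>t. t \<in> {0..L} \<Longrightarrow> (\<Theta> has_real_derivative \<Theta>' t) (at t)"
     "\<And>t. t \<in> {0..L} \<Longrightarrow> (\<Theta>' has_real_derivative \<Theta>'' t) (at t)"
     "\<And>t. t \<in> {0..L} \<Longrightarrow> q t = (U' t)\<^sup>2 / 16 - U'' t / 4 - exp (U t) / 8"
     "\<And>t. t \<in> {0..L} \<Longrightarrow> 2 * \<Theta>'' t - U' t * \<Theta>' t + exp (U t) * \<Theta> t = - 8 * k"
    using H by simp_all
  have d0: "(y 0 has_real_derivative y' 0 t) (at t)" "(y' 0 has_real_derivative q t * y 0 t) (at t)"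
    and d1: "(y 1 has_real_derivative y' 1 t) (at t)"
      "(y' 1 has_real_derivative q t * y 1 t + \<sigma> * y 0 t) (at t)"
    if "real_tower \<sigma> q L y y'" "t \<in> {0..L}" for y y' t
    using that(1)[unfolded real_tower_def, rule_format, OF that(2), of 0]
      that(1)[unfolded real_tower_def, rule_format, OF that(2), of "Suc 0"] by simp_all
  have i0: "a 0 0 = 1" "a' 0 0 = 0" "c 0 0 = 0" "c' 0 0 = 1" and i1: "a 1 0 = 0" "a' 1 0 = 0" "c 1 0 = 0" "c' 1 0 = 0"
    using init by auto
  have z: "((\<lambda>_. 0) has_real_derivative q t * 0 + k * y) (at t)" if "k = 0" for t y :: real using that by simp
  have A: "fps_nth A 0 = a 0 L * a' 0 L" "fps_nth C 0 = c 0 L * c' 0 L"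
    "fps_nth A 1 = a 0 L * a' 1 L + a 1 L * a' 0 L" "fps_nth C 1 = c 0 L * c' 1 L + c 1 L * c' 0 L"
    by (simp_all add: A_def C_def fps_mult_nth)
  show "fps_nth A 1 = k0 * fps_nth C 1 + \<theta>0 * k0 * fps_nth C 0" if "k = \<sigma>"
    unfolding A k0_def U0[symmetric]
    by (rule edge_ratio(2)[OF L E(1-4) cq E(5,6) ends d0[OF a] d1[OF a, folded that] d0[OF c] d1[OF c, folded that]
        i0(1,2) i1(1,2) i0(3,4) i1(3,4)])
  show "\<theta>0 * k0 * fps_nth C 0 = 0" if "k = 0"
    using edge_ratio(2)[where ?a1.0 = "\<lambda>_. 0" and ?da1.0 = "\<lambda>_. 0" and ?b1.0 = "\<lambda>_. 0" and ?db1.0 = "\<lambda>_. 0", OF L E(1-4) cq E(5,6) ends d0[OF a] _ z[OF that] d0[OF c] _ z[OF that] i0(1,2) _ _ i0(3,4)]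
    unfolding A k0_def U0[symmetric] by simp
  assume "k = \<sigma> \<or> k = 0"
  then show "fps_nth A 0 = k0 * fps_nth C 0"
  proof
    assume k: "k = \<sigma>"
    show ?thesis unfolding A k0_def U0[symmetric]
      by (rule edge_ratio(1)[OF L E(1-4) cq E(5,6) ends d0[OF a] d1[OF a, folded k] d0[OF c] d1[OF c, folded k]
        i0(1,2) i1(1,2) i0(3,4) i1(3,4)])
  next
    assume k: "k = 0"
    show ?thesis unfolding A k0_def U0[symmetric]
      by (rule edge_ratio(1)[where ?a1.0 = "\<lambda>_. 0" and ?da1.0 = "\<lambda>_. 0" and ?b1.0 = "\<lambda>_. 0" and ?db1.0 = "\<lambda>_. 0", OF L E(1-4) cq E(5,6) ends d0[OF a] _ z[OF k] d0[OF c] _ z[OF k] i0(1,2) _ _ i0(3,4)])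
         simp_all
  qed
qed

text \<open>The case \<epsilon> = 1 is excluded by \<open>no_double_contact\<close>. In the case
  \<epsilon> = 0 the product of the odd solution on the horizontal edge cannot vanish: the even one
  would vanish with it, contradicting the connection relation since the sine is nonzero. Hence
  \<open>\<theta>0\<close> is zero.\<close>

lemma edges_rigid:
  fixes b \<kappa> :: real and Q :: "complex \<Rightarrow> complex"
  assumes b: "b > 0" and \<kappa>: "\<kappa> \<ge> 0" and sin: "sin (pi * \<kappa>) \<noteq> 0" and Qh: "Q holomorphic_on - lattice b"
    and Qreal: "\<And>z. z \<notin> lattice b \<Longrightarrow> Re z = 0 \<or> Re z = 1/2 \<or> Im z = 0 \<or> Im z = b / 2 \<Longrightarrow> Q z \<in> \<real>"
    and \<rho>: "\<rho> > 0" and p: "\<And>k. \<bar>p k\<bar> \<le> M / \<rho> ^ k"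
    and Q0: "\<And>z. z \<noteq> 0 \<Longrightarrow> norm (z\<^sup>2) < \<rho> \<Longrightarrow> Q z = of_real (\<kappa> * (\<kappa> - 1)) / z\<^sup>2 + eval_fps (rps p) (z\<^sup>2)"
  defines "c \<equiv> Complex (1/2) (b/2)"
  assumes top: "edge_data (1/2) (\<lambda>t. Re (Q (c - of_real t))) \<epsilon> u0 \<theta>0"
    and right: "edge_data (b/2) (\<lambda>t. - Re (Q (c - \<i> * of_real t))) (- \<epsilon>) u0 \<theta>0"
    and \<epsilon>: "\<epsilon> = 0 \<or> \<epsilon> = 1"
  shows "\<epsilon> = 0 \<and> \<theta>0 = 0"
proof -
  have notin: "c - of_real t \<notin> lattice b" "c - \<i> * of_real t \<notin> lattice b" for t
  proof -
    have h: "(1/2 :: real) \<notin> \<int>" using fraction_not_in_Ints[of 2 1] by simp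
    show "c - of_real t \<notin> lattice b" "c - \<i> * of_real t \<notin> lattice b"
      using b h by (auto simp: lattice_iff c_def)
  qed
  have cQ: "continuous_on (- lattice b) Q" by (rule holomorphic_on_imp_continuous_on[OF Qh])
  have cx: "continuous_on {0..1/2} (\<lambda>t. Re (Q (c - of_real t)))"
    by (intro continuous_intros continuous_on_compose2[OF cQ]) (use notin in auto)
  have cy: "continuous_on {0..b/2} (\<lambda>t. - Re (Q (c - \<i> * of_real t)))"
    by (intro continuous_intros continuous_on_compose2[OF cQ]) (use notin in auto)
  have L: "(1/2 :: real) > 0" "b/2 > 0" using b by auto
  show ?thesis
  proof (rule connection_relation[OF b \<kappa> Qh Qreal \<rho> p Q0, folded c_def])
    fix xa xa' xc xc' ya ya' yc yc' :: "nat \<Rightarrow> real \<Rightarrow> real"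
    assume xa: "real_tower 1 (\<lambda>t. Re (Q (c - of_real t))) (1/2) xa xa'"
    and xc: "real_tower 1 (\<lambda>t. Re (Q (c - of_real t))) (1/2) xc xc'"
    and ya: "real_tower (-1) (\<lambda>t. - Re (Q (c - \<i> * of_real t))) (b/2) ya ya'"
    and yc: "real_tower (-1) (\<lambda>t. - Re (Q (c - \<i> * of_real t))) (b/2) yc yc'"
    and ix: "\<And>n. xa n 0 = (if n = 0 then 1 else 0)" "\<And>n. xa' n 0 = 0"
    "\<And>n. xc' n 0 = (if n = 0 then 1 else 0)" "\<And>n. xc n 0 = 0"
    and iy: "\<And>n. ya n 0 = (if n = 0 then 1 else 0)" "\<And>n. ya' n 0 = 0"
    "\<And>n. yc' n 0 = (if n = 0 then 1 else 0)" "\<And>n. yc n 0 = 0"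
    and rel: "Abs_fps (\<lambda>n. xa n (1/2)) * Abs_fps (\<lambda>n. xa' n (1/2)) * (Abs_fps (\<lambda>n. yc n (b/2)) * Abs_fps (\<lambda>n. yc' n (b/2)))
     + Abs_fps (\<lambda>n. xc n (1/2)) * Abs_fps (\<lambda>n. xc' n (1/2)) * (Abs_fps (\<lambda>n. ya n (b/2)) * Abs_fps (\<lambda>n. ya' n (b/2)))
     = fps_const (sin (pi * \<kappa>) / 2)"
  note tx = edge_data_ratio[OF L(1) top cx xa xc ix]
  note ty = edge_data_ratio[OF L(2) right cy ya yc iy]
  show ?thesis
    using \<epsilon>
  proof
    assume e: "\<epsilon> = 0"
    let ?A = "Abs_fps (\<lambda>n. xa n (1/2)) * Abs_fps (\<lambda>n. xa' n (1/2))" and ?C = "Abs_fps (\<lambda>n. xc n (1/2)) * Abs_fps (\<lambda>n. xc' n (1/2))"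
    have "fps_nth ?C 0 \<noteq> 0"
    proof
      assume C: "fps_nth ?C 0 = 0"
      then have A: "fps_nth ?A 0 = 0" using tx(1) e by (simp only: mult_zero_right simp_thms)
      have "fps_nth (fps_const (sin (pi * \<kappa>) / 2)) 0 = 0"
        unfolding rel[symmetric] fps_add_nth fps_mult_low(1)[of ?A] fps_mult_low(1)[of ?C] A C by simp
      then show False using sin by simp
    qed
    then show ?thesis using tx(3) e by simp
  next
    assume e: "\<epsilon> = 1"
    have one: "(1::real)\<^sup>2 = 1" "(-1::real)\<^sup>2 = 1" by simp_all
    have Wx: "xa 0 0 * xc' 0 0 - xa' 0 0 * xc 0 0 = 1" and Wy: "ya 0 0 * yc' 0 0 - ya' 0 0 * yc 0 0 = 1"
      using ix iy by simp_all
    have i: "\<And>n. n > 0 \<Longrightarrow> xa n 0 = 0" "\<And>n. n > 0 \<Longrightarrow> xa' n 0 = 0" "\<And>n. n > 0 \<Longrightarrow> xc n 0 = 0" "\<And>n. n > 0 \<Longrightarrow> xc' n 0 = 0"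
      "\<And>n. n > 0 \<Longrightarrow> ya n 0 = 0" "\<And>n. n > 0 \<Longrightarrow> ya' n 0 = 0" "\<And>n. n > 0 \<Longrightarrow> yc n 0 = 0" "\<And>n. n > 0 \<Longrightarrow> yc' n 0 = 0"
      using ix iy by simp_all
    note Txa = real_tower_turan[OF L(1) one(1) xa xa xc Wx i(1,2)]
    note Txc = real_tower_turan[OF L(1) one(1) xc xa xc Wx i(3,4)]
    note Tya = real_tower_turan[OF L(2) one(2) ya ya yc Wy i(5,6)]
    note Tyc = real_tower_turan[OF L(2) one(2) yc ya yc Wy i(7,8)]
    have False
      by (rule no_double_contact[OF rel _ tx(1) tx(2) ty(1) ty(2)])
         (use sin e Txa Txc Tya Tyc ix in auto)
    then show ?thesis ..
  qed
  qed
qed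

section \<open>Functions of class \<open>C\<^sup>2\<close> in the plane\<close>

lemma continuous_on_slice:
  assumes "continuous_on (X \<times> Y) (\<lambda>(x, y). f x y)"
  shows "x \<in> X \<Longrightarrow> continuous_on Y (f x)" "y \<in> Y \<Longrightarrow> continuous_on X (\<lambda>x. f x y)"
proof -
  assume x: "x \<in> X"
  have "continuous_on Y (\<lambda>y. (x, y))" by (rule continuous_on_Pair[OF continuous_on_const continuous_on_id])
  moreover have "(\<lambda>y. (x, y)) ` Y \<subseteq> X \<times> Y" using x by blast
  ultimately show "continuous_on Y (f x)" using continuous_on_compose2[OF assms, of Y "\<lambda>y. (x, y)"] by simp
next
  assume y: "y \<in> Y"
  have "continuous_on X (\<lambda>x. (x, y))" by (rule continuous_on_Pair[OF continuous_on_id continuous_on_const])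
  moreover have "(\<lambda>x. (x, y)) ` X \<subseteq> X \<times> Y" using y by blast
  ultimately show "continuous_on X (\<lambda>x. f x y)" using continuous_on_compose2[OF assms, of X "\<lambda>x. (x, y)"] by simp
qed

text \<open>The primitive is built by integrating along the lower side and then vertically;
  differentiation under the integral together with the common derivative \<open>K\<close> recovers
  \<open>F\<close>. Joint differentiability then follows from the continuity of the second partial
  derivative.\<close>

lemma poincare_rectangle:
  fixes F G K :: "real \<Rightarrow> real \<Rightarrow> complex"
  assumes F: "\<And>x y. x \<in> {a..b} \<Longrightarrow> y \<in> {c..d} \<Longrightarrow> (F x has_vector_derivative K x y) (at y within {c..d})"
    and G: "\<And>x y. x \<in> {a..b} \<Longrightarrow> y \<in> {c..d} \<Longrightarrow> ((\<lambda>x. G x y) has_vector_derivative K x y) (at x within {a..b})"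
    and cF: "continuous_on ({a..b} \<times> {c..d}) (\<lambda>(x, y). F x y)"
    and cG: "continuous_on ({a..b} \<times> {c..d}) (\<lambda>(x, y). G x y)"
    and cK: "continuous_on ({a..b} \<times> {c..d}) (\<lambda>(x, y). K x y)"
  obtains \<Omega> where "\<And>x y. x \<in> {a..b} \<Longrightarrow> y \<in> {c..d} \<Longrightarrow>
    ((\<lambda>(x, y). \<Omega> x y) has_derivative (\<lambda>(s, t). s *\<^sub>R F x y + t *\<^sub>R G x y)) (at (x, y) within {a..b} \<times> {c..d})"
proof -
  define \<Omega> where "\<Omega> = (\<lambda>x y. integral {a..x} (\<lambda>s. F s c) + integral {c..y} (G x))"
  have cGx: "continuous_on {c..d} (G x)" if "x \<in> {a..b}" for x
    by (rule continuous_on_slice(1)[OF cG that])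
  have cFc: "continuous_on {a..b} (\<lambda>s. F s c)" if "c \<le> d"
    by (rule continuous_on_slice(2)[OF cF]) (use that in auto)
  have dy: "(\<Omega> x has_derivative blinfun_apply (blinfun_scaleR_left (G x y))) (at y within {c..d})"
    if "x \<in> {a..b}" "y \<in> {c..d}" for x y
  proof -
    have "((\<lambda>y. integral {c..y} (G x)) has_vector_derivative G x y) (at y within {c..d})"
      by (rule integral_has_vector_derivative[OF cGx that(2)]) (rule that(1))
    then have "(\<Omega> x has_vector_derivative 0 + G x y) (at y within {c..d})"
      unfolding \<Omega>_def by (intro has_vector_derivative_add has_vector_derivative_const)
    then show ?thesis by (simp add: has_vector_derivative_def)
  qed
  have dx: "((\<lambda>x. \<Omega> x y) has_derivative (\<lambda>s. s *\<^sub>R F x y)) (at x within {a..b})"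
    if x: "x \<in> {a..b}" and y: "y \<in> {c..d}" for x y
  proof -
    have sub: "{c..y} \<subseteq> {c..d}" using y by auto
    have 1: "((\<lambda>x. integral {a..x} (\<lambda>s. F s c)) has_vector_derivative F x c) (at x within {a..b})"
      using y by (intro integral_has_vector_derivative[OF cFc x]) auto
    have "((\<lambda>x. integral (cbox c y) (G x)) has_vector_derivative integral (cbox c y) (K x)) (at x within {a..b})"
    proof (rule leibniz_rule_vector_derivative[OF _ _ _ x])
      show "((\<lambda>x. G x t) has_vector_derivative K x t) (at x within {a..b})" if "x \<in> {a..b}" "t \<in> cbox c y" for x t
        using G that sub by auto
      show "G x integrable_on cbox c y" if "x \<in> {a..b}" for x
        using continuous_on_subset[OF cGx[OF that] sub] by (auto intro: integrable_continuous_real)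
      show "continuous_on ({a..b} \<times> cbox c y) (\<lambda>(x, t). K x t)"
        by (rule continuous_on_subset[OF cK]) (use sub in auto)
    qed auto
    moreover have "integral {c..y} (K x) = F x y - F x c"
    proof (rule integral_unique, rule fundamental_theorem_of_calculus)
      show "c \<le> y" using y by simp
      show "(F x has_vector_derivative K x t) (at t within {c..y})" if "t \<in> {c..y}" for t
        by (rule has_vector_derivative_within_subset[OF F[OF x] sub]) (use that sub in auto)
    qed
    ultimately have "((\<lambda>x. integral {c..y} (G x)) has_vector_derivative F x y - F x c) (at x within {a..b})" by simp
    from has_vector_derivative_add[OF 1 this]
    show ?thesis by (simp add: \<Omega>_def has_vector_derivative_def)
  qed
  have cc: "continuous (at (x, y) within {a..b} \<times> {c..d}) (\<lambda>(x, y). blinfun_scaleR_left (G x y))"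
    if "x \<in> {a..b}" "y \<in> {c..d}" for x y
  proof -
    have "continuous_on ({a..b} \<times> {c..d}) (\<lambda>z. blinfun_scaleR_left (case z of (x, y) \<Rightarrow> G x y))"
      by (rule bounded_linear.continuous_on[OF bounded_linear_blinfun_scaleR_left cG])
    then show ?thesis using that by (simp add: continuous_on_eq_continuous_within split_def)
  qed
  show thesis
  proof (rule that[of \<Omega>])
    fix x y assume xy: "x \<in> {a..b}" "y \<in> {c..d}"
    show "((\<lambda>(x, y). \<Omega> x y) has_derivative (\<lambda>(s, t). s *\<^sub>R F x y + t *\<^sub>R G x y)) (at (x, y) within {a..b} \<times> {c..d})"
      using has_derivative_partialsI[OF dx[OF xy] dy cc[OF xy] xy(2)] by simp
  qed
qed

text \<open>Writing \<open>f u v - f a v\<close> as the integral of \<open>fx\<close> and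
  differentiating under the integral in the second variable represents
  \<open>fy u y - fy a y\<close> as the integral of \<open>fxy\<close>; the fundamental theorem
  finishes.\<close>

lemma mixed_partials_commute:
  fixes f fx fy fxy fyx :: "real \<Rightarrow> real \<Rightarrow> real"
  assumes fx: "\<And>x y. x \<in> {a..b} \<Longrightarrow> y \<in> {c..d} \<Longrightarrow> ((\<lambda>x. f x y) has_vector_derivative fx x y) (at x within {a..b})"
    and fy: "\<And>x y. x \<in> {a..b} \<Longrightarrow> y \<in> {c..d} \<Longrightarrow> (f x has_vector_derivative fy x y) (at y within {c..d})"
    and fxy: "\<And>x y. x \<in> {a..b} \<Longrightarrow> y \<in> {c..d} \<Longrightarrow> (fx x has_vector_derivative fxy x y) (at y within {c..d})"
    and fyx: "\<And>x y. x \<in> {a..b} \<Longrightarrow> y \<in> {c..d} \<Longrightarrow> ((\<lambda>x. fy x y) has_vector_derivative fyx x y) (at x within {a..b})"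
    and cx: "continuous_on ({a..b} \<times> {c..d}) (\<lambda>(x, y). fx x y)"
    and cxy: "continuous_on ({a..b} \<times> {c..d}) (\<lambda>(x, y). fxy x y)"
    and xy: "a < b" "c < d" "x \<in> {a..b}" "y \<in> {c..d}"
  shows "fxy x y = fyx x y"
proof -
  have cxs: "continuous_on {a..b} (\<lambda>s. fx s y)" if "y \<in> {c..d}" for y
    by (rule continuous_on_slice(2)[OF cx that])
  have cxys: "continuous_on {a..b} (\<lambda>s. fxy s y)"
    by (rule continuous_on_slice(2)[OF cxy xy(4)])
  have eq: "fy u y - fy a y = integral {a..u} (\<lambda>s. fxy s y)" if u: "u \<in> {a..b}" for u
  proof -
    have sub: "{a..u} \<subseteq> {a..b}" using u by auto
    have I: "integral {a..u} (\<lambda>s. fx s v) = f u v - f a v" if "v \<in> {c..d}" for v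
    proof (rule integral_unique, rule fundamental_theorem_of_calculus)
      show "a \<le> u" using u by simp
      show "((\<lambda>s. f s v) has_vector_derivative fx t v) (at t within {a..u})" if "t \<in> {a..u}" for t
        by (rule has_vector_derivative_within_subset[OF fx[OF _ \<open>v \<in> {c..d}\<close>] sub]) (use that sub in auto)
    qed
    have "((\<lambda>v. integral (cbox a u) (\<lambda>s. fx s v)) has_vector_derivative integral (cbox a u) (\<lambda>s. fxy s y)) (at y within {c..d})"
    proof (rule leibniz_rule_vector_derivative[OF _ _ _ xy(4)])
      show "(fx t has_vector_derivative fxy t v) (at v within {c..d})" if "v \<in> {c..d}" "t \<in> cbox a u" for v t
        using fxy that sub by auto
      show "(\<lambda>s. fx s v) integrable_on cbox a u" if "v \<in> {c..d}" for v
        using continuous_on_subset[OF cxs[OF that] sub] by (auto intro: integrable_continuous_real)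
      have "continuous_on ({c..d} \<times> {a..u}) (\<lambda>z. case (snd z, fst z) of (x, y) \<Rightarrow> fxy x y)"
        by (rule continuous_on_compose2[OF cxy]) (use sub in \<open>auto intro!: continuous_intros\<close>)
      then show "continuous_on ({c..d} \<times> cbox a u) (\<lambda>(v, t). fxy t v)" by (simp add: split_def)
    qed auto
    then have "((\<lambda>v. integral {a..u} (\<lambda>s. fx s v)) has_vector_derivative integral {a..u} (\<lambda>s. fxy s y)) (at y within {c..d})"
      by simp
    then have "((\<lambda>v. f u v - f a v) has_vector_derivative integral {a..u} (\<lambda>s. fxy s y)) (at y within {c..d})"
      by (rule has_vector_derivative_transform[OF xy(4), rotated]) (simp only: I)
    moreover have "((\<lambda>v. f u v - f a v) has_vector_derivative fy u y - fy a y) (at y within {c..d})"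
      using u xy by (intro has_vector_derivative_diff fy) auto
    moreover have "at y within {c..d} \<noteq> bot" using xy by (simp add: trivial_limit_within)
    ultimately show ?thesis using vector_derivative_unique_within by blast
  qed
  have "((\<lambda>u. integral {a..u} (\<lambda>s. fxy s y)) has_vector_derivative fxy x y) (at x within {a..b})"
    by (rule integral_has_vector_derivative[OF cxys xy(3)])
  then have "((\<lambda>u. fy u y - fy a y) has_vector_derivative fxy x y) (at x within {a..b})"
    by (rule has_vector_derivative_transform[OF xy(3), rotated]) (simp only: eq)
  moreover have "((\<lambda>u. fy u y - fy a y) has_vector_derivative fyx x y - 0) (at x within {a..b})"
    using xy by (intro has_vector_derivative_diff fyx has_vector_derivative_const) auto
  moreover have "at x within {a..b} \<noteq> bot" using xy by (simp add: trivial_limit_within)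
  ultimately show ?thesis using vector_derivative_unique_within by fastforce
qed

text \<open>The real Frechet derivative recorded by its two partials, with values in any normed
  space, so that u and its complex derivative u_z are treated alike.\<close>

definition has_grad :: "(complex \<Rightarrow> 'a::real_normed_vector) \<Rightarrow> 'a \<Rightarrow> 'a \<Rightarrow> complex \<Rightarrow> bool" where
  "has_grad f fx fy z \<longleftrightarrow> (f has_derivative (\<lambda>h. Re h *\<^sub>R fx + Im h *\<^sub>R fy)) (at z)"

lemma has_grad_const: "has_grad (\<lambda>z. c) 0 0 z"
  by (simp add: has_grad_def)

lemma has_grad_add: "has_grad f fx fy z \<Longrightarrow> has_grad g gx gy z \<Longrightarrow> has_grad (\<lambda>z. f z + g z) (fx + gx) (fy + gy) z"
  unfolding has_grad_def by (drule (1) has_derivative_add) (simp add: scaleR_add_right algebra_simps)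

lemma has_grad_mult:
  fixes f g :: "complex \<Rightarrow> 'a::real_normed_algebra"
  assumes "has_grad f fx fy z" "has_grad g gx gy z"
  shows "has_grad (\<lambda>z. f z * g z) (f z * gx + fx * g z) (f z * gy + fy * g z) z"
  using has_derivative_mult[OF assms[unfolded has_grad_def]]
  unfolding has_grad_def by (simp add: algebra_simps)

lemma has_grad_cmult:
  fixes f :: "complex \<Rightarrow> 'a::real_normed_algebra"
  shows "has_grad f fx fy z \<Longrightarrow> has_grad (\<lambda>z. c * f z) (c * fx) (c * fy) z"
  using has_grad_mult[OF has_grad_const, of f fx fy z c] by simp

lemma has_grad_of_real:
  assumes "has_grad f fx fy z"
  shows "has_grad (\<lambda>z. of_real (f z) :: 'a::{real_normed_algebra_1}) (of_real fx) (of_real fy) z"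
  using has_derivative_of_real[OF assms[unfolded has_grad_def], where ?'a = 'a]
  unfolding has_grad_def by (simp add: scaleR_conv_of_real)

lemma has_grad_exp:
  fixes f :: "complex \<Rightarrow> real"
  assumes "has_grad f fx fy z"
  shows "has_grad (\<lambda>z. exp (f z)) (exp (f z) * fx) (exp (f z) * fy) z"
  using has_derivative_exp[OF assms[unfolded has_grad_def]]
  unfolding has_grad_def by (simp add: algebra_simps)

lemma has_grad_line:
  assumes "has_grad f fx fy (p + of_real t * d)"
  shows "((\<lambda>t. f (p + of_real t * d)) has_vector_derivative (Re d *\<^sub>R fx + Im d *\<^sub>R fy)) (at t)"
proof -
  have "((\<lambda>t. p + of_real t * d) has_derivative (\<lambda>s. of_real s * d)) (at t)"
    by (auto intro!: derivative_eq_intros)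
  from has_derivative_compose[OF this assms[unfolded has_grad_def]]
  show ?thesis by (simp add: has_vector_derivative_def scaleR_add_right)
qed

lemma has_grad_unique:
  assumes "has_grad f fx fy z" "has_grad f gx gy z"
  shows "fx = gx" "fy = gy"
proof -
  have "(\<lambda>h. Re h *\<^sub>R fx + Im h *\<^sub>R fy) = (\<lambda>h. Re h *\<^sub>R gx + Im h *\<^sub>R gy)"
    using assms unfolding has_grad_def by (rule has_derivative_unique)
  from fun_cong[OF this, of 1] fun_cong[OF this, of \<i>] show "fx = gx" "fy = gy" by simp_all
qed

lemma differentiable_has_grad:
  assumes "f differentiable (at z)"
  shows "has_grad f (dir_deriv 1 f z) (dir_deriv \<i> f z) z"
proof -
  have d: "(f has_derivative frechet_derivative f (at z)) (at z)"
    using assms frechet_derivative_works by blast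
  then interpret linear "frechet_derivative f (at z)" by (rule has_derivative_linear)
  have "frechet_derivative f (at z) h = Re h *\<^sub>R dir_deriv 1 f z + Im h *\<^sub>R dir_deriv \<i> f z" for h
  proof -
    have "h = Re h *\<^sub>R 1 + Im h *\<^sub>R \<i>" by (simp add: complex_eq_iff)
    then have "frechet_derivative f (at z) h = frechet_derivative f (at z) (Re h *\<^sub>R 1 + Im h *\<^sub>R \<i>)" by simp
    then show ?thesis by (simp only: add scale dir_deriv_def)
  qed
  then have "frechet_derivative f (at z) = (\<lambda>h. Re h *\<^sub>R dir_deriv 1 f z + Im h *\<^sub>R dir_deriv \<i> f z)" by (rule ext)
  with d show ?thesis by (simp add: has_grad_def)
qed

lemma Ck_on_2D:
  assumes "Ck_on 2 S f" "z \<in> S"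
  shows "has_grad f (dir_deriv 1 f z) (dir_deriv \<i> f z) z"
    and "has_grad (dir_deriv d f) (dir_deriv 1 (dir_deriv d f) z) (dir_deriv \<i> (dir_deriv d f) z) z"
    and "continuous_on S (dir_deriv e (dir_deriv d f))"
proof -
  have *: "Ck_on (Suc (Suc 0)) S f" using assms(1) by (simp only: numeral_2_eq_2)
  then show "has_grad f (dir_deriv 1 f z) (dir_deriv \<i> f z) z" using assms(2) by (auto intro: differentiable_has_grad)
  show "has_grad (dir_deriv d f) (dir_deriv 1 (dir_deriv d f) z) (dir_deriv \<i> (dir_deriv d f) z) z"
    using * assms(2) by (auto intro: differentiable_has_grad)
  show "continuous_on S (dir_deriv e (dir_deriv d f))" using * by auto
qed

lemma rectangle_in_open:
  assumes "open S" "z \<in> S"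
  obtains r where "r > 0" "\<And>x y. x \<in> {Re z - r..Re z + r} \<Longrightarrow> y \<in> {Im z - r..Im z + r} \<Longrightarrow> Complex x y \<in> S"
proof -
  obtain e where e: "e > 0" "cball z e \<subseteq> S" using assms open_contains_cball by blast
  show thesis
  proof (rule that[of "e/2"])
    show "e / 2 > 0" using e by simp
    fix x y assume "x \<in> {Re z - e/2..Re z + e/2}" "y \<in> {Im z - e/2..Im z + e/2}"
    then have "\<bar>Re (z - Complex x y)\<bar> \<le> e/2" "\<bar>Im (z - Complex x y)\<bar> \<le> e/2"
      unfolding atLeastAtMost_iff minus_complex.sel complex.sel by linarith+
    then have "norm (z - Complex x y) \<le> e" using cmod_le[of "z - Complex x y"] by linarith
    then show "Complex x y \<in> S" using e by (auto simp: dist_norm)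
  qed
qed

lemma has_grad_rectangle:
  assumes "has_grad f fx fy (Complex x y)"
  shows "((\<lambda>x. f (Complex x y)) has_vector_derivative fx) (at x within A)"
    and "((\<lambda>y. f (Complex x y)) has_vector_derivative fy) (at y within B)"
proof -
  have e: "Complex 0 y + of_real x * 1 = Complex x y" "Complex x 0 + of_real y * \<i> = Complex x y" for x y
    by (simp_all add: complex_eq_iff)
  show "((\<lambda>x. f (Complex x y)) has_vector_derivative fx) (at x within A)"
    using has_grad_line[of f fx fy "Complex 0 y" x 1, unfolded e, OF assms]
    by (simp add: has_vector_derivative_at_within)
  show "((\<lambda>y. f (Complex x y)) has_vector_derivative fy) (at y within B)"
    using has_grad_line[of f fx fy "Complex x 0" y \<i>, unfolded e, OF assms]
    by (simp add: has_vector_derivative_at_within)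
qed

lemma continuous_on_rectangle:
  assumes "continuous_on S f" "\<And>x y. x \<in> X \<Longrightarrow> y \<in> Y \<Longrightarrow> Complex x y \<in> S"
  shows "continuous_on (X \<times> Y) (\<lambda>(x, y). f (Complex x y))"
  unfolding split_def
  by (rule continuous_on_compose2[OF assms(1)]) (use assms(2) in \<open>auto intro!: continuous_intros\<close>)

lemma mixed_dir_deriv_commute:
  assumes S: "open S" and f: "Ck_on 2 S f" and z: "z \<in> S"
  shows "dir_deriv \<i> (dir_deriv 1 f) z = dir_deriv 1 (dir_deriv \<i> f) z"
proof -
  obtain r where r: "r > 0" and R: "\<And>x y. x \<in> {Re z - r..Re z + r} \<Longrightarrow> y \<in> {Im z - r..Im z + r} \<Longrightarrow> Complex x y \<in> S"
    using rectangle_in_open[OF S z] by blast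
  have c1: "continuous_on S (dir_deriv 1 f)"
  proof (rule continuous_at_imp_continuous_on, rule ballI)
    fix w assume "w \<in> S"
    from Ck_on_2D(2)[OF f this, of 1] show "isCont (dir_deriv 1 f) w"
      unfolding has_grad_def by (rule has_derivative_continuous)
  qed
  have "dir_deriv \<i> (dir_deriv 1 f) (Complex (Re z) (Im z)) = dir_deriv 1 (dir_deriv \<i> f) (Complex (Re z) (Im z))"
  proof (rule mixed_partials_commute[where f = "\<lambda>x y. f (Complex x y)" and fx = "\<lambda>x y. dir_deriv 1 f (Complex x y)"
       and fy = "\<lambda>x y. dir_deriv \<i> f (Complex x y)" and fxy = "\<lambda>x y. dir_deriv \<i> (dir_deriv 1 f) (Complex x y)"
       and fyx = "\<lambda>x y. dir_deriv 1 (dir_deriv \<i> f) (Complex x y)"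
       and a = "Re z - r" and b = "Re z + r" and c = "Im z - r" and d = "Im z + r"])
    fix x y assume "x \<in> {Re z - r..Re z + r}" "y \<in> {Im z - r..Im z + r}"
    note w = R[OF this]
    note g = has_grad_rectangle[OF Ck_on_2D(1)[OF f w]] has_grad_rectangle[OF Ck_on_2D(2)[OF f w]]
    show "((\<lambda>x. f (Complex x y)) has_vector_derivative dir_deriv 1 f (Complex x y)) (at x within {Re z - r..Re z + r})"
      "((\<lambda>y. f (Complex x y)) has_vector_derivative dir_deriv \<i> f (Complex x y)) (at y within {Im z - r..Im z + r})"
      "((\<lambda>y. dir_deriv 1 f (Complex x y)) has_vector_derivative dir_deriv \<i> (dir_deriv 1 f) (Complex x y)) (at y within {Im z - r..Im z + r})"
      "((\<lambda>x. dir_deriv \<i> f (Complex x y)) has_vector_derivative dir_deriv 1 (dir_deriv \<i> f) (Complex x y)) (at x within {Re z - r..Re z + r})"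
      by (rule g)+
  next
    show "continuous_on ({Re z - r..Re z + r} \<times> {Im z - r..Im z + r}) (\<lambda>(x, y). dir_deriv 1 f (Complex x y))"
      by (rule continuous_on_rectangle[OF c1 R])
    show "continuous_on ({Re z - r..Re z + r} \<times> {Im z - r..Im z + r}) (\<lambda>(x, y). dir_deriv \<i> (dir_deriv 1 f) (Complex x y))"
      by (rule continuous_on_rectangle[OF Ck_on_2D(3)[OF f z] R])
  qed (use r in auto)
  then show ?thesis by simp
qed

text \<open>The hypotheses say H dz = da + (F dx + G dy) with a closed second form. Locally that
  form has a primitive \<Omega>, and \<open>a + \<Omega>\<close> is complex differentiable with
  derivative \<open>H\<close>; hence \<open>H\<close> is itself the derivative of a holomorphic
  function. No partial derivatives of \<open>H\<close> occur.\<close>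

lemma holomorphic_of_closed:
  fixes a F G H :: "complex \<Rightarrow> complex"
  assumes S: "open S"
    and a: "\<And>z. z \<in> S \<Longrightarrow> has_grad a (ax z) (ay z) z"
    and F: "\<And>z. z \<in> S \<Longrightarrow> has_grad F (Fx z) (K z) z"
    and G: "\<And>z. z \<in> S \<Longrightarrow> has_grad G (K z) (Gy z) z"
    and K: "continuous_on S K"
    and H: "\<And>z. z \<in> S \<Longrightarrow> ax z + F z = H z" "\<And>z. z \<in> S \<Longrightarrow> ay z + G z = \<i> * H z"
  shows "H holomorphic_on S"
  unfolding holomorphic_on_open[OF S]
proof
  fix z assume z: "z \<in> S"
  obtain r where r: "r > 0" and R: "\<And>x y. x \<in> {Re z - r..Re z + r} \<Longrightarrow> y \<in> {Im z - r..Im z + r} \<Longrightarrow> Complex x y \<in> S"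
    using rectangle_in_open[OF S z] by blast
  define X Y where "X = {Re z - r..Re z + r}" and "Y = {Im z - r..Im z + r}"
  have R: "\<And>x y. x \<in> X \<Longrightarrow> y \<in> Y \<Longrightarrow> Complex x y \<in> S" using R by (simp add: X_def Y_def)
  have cF: "continuous_on S F" "continuous_on S G"
    using F G unfolding has_grad_def by (auto intro!: continuous_at_imp_continuous_on dest: has_derivative_continuous)
  obtain \<Omega> where \<Omega>: "\<And>x y. x \<in> X \<Longrightarrow> y \<in> Y \<Longrightarrow> ((\<lambda>(x, y). \<Omega> x y) has_derivative
      (\<lambda>(s, t). s *\<^sub>R F (Complex x y) + t *\<^sub>R G (Complex x y))) (at (x, y) within X \<times> Y)"
  proof (rule poincare_rectangle[where F = "\<lambda>x y. F (Complex x y)" and G = "\<lambda>x y. G (Complex x y)" and K = "\<lambda>x y. K (Complex x y)"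
       and a = "Re z - r" and b = "Re z + r" and c = "Im z - r" and d = "Im z + r", folded X_def Y_def])
    fix x y assume w: "x \<in> X" "y \<in> Y"
    show "((\<lambda>y. F (Complex x y)) has_vector_derivative K (Complex x y)) (at y within Y)"
      by (rule has_grad_rectangle(2)[OF F[OF R[OF w]]])
    show "((\<lambda>x. G (Complex x y)) has_vector_derivative K (Complex x y)) (at x within X)"
      by (rule has_grad_rectangle(1)[OF G[OF R[OF w]]])
  qed (auto intro!: continuous_on_rectangle R cF K)
  define B where "B = {w. Re z - r < Re w \<and> Re w < Re z + r \<and> Im z - r < Im w \<and> Im w < Im z + r}"
  have B: "open B" "z \<in> B"
  proof -
    have "B = {w. Re z - r < Re w} \<inter> {w. Re w < Re z + r} \<inter> {w. Im z - r < Im w} \<inter> {w. Im w < Im z + r}"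
      by (auto simp: B_def)
    then show "open B" by (simp add: open_Int open_halfspace_Re_gt open_halfspace_Re_lt open_halfspace_Im_gt open_halfspace_Im_lt)
    show "z \<in> B" using r by (simp add: B_def)
  qed
  define P where "P = (\<lambda>w. a w + \<Omega> (Re w) (Im w))"
  have P: "(P has_field_derivative H w) (at w)" if w: "w \<in> B" for w
  proof -
    have wXY: "Re w \<in> X" "Im w \<in> Y" and wi: "(Re w, Im w) \<in> interior (X \<times> Y)"
      using w by (auto simp: B_def X_def Y_def interior_Times)
    have wS: "w \<in> S" using R[OF wXY] by simp
    have "((\<lambda>(x, y). \<Omega> x y) has_derivative (\<lambda>(s, t). s *\<^sub>R F w + t *\<^sub>R G w)) (at (Re w, Im w))"
      using \<Omega>[OF wXY] by (simp add: at_within_interior[OF wi])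
    moreover have "((\<lambda>w. (Re w, Im w)) has_derivative (\<lambda>h. (Re h, Im h))) (at w)"
      by (auto intro!: derivative_eq_intros)
    ultimately have "((\<lambda>w. case (Re w, Im w) of (x, y) \<Rightarrow> \<Omega> x y) has_derivative (\<lambda>h. case (Re h, Im h) of (s, t) \<Rightarrow> s *\<^sub>R F w + t *\<^sub>R G w)) (at w)"
      by (rule has_derivative_compose[rotated])
    then have "((\<lambda>w. \<Omega> (Re w) (Im w)) has_derivative (\<lambda>h. Re h *\<^sub>R F w + Im h *\<^sub>R G w)) (at w)" by simp
    from has_derivative_add[OF a[OF wS, unfolded has_grad_def] this]
    have "(P has_derivative (\<lambda>h. Re h *\<^sub>R ax w + Im h *\<^sub>R ay w + (Re h *\<^sub>R F w + Im h *\<^sub>R G w))) (at w)"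
      by (simp add: P_def)
    moreover have "(\<lambda>h. Re h *\<^sub>R ax w + Im h *\<^sub>R ay w + (Re h *\<^sub>R F w + Im h *\<^sub>R G w)) = (*) (H w)"
    proof
      fix h
      have "Re h *\<^sub>R ax w + Im h *\<^sub>R ay w + (Re h *\<^sub>R F w + Im h *\<^sub>R G w) = Re h *\<^sub>R (ax w + F w) + Im h *\<^sub>R (ay w + G w)"
        by (simp add: algebra_simps)
      also have "\<dots> = (of_real (Re h) + \<i> * of_real (Im h)) * H w"
        unfolding H[OF wS] by (simp add: scaleR_conv_of_real algebra_simps)
      also have "of_real (Re h) + \<i> * of_real (Im h) = h" by (rule complex_eq[symmetric])
      finally show "Re h *\<^sub>R ax w + Im h *\<^sub>R ay w + (Re h *\<^sub>R F w + Im h *\<^sub>R G w) = H w * h" by (simp add: mult.commute)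
    qed
    ultimately show ?thesis by (simp add: has_field_derivative_def)
  qed
  then have "P holomorphic_on B" unfolding holomorphic_on_open[OF B(1)] by blast
  then have "deriv P holomorphic_on B" by (rule holomorphic_deriv[OF _ B(1)])
  then have "H holomorphic_on B" by (rule holomorphic_transform) (use P DERIV_imp_deriv in blast)
  then show "\<exists>f'. (H has_field_derivative f') (at z)" using B holomorphic_on_open by blast
qed

section \<open>The Liouville equation and its linearization\<close>

text \<open>The Wirtinger derivative (f_x - \<open>\<i>\<close> f_y)/2. Spelling out real and
  imaginary parts, here and in \<open>Dzz\<close>, reduces later identities to real
  arithmetic.\<close>

definition Dz :: "(complex \<Rightarrow> real) \<Rightarrow> complex \<Rightarrow> complex" where
  "Dz f z = Complex (dir_deriv 1 f z / 2) (- dir_deriv \<i> f z / 2)"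

definition Dzz :: "(complex \<Rightarrow> real) \<Rightarrow> complex \<Rightarrow> complex" where
  "Dzz f z = Complex ((dir_deriv 1 (dir_deriv 1 f) z - dir_deriv \<i> (dir_deriv \<i> f) z) / 4)
     (- dir_deriv \<i> (dir_deriv 1 f) z / 2)"

lemma has_grad_Dz:
  assumes "open S" "Ck_on 2 S f" "z \<in> S"
  shows "has_grad (Dz f) (Complex (dir_deriv 1 (dir_deriv 1 f) z / 2) (- dir_deriv \<i> (dir_deriv 1 f) z / 2))
    (Complex (dir_deriv \<i> (dir_deriv 1 f) z / 2) (- dir_deriv \<i> (dir_deriv \<i> f) z / 2)) z"
proof -
  have "Dz f = (\<lambda>z. (1/2) * of_real (dir_deriv 1 f z) + (- \<i> / 2) * of_real (dir_deriv \<i> f z))"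
    by (rule ext) (simp add: Dz_def complex_eq_iff)
  then have "has_grad (Dz f) ((1/2) * of_real (dir_deriv 1 (dir_deriv 1 f) z) + (- \<i> / 2) * of_real (dir_deriv 1 (dir_deriv \<i> f) z))
     ((1/2) * of_real (dir_deriv \<i> (dir_deriv 1 f) z) + (- \<i> / 2) * of_real (dir_deriv \<i> (dir_deriv \<i> f) z)) z"
    by (simp only:) (intro has_grad_add has_grad_cmult has_grad_of_real Ck_on_2D(2)[OF assms(2,3)])
  moreover have "(1/2) * of_real p + (- \<i> / 2) * of_real q = Complex (p / 2) (- q / 2)" for p q
    by (simp add: complex_eq_iff)
  ultimately show ?thesis by (simp add: mixed_dir_deriv_commute[OF assms])
qed

lemma has_grad_continuous_on:
  "(\<And>z. z \<in> S \<Longrightarrow> has_grad f (fx z) (fy z) z) \<Longrightarrow> continuous_on S f"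
  unfolding has_grad_def
  by (rule continuous_at_imp_continuous_on) (blast dest: has_derivative_continuous)

lemma continuous_on_Complex: "continuous_on S f \<Longrightarrow> continuous_on S g \<Longrightarrow> continuous_on S (\<lambda>z. Complex (f z) (g z))"
  unfolding Complex_eq by (intro continuous_intros)

text \<open>
  As \<open>u\<close> is only of class \<open>C\<^sup>2\<close>, the Cauchy-Riemann equations of the potential cannot be checked by
  differentiation; instead \<open>(u\<^sub>z\<^sup>2/4 - u\<^sub>z\<^sub>z/2) dz\<close> is the sum of the exact form \<open>- d(u\<^sub>z)/2\<close> and of a closed form of class \<open>C\<^sup>1\<close>.
\<close>

lemma liouville_potential_holomorphic:
  assumes S: "open S" and u: "Ck_on 2 S u" and eq: "\<And>z. z \<in> S \<Longrightarrow> laplacian u z + exp (u z) = 0"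
  shows "(\<lambda>z. (Dz u z)\<^sup>2 / 4 - Dzz u z / 2) holomorphic_on S"
proof -
  let ?ux = "dir_deriv 1 u" and ?uy = "dir_deriv \<i> u"
  let ?uxx = "dir_deriv 1 (dir_deriv 1 u)" and ?uxy = "dir_deriv \<i> (dir_deriv 1 u)" and ?uyy = "dir_deriv \<i> (dir_deriv \<i> u)"
  let ?Ax = "\<lambda>z. Complex (?uxx z / 2) (- ?uxy z / 2)" and ?Ay = "\<lambda>z. Complex (?uxy z / 2) (- ?uyy z / 2)"
  \<comment> \<open>The exact form -d(u_z)/2 contains (e^u/8) d(cnj z), since the mixed Wirtinger
    derivative of u is -e^u/4. \<open>F\<close> and \<open>G\<close> are the coefficients of
    (u_z^2/4) dz - (e^u/8) d(cnj z), which cancels it and is closed by the same equation.\<close>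
  define F where "F = (\<lambda>z. (1/4) * (Dz u z * Dz u z) + (- 1/8) * of_real (exp (u z)))"
  define G where "G = (\<lambda>z. (\<i>/4) * (Dz u z * Dz u z) + (\<i>/8) * of_real (exp (u z)))"
  define K where "K = (\<lambda>z. (1/4) * (Dz u z * ?Ay z + ?Ay z * Dz u z) + (- 1/8) * of_real (exp (u z) * ?uy z))"
  have uyy: "?uyy z = - exp (u z) - ?uxx z" if "z \<in> S" for z
    using eq[OF that] by (simp add: laplacian_def)
  have D: "has_grad (Dz u) (?Ax z) (?Ay z) z" if "z \<in> S" for z using has_grad_Dz[OF S u that] .
  have e: "has_grad (\<lambda>z. of_real (exp (u z)) :: complex) (of_real (exp (u z) * ?ux z)) (of_real (exp (u z) * ?uy z)) z" if "z \<in> S" for z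
    by (rule has_grad_of_real[OF has_grad_exp[OF Ck_on_2D(1)[OF u that]]])
  show ?thesis
  proof (rule holomorphic_of_closed[OF S, where a = "\<lambda>z. (- 1/2) * Dz u z" and F = F and G = G and K = K])
    fix z assume z: "z \<in> S"
    show "has_grad (\<lambda>z. (- 1/2) * Dz u z) ((- 1/2) * ?Ax z) ((- 1/2) * ?Ay z) z" by (rule has_grad_cmult[OF D[OF z]])
    show "has_grad F ((1/4) * (Dz u z * ?Ax z + ?Ax z * Dz u z) + (- 1/8) * of_real (exp (u z) * ?ux z)) (K z) z"
      unfolding F_def K_def by (intro has_grad_add has_grad_cmult has_grad_mult D[OF z] e[OF z])
    have "K z = (\<i>/4) * (Dz u z * ?Ax z + ?Ax z * Dz u z) + (\<i>/8) * of_real (exp (u z) * ?ux z)"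
      unfolding K_def Dz_def uyy[OF z] by (simp add: complex_eq_iff algebra_simps add_divide_distrib diff_divide_distrib)
    then show "has_grad G (K z) ((\<i>/4) * (Dz u z * ?Ay z + ?Ay z * Dz u z) + (\<i>/8) * of_real (exp (u z) * ?uy z)) z"
      unfolding G_def by (simp only:) (intro has_grad_add has_grad_cmult has_grad_mult D[OF z] e[OF z])
    show "(- 1/2) * ?Ax z + F z = (Dz u z)\<^sup>2 / 4 - Dzz u z / 2"
      unfolding F_def Dzz_def uyy[OF z] by (simp add: complex_eq_iff power2_eq_square algebra_simps add_divide_distrib diff_divide_distrib)
    show "(- 1/2) * ?Ay z + G z = \<i> * ((Dz u z)\<^sup>2 / 4 - Dzz u z / 2)"
      unfolding G_def Dzz_def uyy[OF z] by (simp add: complex_eq_iff power2_eq_square algebra_simps add_divide_distrib diff_divide_distrib)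
  next
    have "continuous_on S (Dz u)" "continuous_on S u" "continuous_on S ?uy"
      by (rule has_grad_continuous_on, rule D Ck_on_2D(1,2)[OF u], assumption)+
    moreover have "continuous_on S ?uxy" "continuous_on S ?uyy" if "w \<in> S" for w
      using Ck_on_2D(3)[OF u that] by simp_all
    ultimately show "continuous_on S K"
      unfolding K_def by (cases "S = {}") (auto intro!: continuous_intros continuous_on_Complex)
  qed
qed

text \<open>Up to the factor -2 this function is the first variation of the potential in direction
  \<open>p\<close>. Accordingly it splits as the exact form d(p_z) plus the closed form -u_z p_z dz
  + (e^u p/4) d(cnj z).\<close>

lemma linearized_potential_holomorphic:
  assumes S: "open S" and u: "Ck_on 2 S u" and eq: "\<And>z. z \<in> S \<Longrightarrow> laplacian u z + exp (u z) = 0"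
    and p: "Ck_on 2 S p" and peq: "\<And>z. z \<in> S \<Longrightarrow> laplacian p z + exp (u z) * p z = 0"
  shows "(\<lambda>z. Dzz p z - Dz u z * Dz p z) holomorphic_on S"
proof -
  let ?ux = "dir_deriv 1 u" and ?uy = "dir_deriv \<i> u"
  let ?uxx = "dir_deriv 1 (dir_deriv 1 u)" and ?uxy = "dir_deriv \<i> (dir_deriv 1 u)" and ?uyy = "dir_deriv \<i> (dir_deriv \<i> u)"
  let ?Ax = "\<lambda>z. Complex (?uxx z / 2) (- ?uxy z / 2)" and ?Ay = "\<lambda>z. Complex (?uxy z / 2) (- ?uyy z / 2)"
  let ?px = "dir_deriv 1 p" and ?py = "dir_deriv \<i> p"
  let ?pxx = "dir_deriv 1 (dir_deriv 1 p)" and ?pxy = "dir_deriv \<i> (dir_deriv 1 p)" and ?pyy = "dir_deriv \<i> (dir_deriv \<i> p)"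
  let ?Bx = "\<lambda>z. Complex (?pxx z / 2) (- ?pxy z / 2)" and ?By = "\<lambda>z. Complex (?pxy z / 2) (- ?pyy z / 2)"
  define F where "F = (\<lambda>z. (- 1) * (Dz u z * Dz p z) + (1/4) * of_real (exp (u z) * p z))"
  define G where "G = (\<lambda>z. (- \<i>) * (Dz u z * Dz p z) + (- \<i>/4) * of_real (exp (u z) * p z))"
  define K where "K = (\<lambda>z. (- 1) * (Dz u z * ?By z + ?Ay z * Dz p z) + (1/4) * of_real (exp (u z) * ?py z + exp (u z) * ?uy z * p z))"
  have uyy: "?uyy z = - exp (u z) - ?uxx z" if "z \<in> S" for z
    using eq[OF that] by (simp add: laplacian_def)
  have pyy: "?pyy z = - exp (u z) * p z - ?pxx z" if "z \<in> S" for z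
    using peq[OF that] by (simp add: laplacian_def)
  have D: "has_grad (Dz u) (?Ax z) (?Ay z) z" if "z \<in> S" for z using has_grad_Dz[OF S u that] .
  have E: "has_grad (Dz p) (?Bx z) (?By z) z" if "z \<in> S" for z using has_grad_Dz[OF S p that] .
  have e: "has_grad (\<lambda>z. of_real (exp (u z) * p z) :: complex) (of_real (exp (u z) * ?px z + exp (u z) * ?ux z * p z))
      (of_real (exp (u z) * ?py z + exp (u z) * ?uy z * p z)) z" if "z \<in> S" for z
    by (rule has_grad_of_real[OF has_grad_mult[OF has_grad_exp[OF Ck_on_2D(1)[OF u that]] Ck_on_2D(1)[OF p that]]])
  show ?thesis
  proof (rule holomorphic_of_closed[OF S, where a = "Dz p" and F = F and G = G and K = K])
    fix z assume z: "z \<in> S"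
    show "has_grad (Dz p) (?Bx z) (?By z) z" by (rule E[OF z])
    show "has_grad F ((- 1) * (Dz u z * ?Bx z + ?Ax z * Dz p z) + (1/4) * of_real (exp (u z) * ?px z + exp (u z) * ?ux z * p z)) (K z) z"
      unfolding F_def K_def by (intro has_grad_add has_grad_cmult has_grad_mult D[OF z] E[OF z] e[OF z])
    have "K z = (- \<i>) * (Dz u z * ?Bx z + ?Ax z * Dz p z) + (- \<i>/4) * of_real (exp (u z) * ?px z + exp (u z) * ?ux z * p z)"
      unfolding K_def Dz_def uyy[OF z] pyy[OF z] by (simp add: complex_eq_iff algebra_simps add_divide_distrib diff_divide_distrib)
    then show "has_grad G (K z) ((- \<i>) * (Dz u z * ?By z + ?Ay z * Dz p z) + (- \<i>/4) * of_real (exp (u z) * ?py z + exp (u z) * ?uy z * p z)) z"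
      unfolding G_def by (simp only:) (intro has_grad_add has_grad_cmult has_grad_mult D[OF z] E[OF z] e[OF z])
    show "?Bx z + F z = Dzz p z - Dz u z * Dz p z"
      unfolding F_def Dzz_def pyy[OF z] by (simp add: complex_eq_iff algebra_simps add_divide_distrib diff_divide_distrib)
    show "?By z + G z = \<i> * (Dzz p z - Dz u z * Dz p z)"
      unfolding G_def Dzz_def pyy[OF z] by (simp add: complex_eq_iff algebra_simps add_divide_distrib diff_divide_distrib)
  next
    have "continuous_on S (Dz u)" "continuous_on S (Dz p)" "continuous_on S u" "continuous_on S p" "continuous_on S ?uy" "continuous_on S ?py"
      by (rule has_grad_continuous_on, rule D E Ck_on_2D(1,2)[OF u] Ck_on_2D(1,2)[OF p], assumption)+
    moreover have "continuous_on S ?uxy" "continuous_on S ?uyy" "continuous_on S ?pxy" "continuous_on S ?pyy" if "w \<in> S" for w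
      using Ck_on_2D(3)[OF u that] Ck_on_2D(3)[OF p that] by simp_all
    ultimately show "continuous_on S K"
      unfolding K_def by (cases "S = {}") (auto intro!: continuous_intros continuous_on_Complex)
  qed
qed

section \<open>Reflections and lattice translations\<close>

definition mirror :: "real \<Rightarrow> real \<Rightarrow> complex \<Rightarrow> complex \<Rightarrow> complex" where
  "mirror e1 e2 w z = Complex (e1 * Re z) (e2 * Im z) + w"

text \<open>The factor \<open>s\<close> allows a second application to the first derivatives, which
  pick up a sign under a reflection.\<close>

lemma has_grad_mirror:
  assumes S: "open S" "z \<in> S" and e: "e1 * e1 = 1" "e2 * e2 = (1 :: real)"
    and sym: "\<And>z. z \<in> S \<Longrightarrow> f (mirror e1 e2 w z) = s * f z"
    and g: "has_grad f fx fy z" and h: "has_grad f gx gy (mirror e1 e2 w z)"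
  shows "gx = e1 * s * fx" "gy = e2 * s * (fy :: real)"
proof -
  have m: "(mirror e1 e2 w has_derivative (\<lambda>h. Complex (e1 * Re h) (e2 * Im h))) (at z)"
    unfolding mirror_def Complex_eq by (auto intro!: derivative_eq_intros)
  have "((\<lambda>z. f (mirror e1 e2 w z)) has_derivative (\<lambda>h. Re h *\<^sub>R (e1 * gx) + Im h *\<^sub>R (e2 * gy))) (at z)"
    using has_derivative_compose[OF m h[unfolded has_grad_def]] by (simp add: mult_ac)
  then have "((\<lambda>z. s * f z) has_derivative (\<lambda>h. Re h *\<^sub>R (e1 * gx) + Im h *\<^sub>R (e2 * gy))) (at z)"
    by (rule has_derivative_transform_within_open[OF _ S]) (rule sym)
  then have "has_grad (\<lambda>z. s * f z) (e1 * gx) (e2 * gy) z" by (simp add: has_grad_def)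
  from has_grad_unique[OF this has_grad_cmult[OF g]]
  have "e1 * (e1 * gx) = e1 * (s * fx)" "e2 * (e2 * gy) = e2 * (s * fy)" by simp_all
  then show "gx = e1 * s * fx" "gy = e2 * s * fy" using e by (simp_all flip: mult.assoc)
qed

lemma mirror_derivatives:
  assumes S: "open S" and f: "Ck_on 2 S f" and e: "e1 * e1 = 1" "e2 * e2 = (1 :: real)"
    and sym: "\<And>z. z \<in> S \<Longrightarrow> mirror e1 e2 w z \<in> S \<and> f (mirror e1 e2 w z) = f z" and z: "z \<in> S"
  defines "m \<equiv> mirror e1 e2 w"
  shows "dir_deriv 1 f (m z) = e1 * dir_deriv 1 f z" "dir_deriv \<i> f (m z) = e2 * dir_deriv \<i> f z"
    and "dir_deriv 1 (dir_deriv 1 f) (m z) = dir_deriv 1 (dir_deriv 1 f) z"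
      "dir_deriv \<i> (dir_deriv 1 f) (m z) = e1 * e2 * dir_deriv \<i> (dir_deriv 1 f) z"
      "dir_deriv \<i> (dir_deriv \<i> f) (m z) = dir_deriv \<i> (dir_deriv \<i> f) z"
proof -
  have sym: "\<And>z. z \<in> S \<Longrightarrow> m z \<in> S" "\<And>z. z \<in> S \<Longrightarrow> f (m z) = 1 * f z" using sym by (auto simp: m_def)
  have 1: "dir_deriv 1 f (m z) = e1 * dir_deriv 1 f z" "dir_deriv \<i> f (m z) = e2 * dir_deriv \<i> f z" if "z \<in> S" for z
    using has_grad_mirror[OF S that e sym(2)[unfolded m_def] Ck_on_2D(1)[OF f that] Ck_on_2D(1)[OF f sym(1)[OF that], unfolded m_def]]
    by (simp_all add: m_def)
  then show "dir_deriv 1 f (m z) = e1 * dir_deriv 1 f z" "dir_deriv \<i> f (m z) = e2 * dir_deriv \<i> f z" using z by auto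
  show "dir_deriv 1 (dir_deriv 1 f) (m z) = dir_deriv 1 (dir_deriv 1 f) z" "dir_deriv \<i> (dir_deriv 1 f) (m z) = e1 * e2 * dir_deriv \<i> (dir_deriv 1 f) z"
    using has_grad_mirror[OF S z e 1(1)[unfolded m_def] Ck_on_2D(2)[OF f z] Ck_on_2D(2)[OF f sym(1)[OF z], unfolded m_def]] e
    by (simp_all add: m_def)
  show "dir_deriv \<i> (dir_deriv \<i> f) (m z) = dir_deriv \<i> (dir_deriv \<i> f) z"
    using has_grad_mirror(2)[OF S z e 1(2)[unfolded m_def] Ck_on_2D(2)[OF f z] Ck_on_2D(2)[OF f sym(1)[OF z], unfolded m_def]] e
    by (simp_all add: m_def)
qed

lemma mirror_Dz:
  assumes S: "open S" and f: "Ck_on 2 S f" and e: "e1 * e1 = 1" "e2 * e2 = (1 :: real)"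
    and sym: "\<And>z. z \<in> S \<Longrightarrow> mirror e1 e2 w z \<in> S \<and> f (mirror e1 e2 w z) = f z" and z: "z \<in> S"
  shows "Dz f (mirror e1 e2 w z) = Complex (e1 * Re (Dz f z)) (e2 * Im (Dz f z))"
    and "Dzz f (mirror e1 e2 w z) = Complex (Re (Dzz f z)) (e1 * e2 * Im (Dzz f z))"
proof -
  note d = mirror_derivatives[OF S f e sym z]
  show "Dz f (mirror e1 e2 w z) = Complex (e1 * Re (Dz f z)) (e2 * Im (Dz f z))"
    unfolding Dz_def by (simp only: d complex_eq_iff complex.sel) simp
  show "Dzz f (mirror e1 e2 w z) = Complex (Re (Dzz f z)) (e1 * e2 * Im (Dzz f z))"
    unfolding Dzz_def by (simp only: d complex_eq_iff complex.sel) simp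
qed

section \<open>Behaviour at the lattice points\<close>

lemma has_grad_holomorphic:
  assumes "(f has_field_derivative f') (at z)"
  shows "has_grad f f' (\<i> * f') z"
proof -
  have "(*) f' = (\<lambda>h. Re h *\<^sub>R f' + Im h *\<^sub>R (\<i> * f'))"
    by (rule ext) (simp add: complex_eq_iff)
  then show ?thesis using assms by (simp add: has_field_derivative_def has_grad_def)
qed

lemma has_grad_ln_norm:
  assumes "z \<noteq> 0"
  shows "has_grad (\<lambda>z. ln (norm z)) (Re z / (norm z)\<^sup>2) (Im z / (norm z)\<^sup>2) z"
proof -
  have pos: "(Re z)\<^sup>2 + (Im z)\<^sup>2 > 0" using assms by (simp add: complex_neq_0)
  have "((\<lambda>z. (Re z)\<^sup>2 + (Im z)\<^sup>2) has_derivative (\<lambda>h. 2 * Re z * Re h + 2 * Im z * Im h)) (at z)"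
    by (auto intro!: derivative_eq_intros)
  from has_derivative_mult_right[OF has_derivative_ln[OF pos this], of "1/2"]
  have "((\<lambda>z. ln ((Re z)\<^sup>2 + (Im z)\<^sup>2) / 2) has_derivative
      (\<lambda>h. (2 * Re z * Re h + 2 * Im z * Im h) / ((Re z)\<^sup>2 + (Im z)\<^sup>2) / 2)) (at z)"
    by (simp only: divide_inverse mult_1_left mult_1_right mult.commute[of _ "inverse 2"])
  moreover have "(\<lambda>z. ln ((Re z)\<^sup>2 + (Im z)\<^sup>2) / 2) = (\<lambda>z. ln (norm z))"
  proof
    fix z :: complex
    show "ln ((Re z)\<^sup>2 + (Im z)\<^sup>2) / 2 = ln (norm z)"
    proof (cases "z = 0")
      case False
      then have "(Re z)\<^sup>2 + (Im z)\<^sup>2 > 0" by (simp add: complex_neq_0)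
      then show ?thesis by (simp add: cmod_def ln_sqrt)
    qed simp
  qed
  moreover have "(\<lambda>h. (2 * Re z * Re h + 2 * Im z * Im h) / ((Re z)\<^sup>2 + (Im z)\<^sup>2) / 2) =
      (\<lambda>h. Re h *\<^sub>R (Re z / (norm z)\<^sup>2) + Im h *\<^sub>R (Im z / (norm z)\<^sup>2))"
  proof -
    have "(2 * p * h + 2 * q * k) / s / 2 = h * (p / s) + k * (q / s)" for p q h k s :: real
      by (simp add: add_divide_distrib mult.commute)
    then show ?thesis by (simp only: cmod_power2 real_scaleR_def)
  qed
  ultimately show ?thesis by (simp add: has_grad_def)
qed

lemma has_grad_transform:
  assumes "has_grad f fx fy z" "open S" "z \<in> S" "\<And>w. w \<in> S \<Longrightarrow> f w = g w"
  shows "has_grad g fx fy z"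
  using has_derivative_transform_within_open[OF assms(1)[unfolded has_grad_def] assms(2,3)] assms(4)
  unfolding has_grad_def by simp

lemma Dzz_eq:
  "Dzz f z = (Complex (dir_deriv 1 (dir_deriv 1 f) z / 2) (- dir_deriv \<i> (dir_deriv 1 f) z / 2)
     - \<i> * Complex (dir_deriv \<i> (dir_deriv 1 f) z / 2) (- dir_deriv \<i> (dir_deriv \<i> f) z / 2)) / 2"
  by (simp add: Dzz_def complex_eq_iff)

text \<open>The z-derivative of log|z| is 1/(2z), which is holomorphic off 0, so the singular part
  can be differentiated once more as a complex function.\<close>

lemma log_singularity_derivatives:
  assumes S: "open S" "0 \<notin> S" and u: "Ck_on 2 S u" and T: "S \<subseteq> T" "open T" and v: "Ck_on 2 T v"
    and uv: "\<And>z. z \<in> S \<Longrightarrow> u z = 4 * \<eta> * ln (norm z) + v z" and z: "z \<in> S"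
  shows "Dz u z = of_real (2 * \<eta>) / z + Dz v z" and "Dzz u z = - of_real (2 * \<eta>) / z\<^sup>2 + Dzz v z"
proof -
  have D: "Dz u z = of_real (2 * \<eta>) / z + Dz v z" if z: "z \<in> S" for z
  proof -
    have z0: "z \<noteq> 0" using z S by auto
    have "has_grad (\<lambda>z. 4 * \<eta> * ln (norm z) + v z) (4 * \<eta> * (Re z / (norm z)\<^sup>2) + dir_deriv 1 v z) (4 * \<eta> * (Im z / (norm z)\<^sup>2) + dir_deriv \<i> v z) z"
      using z T by (intro has_grad_add has_grad_cmult has_grad_ln_norm z0 Ck_on_2D(1)[OF v]) auto
    from has_grad_unique[OF Ck_on_2D(1)[OF u z] has_grad_transform[OF this S(1) z uv[symmetric]]]
    have "Dz u z = Complex (4 * \<eta> * (Re z / (norm z)\<^sup>2) / 2) (- (4 * \<eta> * (Im z / (norm z)\<^sup>2)) / 2) + Dz v z"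
      by (simp add: Dz_def complex_eq_iff add_divide_distrib)
    also have "Complex (4 * \<eta> * (Re z / (norm z)\<^sup>2) / 2) (- (4 * \<eta> * (Im z / (norm z)\<^sup>2)) / 2) = of_real (2 * \<eta>) / z"
    proof -
      have "4 * \<eta> * (x / s) / 2 = 2 * \<eta> * x / s" "- (4 * \<eta> * (x / s)) / 2 = - (2 * \<eta> * x / s)" for x s by simp_all
      then show ?thesis by (simp only: complex_eq_iff) (simp add: Re_divide Im_divide cmod_power2)
    qed
    finally show ?thesis .
  qed
  show "Dz u z = of_real (2 * \<eta>) / z + Dz v z" by (rule D[OF z])
  have z0: "z \<noteq> 0" using z S by auto
  have "((\<lambda>z. of_real (2 * \<eta>) / z) has_field_derivative - of_real (2 * \<eta>) / z\<^sup>2) (at z)"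
    using z0 by (auto intro!: derivative_eq_intros simp: power2_eq_square)
  from has_grad_add[OF has_grad_holomorphic[OF this] has_grad_Dz[OF T(2) v subsetD[OF T(1) z]]]
  have "has_grad (\<lambda>z. of_real (2 * \<eta>) / z + Dz v z)
     (- of_real (2 * \<eta>) / z\<^sup>2 + Complex (dir_deriv 1 (dir_deriv 1 v) z / 2) (- dir_deriv \<i> (dir_deriv 1 v) z / 2))
     (\<i> * (- of_real (2 * \<eta>) / z\<^sup>2) + Complex (dir_deriv \<i> (dir_deriv 1 v) z / 2) (- dir_deriv \<i> (dir_deriv \<i> v) z / 2)) z" .
  note g = has_grad_unique[OF has_grad_Dz[OF S(1) u z] has_grad_transform[OF this S(1) z D[symmetric]]]
  define a where "a = - of_real (2 * \<eta>) / z\<^sup>2"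
  define V1 where "V1 = Complex (dir_deriv 1 (dir_deriv 1 v) z / 2) (- dir_deriv \<i> (dir_deriv 1 v) z / 2)"
  define V2 where "V2 = Complex (dir_deriv \<i> (dir_deriv 1 v) z / 2) (- dir_deriv \<i> (dir_deriv \<i> v) z / 2)"
  have "Dzz u z = ((a + V1) - \<i> * (\<i> * a + V2)) / 2"
    unfolding Dzz_eq[of u] a_def V1_def V2_def by (simp only: g)
  moreover have "Dzz v z = (V1 - \<i> * V2) / 2" unfolding Dzz_eq[of v] V1_def V2_def ..
  ultimately have "Dzz u z = a + Dzz v z" by (simp add: complex_eq_iff field_simps)
  then show "Dzz u z = - of_real (2 * \<eta>) / z\<^sup>2 + Dzz v z" by (simp only: a_def)
qed

text \<open>Exactly what the removable singularity theorem asks for, in a form stable under sums and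
  products.\<close>

definition bounded_near0 :: "(complex \<Rightarrow> complex) \<Rightarrow> bool" where
  "bounded_near0 f \<longleftrightarrow> (\<exists>B. \<forall>\<^sub>F z in at 0. norm (f z) \<le> B)"

lemma bounded_near0_add: "bounded_near0 f \<Longrightarrow> bounded_near0 g \<Longrightarrow> bounded_near0 (\<lambda>z. f z + g z)"
proof -
  assume "bounded_near0 f" "bounded_near0 g"
  then obtain B C where "\<forall>\<^sub>F z in at 0. norm (f z) \<le> B" "\<forall>\<^sub>F z in at 0. norm (g z) \<le> C"
    by (auto simp: bounded_near0_def)
  then have "\<forall>\<^sub>F z in at 0. norm (f z + g z) \<le> B + C"
    by eventually_elim (rule norm_triangle_mono)
  then show ?thesis by (auto simp: bounded_near0_def)
qed

lemma bounded_near0_mult: "bounded_near0 f \<Longrightarrow> bounded_near0 g \<Longrightarrow> bounded_near0 (\<lambda>z. f z * g z)"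
proof -
  assume "bounded_near0 f" "bounded_near0 g"
  then obtain B C where "\<forall>\<^sub>F z in at 0. norm (f z) \<le> B" "\<forall>\<^sub>F z in at 0. norm (g z) \<le> C"
    by (auto simp: bounded_near0_def)
  then have "\<forall>\<^sub>F z in at 0. norm (f z * g z) \<le> \<bar>B\<bar> * \<bar>C\<bar>"
    by eventually_elim (unfold norm_mult, intro mult_mono, auto)
  then show ?thesis by (auto simp: bounded_near0_def)
qed

lemma bounded_near0_cont: "isCont f 0 \<Longrightarrow> bounded_near0 f"
proof -
  assume "isCont f 0"
  then have "((\<lambda>z. norm (f z)) \<longlongrightarrow> norm (f 0)) (at 0)" by (intro tendsto_norm) (simp add: isCont_def)
  then have "\<forall>\<^sub>F z in at 0. norm (f z) < norm (f 0) + 1" by (rule order_tendstoD) simp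
  then have "\<forall>\<^sub>F z in at 0. norm (f z) \<le> norm (f 0) + 1" by eventually_elim simp
  then show ?thesis by (auto simp: bounded_near0_def)
qed

text \<open>Differentiability at 0 alone bounds the quotient. Applied to v_z and \<phi>_z, it
  absorbs the pole 2\<eta>/z of u_z.\<close>

lemma bounded_near0_quotient:
  assumes g: "has_grad g gx gy 0" and "g 0 = 0"
  shows "bounded_near0 (\<lambda>z. g z / z)"
proof -
  obtain d where d: "d > 0" "\<And>y. norm y < d \<Longrightarrow> norm (g y - (Re y *\<^sub>R gx + Im y *\<^sub>R gy)) \<le> 1 * norm y"
  proof -
    have "\<forall>e>0. \<exists>d>0. \<forall>y. norm (y - 0) < d \<longrightarrow>
        norm (g y - g 0 - (Re (y - 0) *\<^sub>R gx + Im (y - 0) *\<^sub>R gy)) \<le> e * norm (y - 0)"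
      using g unfolding has_grad_def has_derivative_at_alt by (rule conjunct2)
    from this[rule_format, of 1] show thesis using that assms(2) by auto
  qed
  have "norm (g z / z) \<le> 1 + norm gx + norm gy" if z: "z \<noteq> 0" "norm z < d" for z
  proof -
    have "norm (Re z *\<^sub>R gx) \<le> norm z * norm gx" "norm (Im z *\<^sub>R gy) \<le> norm z * norm gy"
      by (auto intro!: mult_right_mono abs_Re_le_cmod abs_Im_le_cmod)
    then have "norm (g z) \<le> norm z + (norm z * norm gx + norm z * norm gy)"
      using d(2)[OF z(2)] norm_triangle_sub[of "g z" "Re z *\<^sub>R gx + Im z *\<^sub>R gy"]
        norm_triangle_ineq[of "Re z *\<^sub>R gx" "Im z *\<^sub>R gy"] by linarith
    also have "\<dots> = (1 + norm gx + norm gy) * norm z" by (simp add: algebra_simps)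
    finally show ?thesis using z(1) by (simp add: norm_divide pos_divide_le_eq)
  qed
  then have "\<forall>\<^sub>F z in at 0. norm (g z / z) \<le> 1 + norm gx + norm gy"
    unfolding eventually_at using d(1) by (intro exI[of _ d]) auto
  then show ?thesis by (auto simp: bounded_near0_def)
qed

lemma bounded_near0_extend:
  assumes "r > 0" "f holomorphic_on ball 0 r - {0}" "bounded_near0 f"
  obtains g where "g holomorphic_on ball 0 r" "\<And>z. z \<in> ball 0 r - {0} \<Longrightarrow> g z = f z"
proof -
  have "0 \<in> interior (ball 0 r :: complex set)" using assms(1) by (simp add: interior_open)
  then have "\<exists>g. g holomorphic_on ball 0 r \<and> (\<forall>z\<in>ball 0 r - {0}. g z = f z)"
    using holomorphic_on_extend_bounded[OF assms(2)] assms(3) unfolding bounded_near0_def by blast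
  then show thesis using that by blast
qed

lemma bounded_near0_transform:
  assumes "bounded_near0 f" "r > 0" "\<And>z. z \<in> ball 0 r - {0} \<Longrightarrow> f z = g z"
  shows "bounded_near0 g"
proof -
  obtain B where "\<forall>\<^sub>F z in at 0. norm (f z) \<le> B" using assms(1) by (auto simp: bounded_near0_def)
  moreover have "\<forall>\<^sub>F z in at 0. f z = g z"
    unfolding eventually_at using assms(2,3) by (intro exI[of _ r]) auto
  ultimately have "\<forall>\<^sub>F z in at 0. norm (g z) \<le> B" by eventually_elim simp
  then show ?thesis by (auto simp: bounded_near0_def)
qed

lemma isCont_Dz:
  assumes "open S" "Ck_on 2 S f" "z \<in> S"
  shows "isCont (Dz f) z" "isCont (Dzz f) z"
proof -
  show "isCont (Dz f) z"
    using has_grad_Dz[OF assms] unfolding has_grad_def by (rule has_derivative_continuous)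
  have "continuous_on S (Dzz f)"
    unfolding Dzz_def by (intro continuous_on_Complex continuous_intros Ck_on_2D(3)[OF assms(2,3)]) auto
  then show "isCont (Dzz f) z" using assms continuous_on_eq_continuous_at by blast
qed

text \<open>An even function is critical at 0. This is how the symmetry z -> -z provides the zeros
  of v_z and \<phi>_z at 0 needed to remove the simple poles.\<close>

lemma odd_Dz_at_0:
  assumes "open S" "Ck_on 2 S f" "0 \<in> S" "\<And>z. z \<in> S \<Longrightarrow> - z \<in> S \<and> f (- z) = f z"
  shows "Dz f 0 = 0"
proof -
  have m: "mirror (-1) (-1) 0 z = - z" for z by (simp add: mirror_def complex_eq_iff)
  have "Dz f (mirror (-1) (-1) 0 0) = Complex (-1 * Re (Dz f 0)) (-1 * Im (Dz f 0))"
    by (rule mirror_Dz(1)[OF assms(1,2) _ _ _ assms(3)]) (use assms(4) in \<open>auto simp: m\<close>)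
  then show ?thesis by (simp add: m complex_eq_iff)
qed

section \<open>Elliptic functions and propagation\<close>

lemma Ck_on_subset: "Ck_on k T f \<Longrightarrow> S \<subseteq> T \<Longrightarrow> Ck_on k S f"
  by (induction k arbitrary: f) (auto intro: continuous_on_subset)

lemma lattice_add: "b \<noteq> 0 \<Longrightarrow> z \<in> lattice b \<Longrightarrow> w \<in> lattice b \<Longrightarrow> z + w \<in> lattice b"
  by (auto simp: lattice_iff add_divide_distrib)

lemma lattice_minus: "b \<noteq> 0 \<Longrightarrow> - z \<in> lattice b \<longleftrightarrow> z \<in> lattice b"
  by (auto simp: lattice_iff minus_in_Ints_iff simp flip: minus_divide_left)

lemma lattice_cnj: "b \<noteq> 0 \<Longrightarrow> cnj z \<in> lattice b \<longleftrightarrow> z \<in> lattice b"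
  by (auto simp: lattice_iff minus_in_Ints_iff simp flip: minus_divide_left)

lemma lattice_add_iff: "b \<noteq> 0 \<Longrightarrow> w \<in> lattice b \<Longrightarrow> z + w \<in> lattice b \<longleftrightarrow> z \<in> lattice b"
  using lattice_add[of b z w] lattice_add[of b "z + w" "- w"] lattice_minus[of b w] by auto

lemma lattice_near_0:
  assumes "b > 0" "z \<in> lattice b" "norm z < min 1 b"
  shows "z = 0"
proof -
  have i: "Re z \<in> \<int>" "Im z / b \<in> \<int>" using assms by (auto simp: lattice_iff)
  have "\<bar>Re z\<bar> < 1" using abs_Re_le_cmod[of z] assms(3) by linarith
  moreover have "\<bar>Im z / b\<bar> < 1" using abs_Im_le_cmod[of z] assms(1,3) by (simp add: abs_divide)
  ultimately show ?thesis using i assms(1) Ints_nonzero_abs_less1[of "Re z"] Ints_nonzero_abs_less1[of "Im z / b"]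
    by (auto simp: complex_eq_iff)
qed

lemma lattice_reduce:
  assumes "b > 0"
  obtains w z' where "w \<in> lattice b" "z = z' + w" "0 \<le> Re z'" "Re z' \<le> 1" "0 \<le> Im z'" "Im z' \<le> b"
proof -
  define w where "w = Complex (of_int \<lfloor>Re z\<rfloor>) (b * of_int \<lfloor>Im z / b\<rfloor>)"
  have w: "w \<in> lattice b" using assms by (simp add: lattice_iff w_def)
  have re: "0 \<le> Re z - of_int \<lfloor>Re z\<rfloor>" "Re z - of_int \<lfloor>Re z\<rfloor> \<le> 1" by linarith+
  have "of_int \<lfloor>Im z / b\<rfloor> \<le> Im z / b" "Im z / b \<le> of_int \<lfloor>Im z / b\<rfloor> + 1" by linarith+
  then have "b * of_int \<lfloor>Im z / b\<rfloor> \<le> b * (Im z / b)" "b * (Im z / b) \<le> b * (of_int \<lfloor>Im z / b\<rfloor> + 1)"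
    using assms by (intro mult_left_mono; simp)+
  then have im: "0 \<le> Im z - b * of_int \<lfloor>Im z / b\<rfloor>" "Im z - b * of_int \<lfloor>Im z / b\<rfloor> \<le> b"
    using assms by (simp_all add: distrib_left)
  show thesis
    using that[of w "z - w"] w re im by (simp add: w_def)
qed

lemma elliptic_bounded_constant:
  assumes b: "b > 0" and L: "L holomorphic_on - lattice b"
    and per: "\<And>z w. z \<notin> lattice b \<Longrightarrow> w \<in> lattice b \<Longrightarrow> L (z + w) = L z"
    and r: "r > 0" "\<And>z. z \<in> lattice b \<Longrightarrow> norm z < r \<Longrightarrow> z = 0"
    and g: "g holomorphic_on ball 0 r" "\<And>z. z \<in> ball 0 r - {0} \<Longrightarrow> g z = L z"
  obtains c where "\<And>z. z \<notin> lattice b \<Longrightarrow> L z = c"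
proof -
  \<comment> \<open>\<open>L\<close> extends to an entire function \<open>G\<close> by putting
    \<open>g 0\<close> at every lattice point; periodicity transports the expansion at 0 to the
    other lattice points, and a period cell bounds \<open>G\<close>.\<close>
  have b0: "b \<noteq> 0" using b by simp
  have op: "open (- lattice b)" using closed_lattice[OF b0] by (simp add: open_Compl)
  define G where "G = (\<lambda>z. if z \<in> lattice b then g 0 else L z)"
  have Gper: "G (z + w) = G z" if "w \<in> lattice b" for z w
    using per[OF _ that] lattice_add_iff[OF b0 that] by (simp add: G_def)
  have "\<exists>f'. (G has_field_derivative f') (at z)" for z
  proof (cases "z \<in> lattice b")
    case False
    then obtain f' where "(L has_field_derivative f') (at z)" using L holomorphic_on_open[OF op] by blast
    then have "(G has_field_derivative f') (at z)"
      by (rule has_field_derivative_transform_within_open[OF _ op]) (use False in \<open>auto simp: G_def\<close>)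
    then show ?thesis ..
  next
    case True
    have mz: "- z \<in> lattice b" using True lattice_minus[OF b0] by simp
    have "0 \<in> ball 0 r" using r by simp
    then obtain f' where f': "(g has_field_derivative f') (at 0)" using g(1) holomorphic_on_open[OF open_ball] by blast
    have "((\<lambda>w. w - z) has_field_derivative 1) (at z)" by (auto intro!: derivative_eq_intros)
    moreover have "(g has_field_derivative f') (at (z - z))" using f' by simp
    ultimately have "((\<lambda>w. g (w - z)) has_field_derivative f' * 1) (at z)" by (rule DERIV_chain2[rotated])
    then have "(G has_field_derivative f' * 1) (at z)"
    proof (rule has_field_derivative_transform_within_open[OF _ open_ball])
      show "z \<in> ball z r" using r by simp
      fix w assume w: "w \<in> ball z r"
      have wz: "w - z \<in> ball 0 r" using w by (simp add: dist_norm norm_minus_commute)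
      show "g (w - z) = G w"
      proof (cases "w = z")
        case False
        then have "w - z \<notin> lattice b" using r(2)[of "w - z"] wz by auto
        then have "G (w - z) = g (w - z)" using g(2)[of "w - z"] wz False by (simp add: G_def)
        then show ?thesis using Gper[OF mz, of w] by simp
      qed (simp add: G_def True)
    qed
    then show ?thesis ..
  qed
  then have hol: "G holomorphic_on UNIV" by (simp add: holomorphic_on_open)
  have "compact (cbox 0 (Complex 1 b))" by simp
  then have "bounded (G ` cbox 0 (Complex 1 b))"
    using holomorphic_on_imp_continuous_on[OF holomorphic_on_subset[OF hol subset_UNIV]]
    by (intro compact_imp_bounded compact_continuous_image)
  moreover have "range G \<subseteq> G ` cbox 0 (Complex 1 b)"
  proof
    fix y assume "y \<in> range G"
    then obtain z where y: "y = G z" by blast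
    obtain w z' where w: "w \<in> lattice b" "z = z' + w" "0 \<le> Re z'" "Re z' \<le> 1" "0 \<le> Im z'" "Im z' \<le> b"
      using lattice_reduce[OF b] by blast
    then have "y = G z'" "z' \<in> cbox 0 (Complex 1 b)" using y Gper by (auto simp: in_cbox_complex_iff)
    then show "y \<in> G ` cbox 0 (Complex 1 b)" by blast
  qed
  ultimately have "bounded (range G)" by (rule bounded_subset)
  then obtain c where "\<And>z. G z = c" using Liouville_theorem[OF hol] by (auto simp: constant_on_def)
  then show thesis using that[of c] by (metis G_def)
qed

lemma axisymmetric_mirror:
  assumes per: "periodic_on b S f" and ax: "axisymmetric_on S f" and w: "w \<in> lattice b"
    and S: "\<And>z. z \<in> S \<Longrightarrow> - z \<in> S \<and> cnj z \<in> S \<and> z + w \<in> S"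
    and e: "e1 = 1 \<or> e1 = - 1" "e2 = 1 \<or> e2 = - 1" and z: "z \<in> S"
  shows "mirror e1 e2 w z \<in> S \<and> f (mirror e1 e2 w z) = f z"
proof -
  define y where "y = Complex (e1 * Re z) (e2 * Im z)"
  have "y = z \<or> y = - z \<or> y = cnj z \<or> y = - cnj z" using e by (auto simp: y_def complex_eq_iff)
  moreover have "- cnj z \<in> S" "f (- cnj z) = f z" "f (- z) = f z" "f (cnj z) = f z" "- z \<in> S" "cnj z \<in> S"
    using S z ax unfolding axisymmetric_on_def by metis+
  ultimately have "y \<in> S" "f y = f z" using z by auto
  then show ?thesis using S w per unfolding periodic_on_def mirror_def y_def[symmetric] by auto
qed

text \<open>The complex condition \<open>L0\<close> gives two real equations for the second
  derivatives of \<open>p\<close>, and the linearized equation gives their trace. Together they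
  express all second derivatives linearly through \<open>p\<close> and its gradient, so Gronwall
  applies along a segment.\<close>

lemma gradient_propagation:
  assumes S: "open S" and u: "Ck_on 2 S u" and p: "Ck_on 2 S p"
    and peq: "\<And>z. z \<in> S \<Longrightarrow> laplacian p z + exp (u z) * p z = 0"
    and L0: "\<And>z. z \<in> S \<Longrightarrow> Dzz p z = Dz u z * Dz p z"
    and seg: "\<And>t. t \<in> {0..1} \<Longrightarrow> a + of_real t * d \<in> S"
    and init: "p a = 0" "Dz p a = 0"
  shows "p (a + d) = 0"
proof -
  let ?z = "\<lambda>t. a + of_real t * d"
  define M where "M = (\<lambda>z. \<bar>dir_deriv 1 u z\<bar> + \<bar>dir_deriv \<i> u z\<bar> + exp (u z))"
  have cu: "continuous_on S u" "continuous_on S (dir_deriv 1 u)" "continuous_on S (dir_deriv \<i> u)"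
    by (rule has_grad_continuous_on, rule Ck_on_2D(1,2)[OF u], assumption)+
  have "continuous_on S M" unfolding M_def by (intro continuous_intros cu)
  then have "continuous_on {0..1} (\<lambda>t. M (?z t))"
    by (rule continuous_on_compose2) (use seg in \<open>auto intro!: continuous_intros\<close>)
  then have "bounded ((\<lambda>t. M (?z t)) ` {0..1})"
    by (intro compact_imp_bounded compact_continuous_image) auto
  then obtain B where B: "\<And>t. t \<in> {0..1} \<Longrightarrow> \<bar>M (?z t)\<bar> \<le> B" unfolding bounded_iff by force
  define E where "E = (\<lambda>z. (p z)\<^sup>2 + (dir_deriv 1 p z)\<^sup>2 + (dir_deriv \<i> p z)\<^sup>2)"
  have "E (?z 1) = 0"
  proof (rule gronwall_zero[where e = "\<lambda>t. E (?z t)" and a = 0 and b = 1 and ?t0.0 = 0 and K = "16 * norm d * (1 + B)"])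
    fix t :: real assume t: "t \<in> {0..1}"
    let ?w = "?z t"
    note w = seg[OF t]
    let ?x = "p ?w" and ?y = "dir_deriv 1 p ?w" and ?v = "dir_deriv \<i> p ?w"
    let ?pxx = "dir_deriv 1 (dir_deriv 1 p) ?w" and ?pxy = "dir_deriv \<i> (dir_deriv 1 p) ?w" and ?pyy = "dir_deriv \<i> (dir_deriv \<i> p) ?w"
    let ?ux = "dir_deriv 1 u ?w" and ?uy = "dir_deriv \<i> u ?w"
    have d1: "((\<lambda>t. p (?z t)) has_real_derivative Re d * ?y + Im d * ?v) (at t)"
      using has_grad_line[OF Ck_on_2D(1)[OF p w]] by (simp add: has_real_derivative_iff_has_vector_derivative)
    have d2: "((\<lambda>t. dir_deriv 1 p (?z t)) has_real_derivative Re d * ?pxx + Im d * ?pxy) (at t)"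
      using has_grad_line[OF Ck_on_2D(2)[OF p w, of 1]] by (simp add: has_real_derivative_iff_has_vector_derivative)
    have d3: "((\<lambda>t. dir_deriv \<i> p (?z t)) has_real_derivative Re d * ?pxy + Im d * ?pyy) (at t)"
      using has_grad_line[OF Ck_on_2D(2)[OF p w, of \<i>]]
      by (simp add: has_real_derivative_iff_has_vector_derivative mixed_dir_deriv_commute[OF S p w])
    define E' where "E' = 2 * ?x * (Re d * ?y + Im d * ?v) + 2 * ?y * (Re d * ?pxx + Im d * ?pxy) + 2 * ?v * (Re d * ?pxy + Im d * ?pyy)"
    show "((\<lambda>t. E (?z t)) has_real_derivative (\<lambda>t. 2 * p (?z t) * (Re d * dir_deriv 1 p (?z t) + Im d * dir_deriv \<i> p (?z t))
        + 2 * dir_deriv 1 p (?z t) * (Re d * dir_deriv 1 (dir_deriv 1 p) (?z t) + Im d * dir_deriv \<i> (dir_deriv 1 p) (?z t))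
        + 2 * dir_deriv \<i> p (?z t) * (Re d * dir_deriv \<i> (dir_deriv 1 p) (?z t) + Im d * dir_deriv \<i> (dir_deriv \<i> p) (?z t))) t) (at t)"
      unfolding E_def by (auto intro!: derivative_eq_intros d1 d2 d3)
    have s: "?pxx + ?pyy = - exp (u ?w) * ?x" using peq[OF w] by (simp add: laplacian_def)
    \<comment> \<open>Real and imaginary parts of \<open>L0\<close>. With \<open>s\<close> they
      determine \<open>?pxx\<close>, \<open>?pxy\<close> and \<open>?pyy\<close> separately.\<close>
    have l: "?pxx - ?pyy = ?ux * ?y - ?uy * ?v" "2 * ?pxy = ?ux * ?v + ?uy * ?y"
      using L0[OF w] by (simp_all add: Dzz_def Dz_def complex_eq_iff field_simps)
    define N where "N = sqrt (E ?w)"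
    have EN: "E ?w = N * N" and N0: "N \<ge> 0" by (simp_all add: N_def E_def)
    have xN: "\<bar>?x\<bar> \<le> N" "\<bar>?y\<bar> \<le> N" "\<bar>?v\<bar> \<le> N"
      unfolding N_def E_def by (auto intro!: real_le_rsqrt)
    have MB: "\<bar>?ux\<bar> \<le> B" "\<bar>?uy\<bar> \<le> B" "exp (u ?w) \<le> B" "0 \<le> B"
      using B[OF t] exp_gt_zero[of "u ?w"] unfolding M_def by linarith+
    have prod: "\<bar>c * x\<bar> \<le> B * N" if "\<bar>c\<bar> \<le> B" "\<bar>x\<bar> \<le> N" for c x
      unfolding abs_mult using that MB by (intro mult_mono) auto
    have b: "\<bar>?ux * ?y\<bar> \<le> B * N" "\<bar>?uy * ?v\<bar> \<le> B * N" "\<bar>?ux * ?v\<bar> \<le> B * N" "\<bar>?uy * ?y\<bar> \<le> B * N" "\<bar>exp (u ?w) * ?x\<bar> \<le> B * N"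
      using MB xN by (auto intro!: prod)
    have s2: "\<bar>?pxx\<bar> \<le> 2 * (B * N)" "\<bar>?pxy\<bar> \<le> 2 * (B * N)" "\<bar>?pyy\<bar> \<le> 2 * (B * N)"
      using b s l by linarith+
    have dd: "\<bar>Re d * x + Im d * y\<bar> \<le> 2 * norm d * c" if "\<bar>x\<bar> \<le> c" "\<bar>y\<bar> \<le> c" for x y c
    proof -
      have "\<bar>Re d * x\<bar> \<le> norm d * c" "\<bar>Im d * y\<bar> \<le> norm d * c"
        unfolding abs_mult using that abs_Re_le_cmod[of d] abs_Im_le_cmod[of d] by (auto intro!: mult_mono)
      then show ?thesis by linarith
    qed
    have tm: "\<bar>2 * x * y\<bar> \<le> 2 * (N * (2 * norm d * c))" if "\<bar>x\<bar> \<le> N" "\<bar>y\<bar> \<le> 2 * norm d * c" for x y c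
    proof -
      have "\<bar>x\<bar> * \<bar>y\<bar> \<le> N * (2 * norm d * c)" using that N0 by (intro mult_mono) auto
      moreover have "\<bar>2 * x * y\<bar> = 2 * (\<bar>x\<bar> * \<bar>y\<bar>)" by (simp add: abs_mult)
      ultimately show ?thesis by linarith
    qed
    have "\<bar>E'\<bar> \<le> 2 * (N * (2 * norm d * N)) + 2 * (N * (2 * norm d * (2 * (B * N)))) + 2 * (N * (2 * norm d * (2 * (B * N))))"
      unfolding E'_def
      using tm[OF xN(1) dd[OF xN(2,3)]] tm[OF xN(2) dd[OF s2(1,2)]] tm[OF xN(3) dd[OF s2(2,3)]] by linarith
    also have "\<dots> = norm d * (4 + 16 * B) * (N * N)" by (simp add: algebra_simps)
    also have "\<dots> \<le> 16 * norm d * (1 + B) * E ?w"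
      unfolding EN using MB(4) by (intro mult_right_mono) (auto simp: algebra_simps)
    finally show "\<bar>(\<lambda>t. 2 * p (?z t) * (Re d * dir_deriv 1 p (?z t) + Im d * dir_deriv \<i> p (?z t))
        + 2 * dir_deriv 1 p (?z t) * (Re d * dir_deriv 1 (dir_deriv 1 p) (?z t) + Im d * dir_deriv \<i> (dir_deriv 1 p) (?z t))
        + 2 * dir_deriv \<i> p (?z t) * (Re d * dir_deriv \<i> (dir_deriv 1 p) (?z t) + Im d * dir_deriv \<i> (dir_deriv \<i> p) (?z t))) t\<bar> \<le> 16 * norm d * (1 + B) * E ?w"
      unfolding E'_def .
    show "0 \<le> E ?w" by (simp add: E_def)
  next
    show "E (?z 0) = 0" using init by (simp add: E_def Dz_def complex_eq_iff)
  qed auto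
  moreover have "(p (a + d))\<^sup>2 \<le> E (a + d)" by (simp add: E_def)
  ultimately show ?thesis by simp
qed

section \<open>Nondegeneracy\<close>

definition potential :: "(complex \<Rightarrow> real) \<Rightarrow> complex \<Rightarrow> complex" where
  "potential u z = (Dz u z)\<^sup>2 / 4 - Dzz u z / 2"

definition lin_potential :: "(complex \<Rightarrow> real) \<Rightarrow> (complex \<Rightarrow> real) \<Rightarrow> complex \<Rightarrow> complex" where
  "lin_potential u p z = Dzz p z - Dz u z * Dz p z"

lemma potential_mirror:
  assumes S: "open S" and u: "Ck_on 2 S u" and e: "e1 * e1 = 1" "e2 * e2 = (1 :: real)"
    and sym: "\<And>z. z \<in> S \<Longrightarrow> mirror e1 e2 w z \<in> S \<and> u (mirror e1 e2 w z) = u z" and z: "z \<in> S"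
  shows "potential u (mirror e1 e2 w z) = Complex (Re (potential u z)) (e1 * e2 * Im (potential u z))"
proof -
  have "e1\<^sup>2 = 1" "e2\<^sup>2 = 1" using e by (simp_all add: power2_eq_square)
  then show ?thesis
    unfolding potential_def
    by (simp only: mirror_Dz[OF S u e sym z]) (simp add: complex_eq_iff Re_power2 Im_power2 power_mult_distrib algebra_simps diff_divide_distrib)
qed

lemma lin_potential_mirror:
  assumes S: "open S" and u: "Ck_on 2 S u" and p: "Ck_on 2 S p" and e: "e1 * e1 = 1" "e2 * e2 = (1 :: real)"
    and symu: "\<And>z. z \<in> S \<Longrightarrow> mirror e1 e2 w z \<in> S \<and> u (mirror e1 e2 w z) = u z"
    and symp: "\<And>z. z \<in> S \<Longrightarrow> mirror e1 e2 w z \<in> S \<and> p (mirror e1 e2 w z) = p z" and z: "z \<in> S"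
  shows "lin_potential u p (mirror e1 e2 w z) = Complex (Re (lin_potential u p z)) (e1 * e2 * Im (lin_potential u p z))"
proof -
  have e': "e1 * (e1 * x) = x" "e2 * (e2 * x) = x" for x
    using e by (simp_all flip: mult.assoc)
  show ?thesis
    unfolding lin_potential_def
    by (simp only: mirror_Dz[OF S u e symu z] mirror_Dz[OF S p e symp z]) (simp add: complex_eq_iff e' algebra_simps)
qed

text \<open>The symmetries act in three places: evenness removes the simple poles of
  \<open>Q\<close> and \<open>L\<close> at 0; the reflections make \<open>Q\<close> real on the
  edges, make the constant value of \<open>L\<close> real and give the Neumann conditions at the
  ends of the edges; and they make the center a critical point of \<open>p\<close>, from which zero
  data propagate.\<close>

lemma axisymmetric_kernel_trivial:
  fixes b \<eta> :: real and u v p :: "complex \<Rightarrow> real"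
  assumes b: "b > 0" and \<eta>: "\<eta> > 0" "sin (pi * \<eta>) \<noteq> 0"
    and u: "Ck_on 2 (- lattice b) u" "periodic_on b (- lattice b) u" "axisymmetric_on (- lattice b) u"
    and ueq: "\<And>z. z \<notin> lattice b \<Longrightarrow> laplacian u z + exp (u z) = 0"
    and v: "r0 > 0" "Ck_on 2 (ball 0 r0) v" "\<And>z. z \<in> ball 0 r0 - {0} \<Longrightarrow> u z = 4 * \<eta> * ln (norm z) + v z"
    and p: "Ck_on 2 UNIV p" "periodic_on b UNIV p" "axisymmetric_on UNIV p"
    and peq: "\<And>z. z \<notin> lattice b \<Longrightarrow> laplacian p z + exp (u z) * p z = 0"
  shows "p z = 0"
proof -
  have b0: "b \<noteq> 0" using b by simp
  define S where "S = - lattice b"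
  have S: "open S" using closed_lattice[OF b0] by (simp add: open_Compl S_def)
  have uS: "Ck_on 2 S u" using u(1) by (simp add: S_def)
  have pS: "Ck_on 2 S p" using p(1) by (rule Ck_on_subset) simp
  have eqS: "laplacian u z + exp (u z) = 0" "laplacian p z + exp (u z) * p z = 0" if "z \<in> S" for z
    using ueq peq that by (auto simp: S_def)
  have lap: "dir_deriv \<i> (dir_deriv \<i> u) z = - exp (u z) - dir_deriv 1 (dir_deriv 1 u) z"
    "dir_deriv \<i> (dir_deriv \<i> p) z = - exp (u z) * p z - dir_deriv 1 (dir_deriv 1 p) z" if "z \<in> S" for z
    using eqS[OF that] by (simp_all add: laplacian_def)
  define Q where "Q = potential u"
  define L where "L = lin_potential u p"
  have Qh: "Q holomorphic_on S"
    unfolding Q_def potential_def[abs_def] by (rule liouville_potential_holomorphic[OF S uS eqS(1)])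
  have Lh: "L holomorphic_on S"
    unfolding L_def lin_potential_def[abs_def] by (rule linearized_potential_holomorphic[OF S uS eqS(1) pS eqS(2)])
  have symu: "mirror e1 e2 w z \<in> S \<and> u (mirror e1 e2 w z) = u z"
    and symp: "mirror e1 e2 w z \<in> S \<and> p (mirror e1 e2 w z) = p z"
    if e: "e1 = 1 \<or> e1 = - 1" "e2 = 1 \<or> e2 = - 1" and w: "w \<in> lattice b" and z: "z \<in> S" for e1 e2 w z
  proof -
    show 1: "mirror e1 e2 w z \<in> S \<and> u (mirror e1 e2 w z) = u z"
      unfolding S_def
      by (rule axisymmetric_mirror[OF u(2,3) w _ e])
         (use z lattice_minus[OF b0] lattice_cnj[OF b0] lattice_add_iff[OF b0 w] in \<open>auto simp: S_def\<close>)
    have "mirror e1 e2 w z \<in> UNIV \<and> p (mirror e1 e2 w z) = p z"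
      by (rule axisymmetric_mirror[OF p(2,3) w _ e]) auto
    then show "mirror e1 e2 w z \<in> S \<and> p (mirror e1 e2 w z) = p z" using 1 by blast
  qed
  have sq: "e * e = 1" if "e = 1 \<or> e = - 1" for e :: real using that by auto
  have Qm: "Q (mirror e1 e2 w z) = Complex (Re (Q z)) (e1 * e2 * Im (Q z))"
    and Lm: "L (mirror e1 e2 w z) = Complex (Re (L z)) (e1 * e2 * Im (L z))"
    if "e1 = 1 \<or> e1 = - 1" "e2 = 1 \<or> e2 = - 1" "w \<in> lattice b" "z \<in> S" for e1 e2 w z
    unfolding Q_def L_def
    using potential_mirror[OF S uS sq[OF that(1)] sq[OF that(2)] symu[OF that(1-3)] that(4)]
      lin_potential_mirror[OF S uS pS sq[OF that(1)] sq[OF that(2)] symu[OF that(1-3)] symp[OF that(1-3)] that(4)] by blast+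
  have lat: "0 \<in> lattice b" "1 \<in> lattice b" "\<i> * of_real b \<in> lattice b" using b by (simp_all add: lattice_iff)
  have vert: "dir_deriv 1 u z = 0" "dir_deriv 1 p z = 0" "Im (Q z) = 0" "Im (L z) = 0"
    if z: "z \<in> S" "Re z = 0 \<or> Re z = 1/2" for z
  proof -
    \<comment> \<open>The map z -> -cnj z + 2 Re z is a symmetry when 2 Re z is a lattice point, and
      it fixes the vertical line through z; quantities that are odd under it vanish there.\<close>
    have "2 * Re z = 0 \<or> 2 * Re z = 1" using z(2) by linarith
    then have "2 * Re z \<in> \<int>" by (metis Ints_0 Ints_1)
    then have w: "of_real (2 * Re z) \<in> lattice b" by (simp add: lattice_iff[OF b0])
    have m: "mirror (- 1) 1 (of_real (2 * Re z)) z = z" by (simp add: mirror_def complex_eq_iff)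
    show "dir_deriv 1 u z = 0" "dir_deriv 1 p z = 0"
      using mirror_derivatives(1)[OF S uS _ _ symu[OF _ _ w] z(1), of "- 1" 1]
        mirror_derivatives(1)[OF S pS _ _ symp[OF _ _ w] z(1), of "- 1" 1] unfolding m by simp_all
    show "Im (Q z) = 0" "Im (L z) = 0"
      using arg_cong[OF Qm[OF _ _ w z(1), of "- 1" 1], of Im] arg_cong[OF Lm[OF _ _ w z(1), of "- 1" 1], of Im]
      unfolding m by simp_all
  qed
  have hor: "dir_deriv \<i> u z = 0" "dir_deriv \<i> p z = 0" "Im (Q z) = 0"
    if z: "z \<in> S" "Im z = 0 \<or> Im z = b/2" for z
  proof -
    have "2 * Im z / b = 0 \<or> 2 * Im z / b = 1" using z(2) b by auto
    then have "2 * Im z / b \<in> \<int>" by (metis Ints_0 Ints_1)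
    then have w: "\<i> * of_real (2 * Im z) \<in> lattice b" by (simp add: lattice_iff[OF b0])
    have m: "mirror 1 (- 1) (\<i> * of_real (2 * Im z)) z = z" by (simp add: mirror_def complex_eq_iff)
    show "dir_deriv \<i> u z = 0" "dir_deriv \<i> p z = 0"
      using mirror_derivatives(2)[OF S uS _ _ symu[OF _ _ w] z(1), of 1 "- 1"]
        mirror_derivatives(2)[OF S pS _ _ symp[OF _ _ w] z(1), of 1 "- 1"] unfolding m by simp_all
    show "Im (Q z) = 0"
      using arg_cong[OF Qm[OF _ _ w z(1), of 1 "- 1"], of Im] unfolding m by simp
  qed
  define r where "r = min r0 (min 1 b)"
  have r: "r > 0" "r \<le> r0" using v(1) b by (auto simp: r_def)
  have rl: "z = 0" if "z \<in> lattice b" "norm z < r" for z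
    by (rule lattice_near_0[OF b that(1)]) (use that(2) in \<open>simp add: r_def\<close>)
  define S0 where "S0 = ball (0 :: complex) r - {0}"
  have S0: "open S0" "0 \<notin> S0" "S0 \<subseteq> ball 0 r" "S0 \<subseteq> S"
    using rl by (auto simp: S0_def S_def open_Diff)
  have vr: "Ck_on 2 (ball 0 r) v" by (rule Ck_on_subset[OF v(2)]) (use r in auto)
  have uv: "u z = 4 * \<eta> * ln (norm z) + v z" if "z \<in> S0" for z
    by (rule v(3)) (use that r in \<open>auto simp: S0_def\<close>)
  have lsd: "Dz u z = of_real (2 * \<eta>) / z + Dz v z" "Dzz u z = - of_real (2 * \<eta>) / z\<^sup>2 + Dzz v z" if "z \<in> S0" for z
    using log_singularity_derivatives[OF S0(1,2) Ck_on_subset[OF uS S0(4)] S0(3) open_ball vr uv that] by blast+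
  have b0r: "0 \<in> ball (0 :: complex) r" using r by simp
  have Dv0: "Dz v 0 = 0"
  proof (rule odd_Dz_at_0[OF open_ball vr b0r])
    fix z assume z: "z \<in> ball (0 :: complex) r"
    have "v (- z) = v z"
    proof (cases "z = 0")
      case False
      then have z0: "z \<in> S0" "- z \<in> S0" using z by (auto simp: S0_def)
      have "u (- z) = u z" using u(3) z0 S0(4) unfolding axisymmetric_on_def S_def by auto
      then show ?thesis using uv[OF z0(1)] uv[OF z0(2)] by simp
    qed simp
    then show "- z \<in> ball 0 r \<and> v (- z) = v z" using z by simp
  qed
  have Dp0: "Dz p 0 = 0"
    by (rule odd_Dz_at_0[OF open_UNIV p(1)]) (use p(3) in \<open>auto simp: axisymmetric_on_def\<close>)
  have bDv: "bounded_near0 (Dz v)" "bounded_near0 (Dzz v)" "bounded_near0 (Dz p)" "bounded_near0 (Dzz p)"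
    using isCont_Dz[OF open_ball vr b0r] isCont_Dz[OF open_UNIV p(1) UNIV_I] by (auto intro: bounded_near0_cont)
  have bc: "bounded_near0 (\<lambda>z. k)" for k by (rule bounded_near0_cont) simp
  have bq: "bounded_near0 (\<lambda>z. Dz v z / z)" "bounded_near0 (\<lambda>z. Dz p z / z)"
    by (rule bounded_near0_quotient[OF has_grad_Dz[OF open_ball vr b0r] Dv0],
        rule bounded_near0_quotient[OF has_grad_Dz[OF open_UNIV p(1) UNIV_I] Dp0])
  \<comment> \<open>The leading coefficient of \<open>Q\<close> is \<eta>(\<eta>+1)/z^2, with
    exponents \<eta> + 1 and -\<eta>. The larger one is taken, since its recursion never divides by
    zero.\<close>
  define \<kappa> where "\<kappa> = \<eta> + 1"
  define Qr where "Qr = (\<lambda>z. Q z - of_real (\<kappa> * (\<kappa> - 1)) / z\<^sup>2)"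
  have Qrh: "Qr holomorphic_on S0"
    unfolding Qr_def using S0 by (intro holomorphic_intros holomorphic_on_subset[OF Qh]) auto
  have "bounded_near0 Qr"
  proof (rule bounded_near0_transform[OF _ r(1)])
    \<comment> \<open>With u_z = 2\<eta>/z + v_z the double poles add up to \<eta>^2 + \<eta> and
      cancel in \<open>Qr\<close>; the cross term \<eta> v_z/z is bounded because v_z vanishes at
      0.\<close>
    show "bounded_near0 (\<lambda>z. (of_real \<eta> * (Dz v z / z) + (1/4) * (Dz v z * Dz v z)) + (- 1/2) * Dzz v z)"
      by (intro bounded_near0_add bounded_near0_mult bc bq bDv)
    fix z :: complex assume "z \<in> ball 0 r - {0}"
    then have z: "z \<in> S0" "z \<noteq> 0" by (auto simp: S0_def)
    show "(of_real \<eta> * (Dz v z / z) + (1/4) * (Dz v z * Dz v z)) + (- 1/2) * Dzz v z = Qr z"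
      unfolding Qr_def Q_def potential_def lsd[OF z(1)] \<kappa>_def
      using z(2) by (simp add: field_simps power2_eq_square)
  qed
  then obtain g where g: "g holomorphic_on ball 0 r" "\<And>z. z \<in> ball 0 r - {0} \<Longrightarrow> g z = Qr z"
    using bounded_near0_extend[OF r(1)] Qrh unfolding S0_def by blast
  have gev: "g (- z) = g z" if z: "z \<in> ball 0 r" for z :: complex
  proof (cases "z = 0")
    case False
    have m: "mirror (- 1) (- 1) 0 z = - z" by (simp add: mirror_def complex_eq_iff)
    have "z \<in> S" using z False S0 by (auto simp: S0_def)
    then have "Q (- z) = Q z" using Qm[of "- 1" "- 1" 0 z] lat by (simp add: m)
    then show ?thesis using g(2)[of z] g(2)[of "- z"] z False by (simp add: Qr_def)
  qed simp
  have gcnj': "g (cnj z) = cnj (g z)" if z: "z \<in> ball 0 r - {0}" for z :: complex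
  proof -
    have m: "mirror 1 (- 1) 0 z = cnj z" by (simp add: mirror_def complex_eq_iff)
    have "z \<in> S" using z S0 by (auto simp: S0_def)
    then have "Q (cnj z) = cnj (Q z)" using Qm[of 1 "- 1" 0 z] lat by (simp add: m complex_eq_iff)
    then show ?thesis using g(2)[of z] g(2)[of "cnj z"] z by (simp add: Qr_def)
  qed
  have gcnj: "g (cnj z) = cnj (g z)" if z: "z \<in> ball 0 r" for z :: complex
  proof (cases "z = 0")
    case True
    \<comment> \<open>At 0 the value of \<open>g\<close> is only known as a limit, so the
      conjugation symmetry passes there by continuity.\<close>
    have gc: "isCont g 0"
      using holomorphic_on_imp_continuous_on[OF g(1)] b0r continuous_on_eq_continuous_at[OF open_ball] by blast
    have "isCont cnj 0" by (rule linear_continuous_at) (rule bounded_linear_cnj)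
    then have c1: "isCont (\<lambda>z. g (cnj z)) 0" by (rule isCont_o2) (simp add: gc)
    have c2: "isCont (\<lambda>z. cnj (g z)) 0" by (intro continuous_intros gc)
    have "\<forall>\<^sub>F z in at 0. g (cnj z) = cnj (g z)"
      unfolding eventually_at using r gcnj' by (intro exI[of _ r]) auto
    moreover have "((\<lambda>z. g (cnj z)) \<longlongrightarrow> g (cnj 0)) (at 0)" using c1 by (simp add: isCont_def)
    ultimately have "((\<lambda>z. cnj (g z)) \<longlongrightarrow> g (cnj 0)) (at 0)" by (rule Lim_transform_eventually[rotated])
    then have "g (cnj 0) = cnj (g 0)" using c2 LIM_unique unfolding isCont_def by blast
    then show ?thesis using True by simp
  qed (use gcnj' z in auto)
  obtain a M where a: "\<And>k. \<bar>a k\<bar> \<le> M / ((r / 2)\<^sup>2) ^ k"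
    "\<And>z. norm z < r \<Longrightarrow> (\<lambda>k. of_real (a k) * (z\<^sup>2) ^ k) sums g z"
    using even_real_expansion[OF r(1) g(1) gev gcnj] by blast
  have Q0: "Q z = of_real (\<kappa> * (\<kappa> - 1)) / z\<^sup>2 + eval_fps (rps a) (z\<^sup>2)"
    if z: "z \<noteq> 0" "norm (z\<^sup>2) < (r/2)\<^sup>2" for z
  proof -
    have "(norm z)\<^sup>2 < (r/2)\<^sup>2" using z(2) by (simp add: norm_power)
    then have "norm z < r/2" by (rule power2_less_imp_less) (use r(1) in simp)
    then have zr: "norm z < r" using r(1) by linarith
    have "eval_fps (rps a) (z\<^sup>2) = g z" unfolding eval_fps_def rps_nth using a(2)[OF zr] by (rule sums_unique[symmetric])
    then show ?thesis using g(2)[of z] z(1) zr by (simp add: Qr_def)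
  qed
  have "bounded_near0 L"
  proof (rule bounded_near0_transform[OF _ r(1)])
    show "bounded_near0 (\<lambda>z. (Dzz p z + (- of_real (2 * \<eta>)) * (Dz p z / z)) + (- 1) * (Dz v z * Dz p z))"
      by (intro bounded_near0_add bounded_near0_mult bc bq bDv)
    fix z :: complex assume "z \<in> ball 0 r - {0}"
    then have z: "z \<in> S0" "z \<noteq> 0" by (auto simp: S0_def)
    show "(Dzz p z + (- of_real (2 * \<eta>)) * (Dz p z / z)) + (- 1) * (Dz v z * Dz p z) = L z"
      unfolding L_def lin_potential_def lsd[OF z(1)] using z(2) by (simp add: field_simps)
  qed
  moreover have "L holomorphic_on ball 0 r - {0}" using holomorphic_on_subset[OF Lh S0(4)] by (simp add: S0_def)
  ultimately obtain gL where gL: "gL holomorphic_on ball 0 r" "\<And>z. z \<in> ball 0 r - {0} \<Longrightarrow> gL z = L z"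
    using bounded_near0_extend[OF r(1)] by blast
  have Lper: "L (z + w) = L z" if "z \<notin> lattice b" "w \<in> lattice b" for z w
  proof -
    have "mirror 1 1 w z = z + w" by (simp add: mirror_def)
    then show ?thesis using Lm[of 1 1 w z] that by (simp add: S_def)
  qed
  obtain c where c: "\<And>z. z \<notin> lattice b \<Longrightarrow> L z = c"
    using elliptic_bounded_constant[OF b Lh[unfolded S_def] Lper r(1) rl gL] by blast
  have cS: "L z = c" if "z \<in> S" for z using c that by (simp add: S_def)
  define m where "m = Complex (1/2) (b/2)"
  have notint: "(1/2 :: real) \<notin> \<int>" using fraction_not_in_Ints[of 2 1] by simp
  have top_in: "m + of_real t * (- 1) \<in> S" and right_in: "m + of_real t * (- \<i>) \<in> S" for t
    using b notint by (auto simp: S_def lattice_iff m_def)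
  have mS: "m \<in> S" using top_in[of 0] by simp
  have creal: "Im c = 0" using vert(4)[OF mS] cS[OF mS] by (simp add: m_def)
  \<comment> \<open>Replacing u by u + t s p moves \<open>Q\<close> at the rate -s c/2, and s = -2/c
    makes this rate 1. If c = 0 the potential does not move, and any nonzero \<open>s\<close> keeps
    the information on \<open>p m\<close>.\<close>
  define s \<epsilon> where "s = (if c = 0 then 1 else - 2 / Re c)" and "\<epsilon> = (if c = 0 then 0 else 1 :: real)"
  have s: "s \<noteq> 0" "s * (4 * Re c) = - 8 * \<epsilon>"
  proof -
    have "Re c \<noteq> 0" if "c \<noteq> 0" using that creal by (metis complex_eq_iff zero_complex.sel)
    then show "s \<noteq> 0" "s * (4 * Re c) = - 8 * \<epsilon>"
      unfolding s_def \<epsilon>_def by (cases "c = 0"; simp)+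
  qed
  have rd: "((\<lambda>t. f (q + of_real t * d)) has_real_derivative (Re d * fx + Im d * fy)) (at t)"
    if "has_grad f fx fy (q + of_real t * d)" for f :: "complex \<Rightarrow> real" and fx fy q d t
    using has_grad_line[OF that] by (simp add: has_real_derivative_iff_has_vector_derivative)
  have Lre: "4 * Re (L z) = dir_deriv 1 (dir_deriv 1 p) z - dir_deriv \<i> (dir_deriv \<i> p) z
      - dir_deriv 1 u z * dir_deriv 1 p z + dir_deriv \<i> u z * dir_deriv \<i> p z" for z
    by (simp add: L_def lin_potential_def Dz_def Dzz_def field_simps)
  have Qre: "Re (Q z) = ((dir_deriv 1 u z)\<^sup>2 - (dir_deriv \<i> u z)\<^sup>2) / 16
      - (dir_deriv 1 (dir_deriv 1 u) z - dir_deriv \<i> (dir_deriv \<i> u) z) / 8" for z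
    by (simp add: Q_def potential_def Dz_def Dzz_def Re_power2 field_simps power2_eq_square)
  have top: "edge_data (1/2) (\<lambda>t. Re (Q (m - of_real t))) \<epsilon> (u m) (s * p m)"
    unfolding edge_data_def
  proof (intro exI conjI ballI)
    fix t :: real assume t: "t \<in> {0..1/2}"
    let ?z = "m + of_real t * (- 1)"
    note z = top_in[of t]
    have hz: "Im ?z = 0 \<or> Im ?z = b/2" by (simp add: m_def)
    show "((\<lambda>t. u (m + of_real t * (- 1))) has_real_derivative (\<lambda>t. - dir_deriv 1 u (m + of_real t * (- 1))) t) (at t)"
      using rd[OF Ck_on_2D(1)[OF uS z]] by simp
    show "((\<lambda>t. - dir_deriv 1 u (m + of_real t * (- 1))) has_real_derivative (\<lambda>t. dir_deriv 1 (dir_deriv 1 u) (m + of_real t * (- 1))) t) (at t)"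
      using DERIV_minus[OF rd[OF Ck_on_2D(2)[OF uS z, of 1]]] by simp
    show "((\<lambda>t. s * p (m + of_real t * (- 1))) has_real_derivative (\<lambda>t. - s * dir_deriv 1 p (m + of_real t * (- 1))) t) (at t)"
      using DERIV_cmult[OF rd[OF Ck_on_2D(1)[OF pS z]], of s] by simp
    show "((\<lambda>t. - s * dir_deriv 1 p (m + of_real t * (- 1))) has_real_derivative (\<lambda>t. s * dir_deriv 1 (dir_deriv 1 p) (m + of_real t * (- 1))) t) (at t)"
      using DERIV_cmult[OF rd[OF Ck_on_2D(2)[OF pS z, of 1]], of "- s"] by simp
    have "Re (Q ?z) = (dir_deriv 1 u ?z)\<^sup>2 / 16 - dir_deriv 1 (dir_deriv 1 u) ?z / 4 - exp (u ?z) / 8"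
      unfolding Qre lap(1)[OF z] hor(1)[OF z hz] by (simp add: field_simps)
    then show "Re (Q (m - of_real t)) = (- dir_deriv 1 u ?z)\<^sup>2 / 16 - dir_deriv 1 (dir_deriv 1 u) ?z / 4 - exp (u ?z) / 8"
      by simp
    have "4 * Re c = 2 * dir_deriv 1 (dir_deriv 1 p) ?z - dir_deriv 1 u ?z * dir_deriv 1 p ?z + exp (u ?z) * p ?z"
      unfolding cS[OF z, symmetric] Lre lap(2)[OF z] hor(1,2)[OF z hz] by simp
    then have "s * (4 * Re c) = s * (2 * dir_deriv 1 (dir_deriv 1 p) ?z - dir_deriv 1 u ?z * dir_deriv 1 p ?z + exp (u ?z) * p ?z)"
      by simp
    then show "2 * (s * dir_deriv 1 (dir_deriv 1 p) ?z) - (- dir_deriv 1 u ?z) * (- s * dir_deriv 1 p ?z) + exp (u ?z) * (s * p ?z) = - 8 * \<epsilon>"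
      unfolding s(2) by (simp add: algebra_simps)
  qed (use vert(1,2)[OF top_in[of 0]] vert(1,2)[OF top_in[of "1/2"]] in \<open>simp_all add: m_def\<close>)
  have right: "edge_data (b/2) (\<lambda>t. - Re (Q (m - \<i> * of_real t))) (- \<epsilon>) (u m) (s * p m)"
    unfolding edge_data_def
  proof (intro exI conjI ballI)
    fix t :: real assume t: "t \<in> {0..b/2}"
    let ?z = "m + of_real t * (- \<i>)"
    note z = right_in[of t]
    have hz: "Re ?z = 0 \<or> Re ?z = 1/2" by (simp add: m_def)
    show "((\<lambda>t. u (m + of_real t * (- \<i>))) has_real_derivative (\<lambda>t. - dir_deriv \<i> u (m + of_real t * (- \<i>))) t) (at t)"
      using rd[OF Ck_on_2D(1)[OF uS z]] by simp
    show "((\<lambda>t. - dir_deriv \<i> u (m + of_real t * (- \<i>))) has_real_derivative (\<lambda>t. dir_deriv \<i> (dir_deriv \<i> u) (m + of_real t * (- \<i>))) t) (at t)"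
      using DERIV_minus[OF rd[OF Ck_on_2D(2)[OF uS z, of \<i>]]] by simp
    show "((\<lambda>t. s * p (m + of_real t * (- \<i>))) has_real_derivative (\<lambda>t. - s * dir_deriv \<i> p (m + of_real t * (- \<i>))) t) (at t)"
      using DERIV_cmult[OF rd[OF Ck_on_2D(1)[OF pS z]], of s] by simp
    show "((\<lambda>t. - s * dir_deriv \<i> p (m + of_real t * (- \<i>))) has_real_derivative (\<lambda>t. s * dir_deriv \<i> (dir_deriv \<i> p) (m + of_real t * (- \<i>))) t) (at t)"
      using DERIV_cmult[OF rd[OF Ck_on_2D(2)[OF pS z, of \<i>]], of "- s"] by simp
    have "- Re (Q ?z) = (dir_deriv \<i> u ?z)\<^sup>2 / 16 - dir_deriv \<i> (dir_deriv \<i> u) ?z / 4 - exp (u ?z) / 8"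
      unfolding Qre lap(1)[OF z] vert(1)[OF z hz] by (simp add: field_simps)
    then show "- Re (Q (m - \<i> * of_real t)) = (- dir_deriv \<i> u ?z)\<^sup>2 / 16 - dir_deriv \<i> (dir_deriv \<i> u) ?z / 4 - exp (u ?z) / 8"
      by (simp add: mult.commute)
    \<comment> \<open>The direction of the vertical edge has square -1, which reverses the sign of
      the potential and of its first order change; hence the parameter
      \<open>- \<epsilon>\<close>.\<close>
    have "- (4 * Re c) = 2 * dir_deriv \<i> (dir_deriv \<i> p) ?z - dir_deriv \<i> u ?z * dir_deriv \<i> p ?z + exp (u ?z) * p ?z"
      unfolding cS[OF z, symmetric] Lre lap(2)[OF z] vert(1,2)[OF z hz] by simp
    then have "- (s * (4 * Re c)) = s * (2 * dir_deriv \<i> (dir_deriv \<i> p) ?z - dir_deriv \<i> u ?z * dir_deriv \<i> p ?z + exp (u ?z) * p ?z)"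
      by (metis mult_minus_right)
    then show "2 * (s * dir_deriv \<i> (dir_deriv \<i> p) ?z) - (- dir_deriv \<i> u ?z) * (- s * dir_deriv \<i> p ?z) + exp (u ?z) * (s * p ?z) = - 8 * (- \<epsilon>)"
      unfolding s(2) by (simp add: algebra_simps)
  qed (use hor(1,2)[OF right_in[of 0]] hor(1,2)[OF right_in[of "b/2"]] in \<open>simp_all add: m_def\<close>)
  have "\<epsilon> = 0 \<and> s * p m = 0"
  proof (rule edges_rigid[OF b _ _ Qh[unfolded S_def] _ _ a(1) Q0, folded m_def])
    show "\<kappa> \<ge> 0" using \<eta> by (simp add: \<kappa>_def)
    show "sin (pi * \<kappa>) \<noteq> 0" using \<eta> by (simp add: \<kappa>_def distrib_left)
    show "Q z \<in> \<real>" if "z \<notin> lattice b" "Re z = 0 \<or> Re z = 1/2 \<or> Im z = 0 \<or> Im z = b/2" for z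
      using that vert(3)[of z] hor(3)[of z] by (auto simp: S_def complex_is_Real_iff)
    show "0 < (r/2)\<^sup>2" using r by simp
    show "edge_data (1/2) (\<lambda>t. Re (Q (m - of_real t))) \<epsilon> (u m) (s * p m)" by (rule top)
    show "edge_data (b/2) (\<lambda>t. - Re (Q (m - \<i> * of_real t))) (- \<epsilon>) (u m) (s * p m)" by (rule right)
    show "\<epsilon> = 0 \<or> \<epsilon> = 1" by (simp add: \<epsilon>_def)
  qed
  then have c0: "c = 0" and pm: "p m = 0" using s(1) by (auto simp: \<epsilon>_def split: if_splits)
  have Dpm: "Dz p m = 0"
    using vert(2)[OF mS] hor(2)[OF mS] by (simp add: Dz_def m_def complex_eq_iff)
  \<comment> \<open>Before its endpoint, a segment from the center to a point of the closed strip
    has real part strictly between 0 and 1, so it meets no lattice point, whatever its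
    height.\<close>
  have inside: "m + of_real t * (z - m) \<in> S"
    if t: "0 \<le> t" "t < 1" and z: "0 \<le> Re z" "Re z \<le> 1" for t z
  proof -
    have "\<bar>Re z - 1/2\<bar> \<le> 1/2" using z by linarith
    then have "\<bar>t\<bar> * \<bar>Re z - 1/2\<bar> \<le> t * (1/2)" using t by (intro mult_mono) auto
    then have "\<bar>t * (Re z - 1/2)\<bar> \<le> t * (1/2)" by (simp only: abs_mult)
    then have "\<bar>t * (Re z - 1/2)\<bar> < 1/2" using t by linarith
    then have h: "0 < 1/2 + t * (Re z - 1/2)" "1/2 + t * (Re z - 1/2) < 1" by linarith+
    have "1/2 + t * (Re z - 1/2) \<notin> \<int>" using h Ints_nonzero_abs_less1[of "1/2 + t * (Re z - 1/2)"] by auto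
    then show ?thesis using b by (simp add: S_def lattice_iff m_def)
  qed
  have strip: "p z = 0" if z: "0 \<le> Re z" "Re z \<le> 1" for z
  proof -
    have zero: "p (m + of_real t * (z - m)) = 0" if t: "t \<in> {0..<1}" for t
    proof (rule gradient_propagation[OF S uS pS eqS(2) _ _ pm Dpm])
      show "Dzz p z = Dz u z * Dz p z" if "z \<in> S" for z
        using cS[OF that] c0 by (simp add: L_def lin_potential_def)
      show "m + of_real t' * (of_real t * (z - m)) \<in> S" if "t' \<in> {0..1}" for t'
      proof -
        have "0 \<le> t' * t" "t' * t < 1" using that t mult_left_le_one_le[of t t'] by auto
        from inside[OF this z] show ?thesis by (simp add: mult.assoc)
      qed
    qed
    \<comment> \<open>The endpoint may be a lattice point, where u is singular; there
      \<open>p\<close> vanishes by continuity.\<close>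
    have "continuous_on UNIV p" by (rule has_grad_continuous_on[OF Ck_on_2D(1)[OF p(1)]])
    then have "continuous_on {0..1} (\<lambda>t. p (m + of_real t * (z - m)))"
      by (rule continuous_on_compose2) (auto intro!: continuous_intros)
    then have "continuous_on (closure {0..<1}) (\<lambda>t. p (m + of_real t * (z - m)))" by simp
    from continuous_constant_on_closure[OF this zero, of 1]
    show ?thesis by simp
  qed
  obtain w z' where w: "w \<in> lattice b" "z = z' + w" "0 \<le> Re z'" "Re z' \<le> 1"
    using lattice_reduce[OF b] by metis
  then have "p z = p z'" using p(2) by (simp add: periodic_on_def)
  then show ?thesis using strip w by simp
qed

theorem theorem1p6:
  fixes b \<rho> :: real and n :: nat and u :: "complex \<Rightarrow> real"
  assumes "b > 0"
    and "n \<ge> 1"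
    and "8 * pi * (real n - 1) < \<rho>" and "\<rho> < 8 * pi * real n"
    and "mean_field_solution b \<rho> u"
    and "axisymmetric_on (- lattice b) u"
  shows "\<forall>\<phi>. axisymmetric_linearized_solution b u \<phi> \<longleftrightarrow> (\<forall>z. \<phi> z = 0)"
proof (intro allI iffI)
  fix \<phi> z assume \<phi>: "axisymmetric_linearized_solution b u \<phi>"
  define \<eta> where "\<eta> = \<rho> / (8 * pi)"
  have \<eta>: "real n - 1 < \<eta>" "\<eta> < real n"
    using assms(3,4) by (simp_all add: \<eta>_def pos_less_divide_eq pos_divide_less_eq mult_ac)
  \<comment> \<open>The interval for \<rho> places \<eta> strictly between the consecutive integers
    n - 1 and n.\<close>
  have "sin (pi * \<eta>) \<noteq> 0"
  proof
    assume "sin (pi * \<eta>) = 0"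
    then obtain i :: int where "pi * \<eta> = of_int i * pi" using sin_zero_iff_int2 by blast
    then have "\<eta> = of_int i" by simp
    then have "of_int (int n - 1) < (of_int i :: real)" "(of_int i :: real) < of_int (int n)" using \<eta> by simp_all
    then have "int n - 1 < i" "i < int n" by (simp_all only: of_int_less_iff)
    then show False by linarith
  qed
  moreover have "\<eta> > 0" using \<eta> assms(2) by linarith
  moreover obtain v r where "r > 0" "Ck_on 2 (ball 0 r) v"
    "\<And>z. z \<in> ball 0 r - {0} \<Longrightarrow> u z = 4 * \<eta> * ln (norm z) + v z"
    using assms(5) unfolding mean_field_solution_def \<eta>_def by blast
  moreover have "laplacian \<phi> z + exp (u z) * \<phi> z = 0" if "z \<notin> lattice b" for z
    using \<phi> that unfolding axisymmetric_linearized_solution_def exp_ext_def by metis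
  ultimately show "\<phi> z = 0"
    using assms(1,5,6) \<phi> unfolding mean_field_solution_def axisymmetric_linearized_solution_def
    by (intro axisymmetric_kernel_trivial[of b \<eta> u r v \<phi> z]) auto
next
  fix \<phi> :: "complex \<Rightarrow> real" assume "\<forall>z. \<phi> z = 0"
  then have \<phi>: "\<phi> = (\<lambda>z. 0)" by auto
  have d: "dir_deriv d (\<lambda>z. 0) = (\<lambda>z. 0)" for d by (rule ext) (simp add: dir_deriv_def)
  have "Ck_on k UNIV (\<lambda>z. 0)" for k by (induction k) (simp_all add: d)
  then show "axisymmetric_linearized_solution b u \<phi>"
    unfolding \<phi> axisymmetric_linearized_solution_def
    by (simp add: periodic_on_def axisymmetric_on_def laplacian_def d)
qed

end
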